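(* Let $L$ be a finite dimensional Lie algebra over a field $F$ of characteristic $0$, graded by an arbitrary group $G$. Suppose that the solvable radical $R$ of $L$ is graded. Then there exists a maximal semisimple subalgebra $B$ of $L$ such that $L=B\oplus R$ is a direct sum of graded subspaces.
   Context: A Lie algebra $L$ is graded by a group $G$ if there is a fixed direct sum decomposition into subspaces $L=\bigoplus_{g\in G}L^{(g)}$ such that $[L^{(g)},L^{(h)}]\subseteq L^{(gh)}$ for all $g,h\in G$. A subspace $W\subseteq L$ is graded if $W=\bigoplus_{g\in G}(L^{(g)}\cap W)$. The solvable radical is the largest solvable ideal of $L$. The group $G$ may be infinite and non-Abelian. *)

theory Defs
  imports Complex_Main "HOL-Algebra.Group"
begin

locale lie_algebra = vector_space scale
  for scale :: "'f::field \<Rightarrow> 'v::ab_group_add \<Rightarrow> 'v" (infixr \<open>*s\<close> 75) +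
  fixes bracket :: "'v \<Rightarrow> 'v \<Rightarrow> 'v"
  assumes bracket_add_left: "bracket (x + y) z = bracket x z + bracket y z"
    and bracket_add_right: "bracket x (y + z) = bracket x y + bracket x z"
    and bracket_scale_left: "bracket (a *s x) y = a *s bracket x y"
    and bracket_scale_right: "bracket x (a *s y) = a *s bracket x y"
    and bracket_self: "bracket x x = 0"
    and jacobi: "bracket x (bracket y z) + bracket y (bracket z x) + bracket z (bracket x y) = 0"
begin

text \<open>The Lie algebra itself is the whole type; ideals, solvability and radicals are
  taken relative to a subalgebra, so that they also apply to subalgebras as Lie algebras
  in their own right.\<close>

definition finite_dimensional :: bool where
  "finite_dimensional \<longleftrightarrow> (\<exists>S. finite S \<and> span S = UNIV)"

definition lie_subalgebra :: "'v set \<Rightarrow> bool" where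
  "lie_subalgebra B \<longleftrightarrow> subspace B \<and> (\<forall>x\<in>B. \<forall>y\<in>B. bracket x y \<in> B)"

definition lie_ideal :: "'v set \<Rightarrow> 'v set \<Rightarrow> bool" where
  "lie_ideal B I \<longleftrightarrow> subspace I \<and> I \<subseteq> B \<and> (\<forall>x\<in>B. \<forall>y\<in>I. bracket x y \<in> I)"

definition derived_subalgebra :: "'v set \<Rightarrow> 'v set" where
  "derived_subalgebra B = span {bracket x y | x y. x \<in> B \<and> y \<in> B}"

definition lie_solvable :: "'v set \<Rightarrow> bool" where
  "lie_solvable B \<longleftrightarrow> (\<exists>n. (derived_subalgebra ^^ n) B = {0})"

definition is_solvable_radical :: "'v set \<Rightarrow> 'v set \<Rightarrow> bool" where
  "is_solvable_radical B R \<longleftrightarrow>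
     lie_ideal B R \<and> lie_solvable R \<and> (\<forall>I. lie_ideal B I \<and> lie_solvable I \<longrightarrow> I \<subseteq> R)"

text \<open>With this convention the zero algebra is semisimple.\<close>

definition semisimple_subalgebra :: "'v set \<Rightarrow> bool" where
  "semisimple_subalgebra B \<longleftrightarrow> lie_subalgebra B \<and> is_solvable_radical B {0}"

definition maximal_semisimple_subalgebra :: "'v set \<Rightarrow> bool" where
  "maximal_semisimple_subalgebra B \<longleftrightarrow>
     semisimple_subalgebra B \<and> (\<forall>C. semisimple_subalgebra C \<and> B \<subseteq> C \<longrightarrow> C = B)"

text \<open>The index set may be infinite, so an element is decomposed as a sum of components of
  which only finitely many are nonzero. Components outside the index set are fixed to be
  zero only to make the family unique as a function.\<close>

definition direct_sum_decomposition :: "'i set \<Rightarrow> ('i \<Rightarrow> 'v set) \<Rightarrow> 'v set \<Rightarrow> bool" where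
  "direct_sum_decomposition I V W \<longleftrightarrow>
     subspace W \<and> (\<forall>i\<in>I. subspace (V i) \<and> V i \<subseteq> W) \<and>
     (\<forall>x\<in>W. \<exists>!c. (\<forall>i\<in>I. c i \<in> V i) \<and> (\<forall>i. i \<notin> I \<longrightarrow> c i = 0) \<and>
        finite {i\<in>I. c i \<noteq> 0} \<and> x = (\<Sum>i\<in>{i\<in>I. c i \<noteq> 0}. c i))"

definition lie_grading :: "('g, 'm) monoid_scheme \<Rightarrow> ('g \<Rightarrow> 'v set) \<Rightarrow> bool" where
  "lie_grading G L \<longleftrightarrow>
     direct_sum_decomposition (carrier G) L UNIV \<and>
     (\<forall>g\<in>carrier G. \<forall>h\<in>carrier G. \<forall>x\<in>L g. \<forall>y\<in>L h. bracket x y \<in> L (g \<otimes>\<^bsub>G\<^esub> h))"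

definition graded_subspace ::
    "('g, 'm) monoid_scheme \<Rightarrow> ('g \<Rightarrow> 'v set) \<Rightarrow> 'v set \<Rightarrow> bool" where
  "graded_subspace G L W \<longleftrightarrow> direct_sum_decomposition (carrier G) (\<lambda>g. L g \<inter> W) W"

end

end

theory Submission
  imports Defs "HOL-Library.Function_Algebras" "HOL-Algebra.Algebraic_Closure_Type"
    "Jordan_Normal_Form.Jordan_Normal_Form_Existence"
begin

text \<open>A complement of an abelian ideal \<open>I\<close> that is a subalgebra is the kernel of a derivation \<open>p\<close>
  mapping into \<open>I\<close> and equal to the identity on \<open>I\<close>. If \<open>I\<close> is graded, the degree-preserving part of
  \<open>p\<close> is again such a derivation, even for non-abelian gradings, and its kernel is graded. Applied
  modulo \<open>[I,I]\<close> and iterated along the derived series of the radical, this reduces the theorem to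
  the existence of \<open>p\<close>, that is, to the vanishing of \<open>H\<^sup>2(S,V)\<close> for a semisimple Lie algebra \<open>S\<close> and a
  finite-dimensional module \<open>V\<close>. That is Whitehead's second lemma: for nontrivial irreducible \<open>V\<close> a
  Casimir operator is invertible and homotopic to zero; for trivial \<open>V\<close> a cocycle is given by a
  derivation through the Killing form, and derivations are inner. Nondegeneracy of the forms involved
  comes from Cartan's criterion, for which elements of a perfect subalgebra with zero trace form are
  shown to be nilpotent over the algebraic closure, and from Engel's theorem.\<close>


text \<open>Over an arbitrary field of characteristic 0 the eigenvalues need not lie in the field,
  and there is no complex conjugation for Cartan's criterion. Additive maps on the algebraic closure
  replace it: the sum of \<open>h lam * lam\<close> over the eigenvalues is 0 for every additive
  \<open>h\<close>, and a functional into the rationals turns this into a vanishing sum of squares.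
  Perfect subalgebras suffice: an ideal with zero form is either perfect or has a smaller derived
  ideal, and the descent ends with an abelian ideal.

  Working modulo \<open>[I,I]\<close> is what makes cohomology applicable, since \<open>U/I\<close>
  acts on \<open>I/[I,I]\<close> but in general not on \<open>I\<close>. The complement
  \<open>B\<close> obtained this way still meets \<open>I\<close> in \<open>[I,I]\<close>, so the
  next round takes place inside \<open>B\<close>, with \<open>[I,I]\<close> in the role of
  \<open>I\<close>.

  The map \<open>p\<close> is preferred to the complement itself because the conditions on
  \<open>p\<close> are affine. They survive passing to the degree-preserving part, which thus serves
  as the average that an infinite group does not provide.

  Complete reducibility is bypassed: a cocycle is split first modulo a submodule and then inside
  it.\<close>

context vector_space begin

section \<open>Generalized eigenvectors in invariant subspaces\<close>

lemma shift_preimage_mem: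
  assumes T: "Vector_Spaces.linear scale scale T" and Z: "subspace Z" "\<And>w. w \<in> Z \<Longrightarrow> T w \<in> Z"
    and "((\<lambda>w. T w - b *s w) ^^ m) w = 0" "T w - a *s w \<in> Z" "a \<noteq> b"
  shows "w \<in> Z"
  using assms(4,5)
proof (induction m arbitrary: w)
  case 0
  then show ?case using Z(1) by (simp add: subspace_0)
next
  case (Suc m)
  interpret T: Vector_Spaces.linear scale scale T by (rule T)
  let ?w = "T w - b *s w"
  have "((\<lambda>w. T w - b *s w) ^^ m) ?w = 0"
    using Suc.prems(1) by (simp add: funpow_Suc_right del: funpow.simps)
  moreover have "T ?w - a *s ?w = T (T w - a *s w) - b *s (T w - a *s w)"
    by (simp add: T.diff T.scale scale_right_diff_distrib scale_left_commute algebra_simps)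
  hence "T ?w - a *s ?w \<in> Z" using Z Suc.prems(2) by (simp add: subspace_diff subspace_scale)
  ultimately have "?w \<in> Z" by (rule Suc.IH)
  \<comment> \<open>Both terms lie in \<open>Z\<close>, the first by induction; \<open>T w\<close>
    cancels and a nonzero multiple of \<open>w\<close> remains.\<close>
  hence "?w - (T w - a *s w) \<in> Z" using Suc.prems(2) Z(1) by (blast intro: subspace_diff)
  hence "(a - b) *s w \<in> Z" by (simp add: scale_left_diff_distrib)
  hence "inverse (a - b) *s ((a - b) *s w) \<in> Z" by (rule subspace_scale[OF Z(1)])
  thus ?case using \<open>a \<noteq> b\<close> by simp
qed

lemma lin_iff:
  "Vector_Spaces.linear scale scale f \<longleftrightarrow>
     (\<forall>x y. f (x + y) = f x + f y) \<and> (\<forall>c x. f (c *s x) = c *s f x)"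
  unfolding Vector_Spaces.linear_iff using vector_space_axioms by blast

lemma linear_imp_module_hom: "Vector_Spaces.linear scale scale f \<Longrightarrow> Modules.module_hom scale scale f"
  by (simp add: Vector_Spaces.module_hom_iff_linear)

lemma linear_shift:
  "Vector_Spaces.linear scale scale T \<Longrightarrow> Vector_Spaces.linear scale scale (\<lambda>w. T w - a *s w)"
  by (simp add: lin_iff algebra_simps scale_left_commute)

lemma linear_funpow:
  "Vector_Spaces.linear scale scale T \<Longrightarrow> Vector_Spaces.linear scale scale (T ^^ k)"
  by (induction k) (simp_all add: lin_iff)

text \<open>Applying \<open>(T - c)^m\<close> kills the summand at \<open>c\<close> and preserves
  both \<open>Z\<close> and the other generalized eigenspaces, so induction on the set of
  eigenvalues applies to the images of the remaining summands. These are pulled back into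
  \<open>Z\<close> one factor \<open>T - c\<close> at a time by
  \<open>shift_preimage_mem\<close>.\<close>

lemma generalized_eigenvectors_mem:
  assumes T: "Vector_Spaces.linear scale scale T" and Z: "subspace Z" "\<And>w. w \<in> Z \<Longrightarrow> T w \<in> Z"
    and "finite S" "\<And>a. a \<in> S \<Longrightarrow> ((\<lambda>w. T w - a *s w) ^^ m) (w a) = 0"
    and "(\<Sum>a\<in>S. w a) \<in> Z"
  shows "\<forall>a\<in>S. w a \<in> Z"
  using assms(4-)
proof (induction S arbitrary: w rule: finite_induct)
  case empty thus ?case by simp
next
  case (insert c S)
  let ?D = "\<lambda>a w. T w - a *s w"
  interpret T: Vector_Spaces.linear scale scale T by (rule T)
  have lin: "Vector_Spaces.linear scale scale (?D a ^^ k)" for a k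
    by (intro linear_funpow linear_shift T)
  have DZ: "(?D c ^^ k) z \<in> Z" if "z \<in> Z" for k z
    using that by (induction k) (simp_all add: Z subspace_diff subspace_scale)
  have com1: "?D a (?D b z) = ?D b (?D a z)" for a b z
    by (simp add: T.diff T.scale scale_right_diff_distrib scale_left_commute algebra_simps)
  have com2: "?D a ((?D b ^^ k) z) = (?D b ^^ k) (?D a z)" for a b z k
    by (induction k arbitrary: z) (simp_all only: funpow.simps o_apply id_apply com1)
  have com: "(?D a ^^ j) ((?D b ^^ k) z) = (?D b ^^ k) ((?D a ^^ j) z)" for a b z j k
    by (induction j) (simp_all only: funpow.simps o_apply id_apply com2)
  have z0: "(?D a ^^ k) 0 = 0" for a k
    by (induction k) (simp_all add: T.zero)
  have "(\<Sum>a\<in>S. (?D c ^^ m) (w a)) = (?D c ^^ m) (\<Sum>a\<in>insert c S. w a)"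
    using insert
    by (simp add: Modules.module_hom.sum[OF linear_imp_module_hom[OF lin]] Modules.module_hom.add[OF linear_imp_module_hom[OF lin]])
  also have "\<dots> \<in> Z" using insert.prems by (intro DZ)
  finally have "\<forall>a\<in>S. (?D c ^^ m) (w a) \<in> Z"
  proof (rule insert.IH[rotated])
    fix a assume "a \<in> S"
    hence *: "(?D a ^^ m) (w a) = 0" using insert.prems(1) by blast
    show "(?D a ^^ m) ((?D c ^^ m) (w a)) = 0" by (subst com) (simp only: * z0)
  qed
  have aux: "z \<in> Z" if "(?D c ^^ k) z \<in> Z" "(?D a ^^ m) z = 0" "a \<noteq> c" for a k z
    using that(1,2)
  proof (induction k arbitrary: z)
    case (Suc k)
    have "?D c z \<in> Z"
      by (rule Suc.IH) (use Suc.prems in \<open>simp_all add: funpow_Suc_right com2[symmetric] T.zero del: funpow.simps\<close>)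
    thus ?case using Suc.prems(2) \<open>a \<noteq> c\<close> by - (rule shift_preimage_mem[OF T Z(1) Z(2), where m = m and b = a and w = z and a = c], auto)
  qed simp
  have *: "w a \<in> Z" if "a \<in> S" for a
    by (rule aux[where k = m and a = a]) (use that insert \<open>\<forall>a\<in>S. (?D c ^^ m) (w a) \<in> Z\<close> in auto)
  moreover have "w c = (\<Sum>a\<in>insert c S. w a) - (\<Sum>a\<in>S. w a)" using insert by simp
  hence "w c \<in> Z" using insert.prems(2) * Z(1) by (metis subspace_diff subspace_sum)
  ultimately show ?case by simp
qed

end

subsection \<open>Triangular form over algebraically closed fields\<close>

lemma vec_first_column_invertible:
  fixes v :: "'a :: field vec"
  assumes v: "v \<in> carrier_vec n" "v \<noteq> 0\<^sub>v n"
  shows "\<exists>P Q. P \<in> carrier_mat n n \<and> Q \<in> carrier_mat n n \<and> P * Q = 1\<^sub>m n \<and> Q * P = 1\<^sub>m n \<and> col P 0 = v"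
proof -
  obtain k where k: "k < n" "v $ k \<noteq> 0"
    using v by (metis eq_vecI carrier_vecD index_zero_vec)
  \<comment> \<open>The identity matrix with column 0 replaced by \<open>v\<close>; if
    \<open>k\<close> is not 0, the displaced unit vector moves to column \<open>k\<close>. The
    columns stay independent because \<open>v $ k\<close> is nonzero.\<close>
  define P where "P = mat n n (\<lambda>(i,j). if j = 0 then v $ i
     else if j = k then (if i = 0 then 1 else 0) else (if i = j then 1 else 0))"
  have P: "P \<in> carrier_mat n n" by (simp add: P_def)
  have "det P \<noteq> 0"
  proof
    assume "det P = 0"
    then obtain w where w: "w \<in> carrier_vec n" "w \<noteq> 0\<^sub>v n" "P *\<^sub>v w = 0\<^sub>v n"
      using det_0_iff_vec_prod_zero_field[OF P] by blast
    have row: "(\<Sum>j<n. P $$ (i,j) * w $ j) = 0" if "i < n" for i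
    proof -
      have "(P *\<^sub>v w) $ i = 0" using w(3) that by simp
      thus ?thesis using that P w(1) by (simp add: scalar_prod_def lessThan_atLeast0)
    qed
    have n0: "0 < n" using k by simp
    have split: "(\<Sum>j<n. P $$ (i,j) * w $ j) = v $ i * w $ 0 +
        (\<Sum>j\<in>{0<..<n}. P $$ (i,j) * w $ j)" if "i < n" for i
    proof -
      have "{..<n} = insert 0 {0<..<n}" using n0 by auto
      thus ?thesis using that n0 by (simp add: P_def)
    qed
    have rk: "w $ 0 = 0"
    proof -
      have "(\<Sum>j\<in>{0<..<n}. P $$ (k,j) * w $ j) = 0" if "k \<noteq> 0"
        by (rule sum.neutral) (use that k in \<open>auto simp: P_def\<close>)
      moreover have "(\<Sum>j\<in>{0<..<n}. P $$ (k,j) * w $ j) = 0" if "k = 0"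
        by (rule sum.neutral) (use that k in \<open>auto simp: P_def\<close>)
      ultimately show ?thesis using row[OF k(1)] split[OF k(1)] k(2) by (cases "k = 0") auto
    qed
    have ri: "w $ i = 0" if "i < n" "i \<noteq> 0" "i \<noteq> k" for i
    proof -
      have "(\<Sum>j\<in>{0<..<n}. P $$ (i,j) * w $ j) = (\<Sum>j\<in>{0<..<n}. if j = i then w $ i else 0)"
        by (rule sum.cong) (use that k in \<open>auto simp: P_def\<close>)
      also have "\<dots> = w $ i" using that by simp
      finally show ?thesis using row[OF that(1)] split[OF that(1)] rk by simp
    qed
    have "w $ k = 0"
    proof (cases "k = 0")
      case False
      have "(\<Sum>j\<in>{0<..<n}. P $$ (0,j) * w $ j) = (\<Sum>j\<in>{0<..<n}. if j = k then w $ k else 0)"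
        by (rule sum.cong) (use k n0 in \<open>auto simp: P_def\<close>)
      also have "\<dots> = w $ k" using k False by simp
      finally show ?thesis using row[OF n0] split[OF n0] rk by simp
    qed (use rk in simp)
    with rk ri have "w = 0\<^sub>v n" using w(1) by (intro eq_vecI) (metis carrier_vecD index_zero_vec, simp)
    with w(2) show False by simp
  qed
  from det_non_zero_imp_unit[OF P this, of "()"] obtain Q
    where Q: "Q \<in> carrier_mat n n" "Q * P = 1\<^sub>m n" "P * Q = 1\<^sub>m n"
    unfolding Units_def ring_mat_def by auto
  moreover have "col P 0 = v" using v k by (intro eq_vecI) (auto simp: P_def)
  ultimately show ?thesis using P by blast
qed

text \<open>Taking an eigenvector as first basis vector gives a block triangular matrix whose lower
  block is handled by induction. Triangular form is the input that
  \<open>triangular_to_jnf_vector\<close> needs.\<close>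

lemma triangularizable:
  fixes A :: "'a :: alg_closed_field mat"
  assumes "A \<in> carrier_mat n n"
  shows "\<exists>U\<in>carrier_mat n n. upper_triangular U \<and> similar_mat A U"
  using assms
proof (induction n arbitrary: A)
  case 0
  thus ?case by (intro bexI[of _ A]) (auto intro: similar_mat_refl)
next
  case (Suc n)
  have "Polynomial.degree (char_poly A) = Suc n" using degree_monic_char_poly[OF Suc.prems] by simp
  hence "\<exists>e. poly (char_poly A) e = 0" by (intro alg_closed_imp_poly_has_root) simp
  then obtain e where "eigenvalue A e" using eigenvalue_root_char_poly[OF Suc.prems] by blast
  then obtain v where v: "v \<in> carrier_vec (Suc n)" "v \<noteq> 0\<^sub>v (Suc n)" "A *\<^sub>v v = e \<cdot>\<^sub>v v"
    using Suc.prems unfolding eigenvalue_def eigenvector_def by auto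
  obtain P Q where PQ: "P \<in> carrier_mat (Suc n) (Suc n)" "Q \<in> carrier_mat (Suc n) (Suc n)"
      "P * Q = 1\<^sub>m (Suc n)" "Q * P = 1\<^sub>m (Suc n)" "col P 0 = v"
    using vec_first_column_invertible[OF v(1,2)] by blast
  define B where "B = Q * A * P"
  have B: "B \<in> carrier_mat (Suc n) (Suc n)" using PQ Suc.prems by (simp add: B_def)
  have "P * B * Q = (P * Q) * A * (P * Q)"
    unfolding B_def using PQ(1,2) Suc.prems by (simp add: assoc_mult_mat[of _ "Suc n" "Suc n" _ "Suc n" _ "Suc n"])
  hence "A = P * B * Q" using PQ Suc.prems by simp
  hence AB: "similar_mat A B"
    using PQ Suc.prems B by (intro similar_matI[of _ _ P Q "Suc n"]) auto
  have "B = Q * (A * P)" unfolding B_def using PQ Suc.prems by (intro assoc_mult_mat) auto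
  hence "col B 0 = Q *\<^sub>v col (A * P) 0" using PQ Suc.prems by (simp add: col_mult2[of _ "Suc n" "Suc n" _ "Suc n"])
  also have "col (A * P) 0 = A *\<^sub>v v"
    unfolding PQ(5)[symmetric] using PQ Suc.prems by (intro col_mult2) auto
  also have "Q *\<^sub>v (A *\<^sub>v v) = e \<cdot>\<^sub>v (Q *\<^sub>v col P 0)" using v PQ by (simp add: mult_mat_vec)
  also have "Q *\<^sub>v col P 0 = col (Q * P) 0" using PQ(1,2) by (intro col_mult2[symmetric]) auto
  also have "\<dots> = unit_vec (Suc n) 0" using PQ by simp
  finally have col: "col B 0 = e \<cdot>\<^sub>v unit_vec (Suc n) 0" .
  have B0: "B $$ (i, 0) = 0" if "0 < i" "i < Suc n" for i
  proof -
    have "B $$ (i, 0) = col B 0 $ i" using B that by simp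
    thus ?thesis unfolding col using that by simp
  qed
  obtain B1 B2 B3 B4 where split: "split_block B 1 1 = (B1, B2, B3, B4)"
    by (metis prod_cases4)
  have d: "dim_row B = 1 + n" "dim_col B = 1 + n" using B by auto
  note sb = split_block[OF split d]
  have "B3 = 0\<^sub>m n 1"
    using split B B0 unfolding split_block_def Let_def by (intro eq_matI) auto
  hence Bb: "B = four_block_mat B1 B2 (0\<^sub>m n 1) B4" using sb by simp
  obtain U where U: "U \<in> carrier_mat n n" "upper_triangular U" "similar_mat B4 U"
    using Suc.IH[of B4] sb by auto
  obtain B0 where B0: "B0 \<in> carrier_mat 1 n" "similar_mat B (four_block_mat B1 B0 (0\<^sub>m n 1) U)"
    using similar_mat_four_block_0_ex[OF similar_mat_refl[OF sb(1)] U(3) sb(2) sb(1) sb(4)] Bb by auto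
  have "upper_triangular (four_block_mat B1 B0 (0\<^sub>m n 1) U)"
    using sb(1) U(1,2) B0(1) by (auto simp: upper_triangular_def)
  moreover have "four_block_mat B1 B0 (0\<^sub>m n 1) U \<in> carrier_mat (Suc n) (Suc n)"
    using four_block_carrier_mat[OF sb(1) U(1)] by simp
  ultimately show ?case using similar_mat_trans[OF AB B0(2)] by blast
qed

text \<open>Off-diagonal ones occur only inside a Jordan block, where the eigenvalue is constant. So
  the nilpotent part commutes with the diagonal part, which is what the locale
  \<open>jordan_form\<close> assumes.\<close>

lemma jordan_matrix_offdiag:
  assumes "i < sum_list (map fst nas)" "j < sum_list (map fst nas)" "i \<noteq> j"
    and "jordan_matrix nas $$ (i,j) \<noteq> (0 :: 'a :: {zero,one})"
  shows "i < j \<and> jordan_matrix nas $$ (i,i) = jordan_matrix nas $$ (j,j)"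
  using assms
proof (induction nas arbitrary: i j)
  case (Cons na nas)
  obtain n a where na: "na = (n, a)" by force
  let ?s = "sum_list (map fst nas)"
  show ?case
  proof (cases "i < n \<or> j < n")
    case True
    thus ?thesis using Cons.prems unfolding na jordan_matrix_Cons
      by (auto simp: jordan_block_def split: if_splits)
  next
    case False
    then obtain i' j' where "i = n + i'" "j = n + j'" using le_Suc_ex[of n i] le_Suc_ex[of n j] by auto
    thus ?thesis using Cons.prems Cons.IH[of i' j'] by (simp add: na jordan_matrix_Cons)
  qed
qed simp

subsection \<open>Replicas\<close>

text \<open>The operator \<open>T\<close> below is \<open>ad J\<close> for \<open>J = diag lam + N\<close>, in matrix coordinates. Replacing the
  eigenvalues \<open>lam\<close> by their images under an additive map gives a replica of \<open>J\<close>: it leaves invariant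
  every subspace invariant under \<open>ad J\<close>.\<close>

locale jordan_form =
  fixes n :: nat and lam :: "nat \<Rightarrow> 'a :: field" and N :: "nat \<Rightarrow> nat \<Rightarrow> 'a"
  assumes N: "N i k \<noteq> 0 \<Longrightarrow> i < k \<and> k < n \<and> lam i = lam k"
begin

definition T :: "(nat \<Rightarrow> nat \<Rightarrow> 'a) \<Rightarrow> nat \<Rightarrow> nat \<Rightarrow> 'a" where
  "T W i j = (lam i - lam j) * W i j + (\<Sum>k<n. N i k * W k j) - (\<Sum>k<n. W i k * N k j)"

abbreviation (input) fscale :: "'a \<Rightarrow> (nat \<Rightarrow> nat \<Rightarrow> 'a) \<Rightarrow> nat \<Rightarrow> nat \<Rightarrow> 'a" where
  "fscale c W \<equiv> (\<lambda>i j. c * W i j)"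

sublocale F: vector_space fscale
  by unfold_locales (auto simp: fun_eq_iff algebra_simps)

lemma linear_T: "Vector_Spaces.linear fscale fscale T"
  by (simp add: F.lin_iff T_def fun_eq_iff algebra_simps sum.distrib sum_distrib_left)

text \<open>Split \<open>W\<close> into the parts \<open>C a\<close> supported where
  \<open>lam i - lam j = a\<close>. They are generalized eigenvectors of \<open>T\<close>, so
  \<open>Z\<close> contains each of them; adding them up again with weights \<open>h a\<close> gives
  the replica.\<close>

lemma replica_mem:
  assumes Z: "F.subspace Z" "\<And>W. W \<in> Z \<Longrightarrow> T W \<in> Z"
    and W: "W \<in> Z" "\<And>i j. W i j \<noteq> 0 \<Longrightarrow> i < n \<and> j < n"
    and h: "\<And>a b. h (a - b) = h a - h b"
  shows "(\<lambda>i j. (h (lam i) - h (lam j)) * W i j) \<in> Z"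
proof -
  define S where "S = (\<lambda>(i,j). lam i - lam j) ` ({..<n} \<times> {..<n})"
  define C where "C a = (\<lambda>i j. if i < n \<and> j < n \<and> lam i - lam j = a then W i j else 0)" for a
  have finS: "finite S" by (simp add: S_def)
  \<comment> \<open>On the support of \<open>C a\<close> the diagonal contribution of
    \<open>T\<close> cancels against \<open>a\<close>, and the terms with \<open>N\<close> move
    entries at least one diagonal to the upper right. The bound \<open>i + k < n + j\<close> records
    this; as \<open>j < n\<close>, nothing survives \<open>2 * n\<close> steps.\<close>
  have supp: "((\<lambda>W. T W - fscale a W) ^^ k) (C a) i j \<noteq> 0 \<Longrightarrow>
      i < n \<and> j < n \<and> lam i - lam j = a \<and> i + k < n + j" for a k i j
  proof (induction k arbitrary: i j)
    case 0
    thus ?case by (auto simp: C_def split: if_splits)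
  next
    case (Suc k)
    define f where "f = ((\<lambda>W. T W - fscale a W) ^^ k) (C a)"
    have IH: "f i j \<noteq> 0 \<Longrightarrow> i < n \<and> j < n \<and> lam i - lam j = a \<and> i + k < n + j" for i j
      using Suc.IH unfolding f_def by blast
    have "((\<lambda>W. T W - fscale a W) ^^ Suc k) (C a) i j = (T f - fscale a f) i j"
      by (simp only: funpow.simps o_apply f_def)
    hence "(T f - fscale a f) i j \<noteq> 0" using Suc.prems by (simp only: not_False_eq_True)
    hence "T f i j - a * f i j \<noteq> 0" by simp
    hence "(lam i - lam j - a) * f i j + (\<Sum>k<n. N i k * f k j) - (\<Sum>k<n. f i k * N k j) \<noteq> 0"
      by (simp add: T_def algebra_simps)
    moreover have "(lam i - lam j - a) * f i j = 0" using IH[of i j] by auto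
    ultimately have "(\<exists>k<n. N i k * f k j \<noteq> 0) \<or> (\<exists>k<n. f i k * N k j \<noteq> 0)"
      by (metis (no_types, lifting) add.right_neutral diff_zero lessThan_iff sum.neutral)
    thus ?case
    proof (elim disjE exE conjE)
      fix l assume "N i l * f l j \<noteq> 0"
      thus ?thesis using N[of i l] IH[of l j] by auto
    next
      fix l assume "f i l * N l j \<noteq> 0"
      thus ?thesis using N[of l j] IH[of i l] by auto
    qed
  qed
  have nil: "((\<lambda>W. T W - fscale a W) ^^ (2 * n)) (C a) = 0" for a
  proof (intro ext)
    fix i j
    show "((\<lambda>W. T W - fscale a W) ^^ (2 * n)) (C a) i j = 0 i j"
      using supp[of "2 * n" a i j] by fastforce
  qed
  have sumC: "(\<Sum>a\<in>S. fscale (c a) (C a)) = (\<lambda>i j. c (lam i - lam j) * W i j)" for c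
  proof (intro ext)
    fix i j
    have "(\<Sum>a\<in>S. fscale (c a) (C a)) i j = (\<Sum>a\<in>S. c a * C a i j)"
      by (induction S rule: infinite_finite_induct) auto
    also have "\<dots> = (\<Sum>a\<in>S. if a = lam i - lam j then c a * W i j else 0)"
      using W(2)[of i j] by (intro sum.cong) (auto simp: C_def)
    also have "\<dots> = c (lam i - lam j) * W i j"
      using W(2)[of i j] finS by (auto simp: S_def)
    finally show "(\<Sum>a\<in>S. fscale (c a) (C a)) i j = c (lam i - lam j) * W i j" .
  qed
  have "(\<Sum>a\<in>S. C a) \<in> Z" using sumC[of "\<lambda>_. 1"] W(1) by simp
  from F.generalized_eigenvectors_mem[OF linear_T Z finS nil this]
  have "C a \<in> Z" if "a \<in> S" for a using that by blast
  hence "(\<Sum>a\<in>S. fscale (h a) (C a)) \<in> Z" by (intro F.subspace_sum F.subspace_scale Z(1))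
  thus ?thesis by (simp add: sumC h)
qed

end


section \<open>Nilpotency from vanishing traces\<close>

definition mtr :: "'a :: comm_ring_1 mat \<Rightarrow> 'a" where
  "mtr A = (\<Sum>i<dim_row A. A $$ (i,i))"

lemma mtr_mult:
  assumes "A \<in> carrier_mat n m" "B \<in> carrier_mat m n"
  shows "mtr (A * B) = (\<Sum>i<n. \<Sum>j<m. A $$ (i,j) * B $$ (j,i))"
  using assms by (simp add: mtr_def scalar_prod_def lessThan_atLeast0)

lemma mtr_comm:
  assumes "A \<in> carrier_mat n m" "B \<in> carrier_mat m n"
  shows "mtr (A * B) = mtr (B * A)"
  unfolding mtr_mult[OF assms] mtr_mult[OF assms(2,1)]
  by (subst sum.swap) (simp add: mult.commute)

lemma commutator_pow_carrier:
  assumes "A \<in> carrier_mat n n" "B \<in> carrier_mat n n"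
  shows "((\<lambda>W. A * W - W * A) ^^ k) (B :: 'a :: comm_ring_1 mat) \<in> carrier_mat n n"
  using assms by (induction k) auto

text \<open>The matrices all of whose iterated commutators with \<open>J\<close> have trace zero
  against \<open>E\<close> form a subspace invariant under \<open>ad J\<close>. It contains
  \<open>B\<close>, hence also the replica of \<open>ad J\<close> applied to \<open>B\<close>; the
  zeroth iterate is the claim.\<close>

lemma replica_trace:
  fixes J :: "'a :: field mat"
  assumes J: "J \<in> carrier_mat n n"
    and off: "\<And>i j. i < n \<Longrightarrow> j < n \<Longrightarrow> i \<noteq> j \<Longrightarrow> J $$ (i,j) \<noteq> 0 \<Longrightarrow> i < j \<and> J $$ (i,i) = J $$ (j,j)"
    and E: "E \<in> carrier_mat n n" and B: "B \<in> carrier_mat n n"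
    and tr: "\<And>k. mtr (E * ((\<lambda>W. J * W - W * J) ^^ k) B) = 0"
    and h: "\<And>a b. h (a - b) = h a - h b"
  shows "(\<Sum>i<n. \<Sum>j<n. E $$ (j,i) * ((h (J $$ (i,i)) - h (J $$ (j,j))) * B $$ (i,j))) = 0"
proof -
  define N where "N i k = (if i < n \<and> k < n \<and> i \<noteq> k then J $$ (i,k) else 0)" for i k
  interpret jordan_form n "\<lambda>i. J $$ (i,i)" N
    by unfold_locales (use off in \<open>auto simp: N_def split: if_splits\<close>)
  \<comment> \<open>Matrices of all sizes share one type, which is no vector space; extension by
    zero turns them into functions on pairs of indices.\<close>
  define f where "f M i j = (if i < n \<and> j < n then M $$ (i,j) else 0)" for M :: "'a mat" and i j
  define l where "l W = (\<Sum>i<n. \<Sum>j<n. E $$ (j,i) * W i j)" for W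
  have lf: "l (f M) = mtr (E * M)" if "M \<in> carrier_mat n n" for M
    unfolding mtr_mult[OF E that] l_def f_def by (subst sum.swap) simp
  have Tf: "f (J * M - M * J) = T (f M)" if M: "M \<in> carrier_mat n n" for M
  proof (intro ext)
    fix i j
    show "f (J * M - M * J) i j = T (f M) i j"
    proof (cases "i < n \<and> j < n")
      case True
      have "(\<Sum>k<n. J $$ (i,k) * M $$ (k,j)) = J $$ (i,i) * M $$ (i,j) + (\<Sum>k<n. N i k * f M k j)"
      proof -
        have "(\<Sum>k<n. J $$ (i,k) * M $$ (k,j)) = J $$ (i,i) * M $$ (i,j) + (\<Sum>k\<in>{..<n} - {i}. J $$ (i,k) * M $$ (k,j))"
          using True by (intro sum.remove) auto
        also have "(\<Sum>k\<in>{..<n} - {i}. J $$ (i,k) * M $$ (k,j)) = (\<Sum>k<n. N i k * f M k j)"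
          using True by (intro sum.mono_neutral_cong_left) (auto simp: N_def f_def)
        finally show ?thesis .
      qed
      moreover have "(\<Sum>k<n. M $$ (i,k) * J $$ (k,j)) = M $$ (i,j) * J $$ (j,j) + (\<Sum>k<n. f M i k * N k j)"
      proof -
        have "(\<Sum>k<n. M $$ (i,k) * J $$ (k,j)) = M $$ (i,j) * J $$ (j,j) + (\<Sum>k\<in>{..<n} - {j}. M $$ (i,k) * J $$ (k,j))"
          using True by (intro sum.remove) auto
        also have "(\<Sum>k\<in>{..<n} - {j}. M $$ (i,k) * J $$ (k,j)) = (\<Sum>k<n. f M i k * N k j)"
          using True by (intro sum.mono_neutral_cong_left) (auto simp: N_def f_def)
        finally show ?thesis .
      qed
      moreover have "f (J * M - M * J) i j =
          (\<Sum>k<n. J $$ (i,k) * M $$ (k,j)) - (\<Sum>k<n. M $$ (i,k) * J $$ (k,j))"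
        using True J M by (simp add: f_def scalar_prod_def lessThan_atLeast0)
      ultimately show ?thesis using True by (simp add: T_def f_def algebra_simps)
    next
      case False
      thus ?thesis by (auto simp: T_def f_def N_def intro!: sum.neutral)
    qed
  qed
  have Tfk: "(T ^^ k) (f B) = f (((\<lambda>W. J * W - W * J) ^^ k) B)" for k
    by (induction k) (simp_all add: Tf commutator_pow_carrier[OF J B])
  define Z where "Z = {W. \<forall>k. l ((T ^^ k) W) = 0}"
  have l_lin: "l (V + W) = l V + l W" "l (fscale c W) = c * l W" for V W c
    by (simp_all add: l_def sum.distrib sum_distrib_left algebra_simps)
  have Tk_lin: "(T ^^ k) (V + W) = (T ^^ k) V + (T ^^ k) W" "(T ^^ k) (fscale c W) = fscale c ((T ^^ k) W)" for k V W c
    using F.linear_funpow[OF linear_T, of k] unfolding F.lin_iff by blast+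
  have "F.subspace Z"
  proof (rule F.subspaceI)
    show "0 \<in> Z"
      using Tk_lin(2)[of _ 0 0] l_lin(2)[of 0 0] by (simp add: Z_def zero_fun_def)
  qed (simp_all add: Z_def l_lin Tk_lin)
  moreover have "T W \<in> Z" if "W \<in> Z" for W
  proof -
    have "l ((T ^^ k) (T W)) = 0" for k
    proof -
      have "l ((T ^^ Suc k) W) = 0" using that unfolding Z_def by blast
      thus ?thesis by (simp only: funpow_Suc_right o_apply)
    qed
    thus ?thesis by (simp add: Z_def)
  qed
  moreover have "f B \<in> Z"
    by (simp add: Z_def Tfk lf commutator_pow_carrier[OF J B] tr)
  ultimately have "(\<lambda>i j. (h (J $$ (i,i)) - h (J $$ (j,j))) * f B i j) \<in> Z"
    by (rule replica_mem[OF _ _ _ _ h]) (auto simp: f_def split: if_splits)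
  hence "l (\<lambda>i j. (h (J $$ (i,i)) - h (J $$ (j,j))) * f B i j) = 0"
    by (auto simp: Z_def dest: spec[of _ 0])
  thus ?thesis by (simp add: l_def f_def)
qed

text \<open>Complete \<open>a\<close> to a basis over the rationals. Rational values matter because
  a sum of rational squares vanishes only if every term does.\<close>

lemma rational_functional:
  fixes a :: "'a :: field_char_0"
  assumes "a \<noteq> 0"
  shows "\<exists>h :: 'a \<Rightarrow> rat. (\<forall>x y. h (x - y) = h x - h y) \<and> (\<forall>q x. h (x * of_rat q) = h x * q) \<and> h a \<noteq> 0"
proof -
  interpret A: vector_space "\<lambda>q (x :: 'a). of_rat q * x"
    by unfold_locales (simp_all add: algebra_simps of_rat_add of_rat_mult)
  interpret Q: vector_space "\<lambda>q x :: rat. q * x"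
    by unfold_locales (simp_all add: algebra_simps)
  interpret AQ: vector_space_pair "\<lambda>q (x :: 'a). of_rat q * x" "\<lambda>q x :: rat. q * x" ..
  have "\<not> A.dependent {a}" using assms by simp
  then obtain h where h: "Vector_Spaces.linear (\<lambda>q (x :: 'a). of_rat q * x) (\<lambda>q x :: rat. q * x) h" "h a = 1"
    using AQ.linear_independent_extend[of "{a}" "\<lambda>_. 1"] by auto
  hence "\<forall>x y. h (x - y) = h x - h y" by (simp add: AQ.linear_diff)
  moreover have "h (x * of_rat q) = h x * q" for q x
    using h(1) unfolding Vector_Spaces.linear_iff by (metis mult.commute)
  ultimately show ?thesis using h(2) by (intro exI[of _ h]) simp
qed


text \<open>In Jordan form, vanishing replica traces say that the sum of \<open>h lam * lam\<close>
  over the eigenvalues is 0 for every additive \<open>h\<close>. Rational functionals then force all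
  eigenvalues to be 0.\<close>

lemma commutator_trace_nilpotent_alg_closed:
  fixes A :: "'a :: {alg_closed_field, field_char_0} mat"
  assumes A: "A \<in> carrier_mat n n"
    and EB: "\<And>l. l < m \<Longrightarrow> E l \<in> carrier_mat n n" "\<And>l. l < m \<Longrightarrow> B l \<in> carrier_mat n n"
    and sum: "\<And>i j. i < n \<Longrightarrow> j < n \<Longrightarrow> A $$ (i,j) = (\<Sum>l<m. (E l * B l - B l * E l) $$ (i,j))"
    and tr: "\<And>l k. l < m \<Longrightarrow> mtr (E l * ((\<lambda>W. A * W - W * A) ^^ k) (B l)) = 0"
  shows "A ^\<^sub>m n = 0\<^sub>m n n"
proof -
  obtain U where U: "U \<in> carrier_mat n n" "upper_triangular U" "similar_mat A U"
    using triangularizable[OF A] by blast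
  define J where "J = jordan_matrix (triangular_to_jnf_vector U)"
  have "similar_mat A J"
    using similar_mat_trans[OF U(3)] triangular_to_jnf_vector[OF U(1,2)] unfolding J_def jordan_nf_def by blast
  then obtain P Q where wit: "similar_mat_wit A J P Q" unfolding similar_mat_def by blast
  note w = similar_mat_witD2[OF A wit]
  note J = w(5)
  note PQ = w(6,7)
  have s: "sum_list (map fst (triangular_to_jnf_vector U)) = n" using carrier_matD(1)[OF J] by (simp add: J_def)
  note off = jordan_matrix_offdiag[of _ "triangular_to_jnf_vector U", unfolded s, folded J_def]
  define c where "c M = Q * M * P" for M
  have c: "c M \<in> carrier_mat n n" if "M \<in> carrier_mat n n" for M using PQ that by (simp add: c_def)
  note as = assoc_mult_mat[of _ n n _ n _ n]
  have c_mult: "c (M * M') = c M * c M'" if M: "M \<in> carrier_mat n n" "M' \<in> carrier_mat n n" for M M'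
  proof -
    have "c M * c M' = Q * (M * ((P * Q) * (M' * P)))" unfolding c_def using PQ M by (simp add: as)
    also have "\<dots> = c (M * M')" unfolding w(1) c_def using PQ M by (simp add: as)
    finally show ?thesis by simp
  qed
  have c_diff: "c (M - M') = c M - c M'" if M: "M \<in> carrier_mat n n" "M' \<in> carrier_mat n n" for M M'
    unfolding c_def using PQ M by (simp add: mult_minus_distrib_mat[of _ n n _ n] minus_mult_distrib_mat[of _ n n _ _ n])
  have cA: "c A = J"
  proof -
    have "c A = (Q * P) * (J * (Q * P))" unfolding c_def w(3) using PQ J by (simp add: as)
    thus ?thesis unfolding w(2) using J by simp
  qed
  have c_tr: "mtr (c M) = mtr M" if M: "M \<in> carrier_mat n n" for M
  proof -
    have "mtr (c M) = mtr (Q * (M * P))" unfolding c_def using PQ M by (simp add: as)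
    also have "\<dots> = mtr ((M * P) * Q)" using PQ M by (intro mtr_comm) auto
    also have "(M * P) * Q = M * (P * Q)" using PQ M by (simp add: as)
    finally show ?thesis unfolding w(1) using M by simp
  qed
  have c_ad: "((\<lambda>W. J * W - W * J) ^^ k) (c M) = c (((\<lambda>W. A * W - W * A) ^^ k) M)" if M: "M \<in> carrier_mat n n" for M k
  proof (induction k)
    case (Suc k)
    let ?W = "((\<lambda>W. A * W - W * A) ^^ k) M"
    have W: "?W \<in> carrier_mat n n" by (rule commutator_pow_carrier[OF A M])
    have "c (A * ?W - ?W * A) = c (A * ?W) - c (?W * A)" using A W by (intro c_diff) auto
    thus ?case using Suc by (simp add: c_mult[OF A W] c_mult[OF W A] cA)
  qed simp
  have c_entry: "c M $$ (i,j) = (\<Sum>a<n. \<Sum>b<n. Q $$ (i,a) * (M $$ (a,b) * P $$ (b,j)))"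
    if "M \<in> carrier_mat n n" "i < n" "j < n" for M i j
    using that PQ by (simp add: c_def scalar_prod_def lessThan_atLeast0 sum_distrib_left)
  have Jsum: "J $$ (i,j) = (\<Sum>l<m. (c (E l) * c (B l) - c (B l) * c (E l)) $$ (i,j))" if ij: "i < n" "j < n" for i j
  proof -
    have "J $$ (i,j) = (\<Sum>a<n. \<Sum>b<n. Q $$ (i,a) * ((\<Sum>l<m. (E l * B l - B l * E l) $$ (a,b)) * P $$ (b,j)))"
      unfolding cA[symmetric] c_entry[OF A ij] by (intro sum.cong refl arg_cong2[where f = "(*)"]) (simp_all add: sum)
    also have "\<dots> = (\<Sum>a<n. \<Sum>b<n. \<Sum>l<m. Q $$ (i,a) * ((E l * B l - B l * E l) $$ (a,b) * P $$ (b,j)))"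
      by (simp only: sum_distrib_left sum_distrib_right)
    also have "\<dots> = (\<Sum>l<m. \<Sum>a<n. \<Sum>b<n. Q $$ (i,a) * ((E l * B l - B l * E l) $$ (a,b) * P $$ (b,j)))"
      by (subst (2) sum.swap, subst sum.swap, rule refl)
    also have "\<dots> = (\<Sum>l<m. c (E l * B l - B l * E l) $$ (i,j))"
      using EB by (intro sum.cong refl c_entry[OF minus_carrier_mat[OF mult_carrier_mat[of _ n n _ n]] ij, symmetric]) auto
    also have "\<dots> = (\<Sum>l<m. (c (E l) * c (B l) - c (B l) * c (E l)) $$ (i,j))"
    proof (rule sum.cong[OF refl])
      fix l assume "l \<in> {..<m}"
      hence l: "E l \<in> carrier_mat n n" "B l \<in> carrier_mat n n" using EB by auto
      hence "c (E l * B l - B l * E l) = c (E l * B l) - c (B l * E l)" by (intro c_diff) auto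
      thus "c (E l * B l - B l * E l) $$ (i,j) = (c (E l) * c (B l) - c (B l) * c (E l)) $$ (i,j)"
        by (simp add: c_mult[OF l] c_mult[OF l(2,1)])
    qed
    finally show ?thesis .
  qed
  have key: "(\<Sum>i<n. h (J $$ (i,i)) * J $$ (i,i)) = 0" if h: "\<And>a b. h (a - b) = h a - h b" for h :: "'a \<Rightarrow> 'a"
  proof -
    have 0: "(\<Sum>i<n. \<Sum>j<n. c (E l) $$ (j,i) * ((h (J $$ (i,i)) - h (J $$ (j,j))) * c (B l) $$ (i,j))) = 0" if l: "l < m" for l
    proof (rule replica_trace[OF J _ c[OF EB(1)[OF l]] c[OF EB(2)[OF l]] _ h])
      show "mtr (c (E l) * ((\<lambda>W. J * W - W * J) ^^ k) (c (B l))) = 0" for k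
        unfolding c_ad[OF EB(2)[OF l]]
        unfolding c_mult[OF EB(1)[OF l] commutator_pow_carrier[OF A EB(2)[OF l]], symmetric]
        by (simp add: c_tr mult_carrier_mat[OF EB(1)[OF l] commutator_pow_carrier[OF A EB(2)[OF l]]] tr l)
    qed (use off in blast)
    have "(\<Sum>i<n. h (J $$ (i,i)) * J $$ (i,i)) =
        (\<Sum>l<m. \<Sum>i<n. h (J $$ (i,i)) * (c (E l) * c (B l) - c (B l) * c (E l)) $$ (i,i))"
      by (subst sum.swap) (simp add: Jsum sum_distrib_left)
    \<comment> \<open>For \<open>D\<close> the diagonal matrix with entries
      \<open>h (J $$ (i,i))\<close>, this is the identity
      \<open>tr (D [E,B]) = - tr (E [D,B])\<close>.\<close>
    also have "\<dots> = (\<Sum>l<m. - (\<Sum>i<n. \<Sum>j<n. c (E l) $$ (j,i) * ((h (J $$ (i,i)) - h (J $$ (j,j))) * c (B l) $$ (i,j))))"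
    proof (rule sum.cong[OF refl])
      fix l assume "l \<in> {..<m}"
      hence l: "l < m" by simp
      note cE = c[OF EB(1)[OF l]] and cB = c[OF EB(2)[OF l]]
      have "(\<Sum>i<n. h (J $$ (i,i)) * (c (E l) * c (B l) - c (B l) * c (E l)) $$ (i,i)) =
          (\<Sum>i<n. \<Sum>j<n. h (J $$ (i,i)) * (c (E l) $$ (i,j) * c (B l) $$ (j,i)))
          - (\<Sum>i<n. \<Sum>j<n. h (J $$ (i,i)) * (c (B l) $$ (i,j) * c (E l) $$ (j,i)))"
        using cE cB by (simp add: scalar_prod_def lessThan_atLeast0 right_diff_distrib sum_subtractf sum_distrib_left)
      also have "(\<Sum>i<n. \<Sum>j<n. h (J $$ (i,i)) * (c (E l) $$ (i,j) * c (B l) $$ (j,i))) =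
          (\<Sum>i<n. \<Sum>j<n. h (J $$ (j,j)) * (c (E l) $$ (j,i) * c (B l) $$ (i,j)))"
        by (rule sum.swap)
      finally show "(\<Sum>i<n. h (J $$ (i,i)) * (c (E l) * c (B l) - c (B l) * c (E l)) $$ (i,i)) =
          - (\<Sum>i<n. \<Sum>j<n. c (E l) $$ (j,i) * ((h (J $$ (i,i)) - h (J $$ (j,j))) * c (B l) $$ (i,j)))"
        by (simp add: sum_subtractf[symmetric] sum_negf[symmetric] algebra_simps)
    qed
    also have "\<dots> = 0" using 0 by simp
    finally show ?thesis .
  qed
  have diag: "J $$ (i,i) = 0" if i: "i < n" for i
  proof (rule ccontr)
    assume "J $$ (i,i) \<noteq> 0"
    from rational_functional[OF this] obtain h :: "'a \<Rightarrow> rat"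
      where h: "\<And>x y. h (x - y) = h x - h y" "\<And>q x. h (x * of_rat q) = h x * q" "h (J $$ (i,i)) \<noteq> 0" by blast
    have h0: "h 0 = 0" using h(1)[of 0 0] by simp
    have hadd: "h (x + y) = h x + h y" for x y using h(1)[of "x + y" y] by simp
    have hsum: "h (sum g S) = (\<Sum>x\<in>S. h (g x))" for g and S :: "nat set"
      by (induction S rule: infinite_finite_induct) (simp_all add: h0 hadd)
    \<comment> \<open>Here \<open>key\<close> is used for the additive map \<open>of_rat\<close>
      after \<open>h\<close>. Applying \<open>h\<close> once more to the resulting equation is
      legitimate by rational linearity and produces a sum of squares.\<close>
    have "(\<Sum>i<n. of_rat (h (J $$ (i,i))) * J $$ (i,i)) = 0"
      by (rule key) (simp add: h(1) of_rat_diff)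
    hence "h (\<Sum>i<n. J $$ (i,i) * of_rat (h (J $$ (i,i)))) = 0" by (simp add: h0 mult.commute)
    hence "(\<Sum>i<n. h (J $$ (i,i)) * h (J $$ (i,i))) = 0" by (simp add: hsum h(2))
    hence "\<forall>i\<in>{..<n}. h (J $$ (i,i)) * h (J $$ (i,i)) = 0" by (subst (asm) sum_nonneg_eq_0_iff) auto
    thus False using h(3) i by auto
  qed
  \<comment> \<open>With zero diagonal every factor \<open>J\<close> moves at least one column to
    the right.\<close>
  have Jpow: "i + k \<le> j" if "i < n" "j < n" "(J ^\<^sub>m k) $$ (i,j) \<noteq> 0" for i j k
    using that
  proof (induction k arbitrary: j)
    case 0
    thus ?case using J by (auto split: if_splits)
  next
    case (Suc k)
    have "(J ^\<^sub>m Suc k) $$ (i,j) = (\<Sum>a<n. (J ^\<^sub>m k) $$ (i,a) * J $$ (a,j))"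
      using Suc.prems J by (simp add: scalar_prod_def lessThan_atLeast0)
    then obtain a where a: "a < n" "(J ^\<^sub>m k) $$ (i,a) \<noteq> 0" "J $$ (a,j) \<noteq> 0"
      using Suc.prems(3) by (metis (no_types, lifting) lessThan_iff mult_zero_left mult_zero_right sum.neutral)
    moreover have "a < j" using a off[of a j] diag[of a] Suc.prems(2) by metis
    ultimately show ?case using Suc.IH[of a] Suc.prems(1) by simp
  qed
  have "J ^\<^sub>m n = 0\<^sub>m n n" using Jpow[of _ _ n] J by (intro eq_matI) force+
  hence "A ^\<^sub>m n = P * 0\<^sub>m n n * Q" using similar_mat_wit_pow_id[OF wit, of n] by simp
  thus ?thesis using PQ by simp
qed

text \<open>Hypotheses and conclusion are polynomial identities in the matrix entries, so they
  transfer along the embedding \<open>to_ac\<close> into the algebraic closure, whose injectivity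
  brings the conclusion back.\<close>

lemma commutator_trace_nilpotent:
  fixes A :: "'a :: field_char_0 mat"
  assumes A: "A \<in> carrier_mat n n"
    and EB: "\<And>l. l < m \<Longrightarrow> E l \<in> carrier_mat n n" "\<And>l. l < m \<Longrightarrow> B l \<in> carrier_mat n n"
    and sum: "\<And>i j. i < n \<Longrightarrow> j < n \<Longrightarrow> A $$ (i,j) = (\<Sum>l<m. (E l * B l - B l * E l) $$ (i,j))"
    and tr: "\<And>l k. l < m \<Longrightarrow> mtr (E l * ((\<lambda>W. A * W - W * A) ^^ k) (B l)) = 0"
  shows "A ^\<^sub>m n = 0\<^sub>m n n"
proof -
  interpret h: semiring_hom "to_ac :: 'a \<Rightarrow> _" by unfold_locales simp_all
  let ?m = "map_mat (to_ac :: 'a \<Rightarrow> _)"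
  have diff: "?m (M - M') = ?m M - ?m M'" if "M \<in> carrier_mat n n" "M' \<in> carrier_mat n n" for M M'
    using that by (intro eq_matI) auto
  have ad: "((\<lambda>W. ?m A * W - W * ?m A) ^^ k) (?m M) = ?m (((\<lambda>W. A * W - W * A) ^^ k) M)" if M: "M \<in> carrier_mat n n" for M k
  proof (induction k)
    case (Suc k)
    let ?W = "((\<lambda>W. A * W - W * A) ^^ k) M"
    have W: "?W \<in> carrier_mat n n" by (rule commutator_pow_carrier[OF A M])
    have "?m (A * ?W - ?W * A) = ?m (A * ?W) - ?m (?W * A)" using A W by (intro diff) auto
    thus ?case using Suc by (simp add: h.mat_hom_mult[OF A W] h.mat_hom_mult[OF W A])
  qed simp
  have trm: "mtr (?m M) = to_ac (mtr M)" if "M \<in> carrier_mat n n" for M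
    using that by (simp add: mtr_def to_ac_sum)
  have "?m A ^\<^sub>m n = 0\<^sub>m n n"
  proof (rule commutator_trace_nilpotent_alg_closed[where m = m and E = "\<lambda>l. ?m (E l)" and B = "\<lambda>l. ?m (B l)"])
    fix i j assume ij: "i < n" "j < n"
    have "?m A $$ (i,j) = (\<Sum>l<m. to_ac ((E l * B l - B l * E l) $$ (i,j)))"
      using ij A by (simp add: sum to_ac_sum)
    also have "\<dots> = (\<Sum>l<m. ?m (E l * B l - B l * E l) $$ (i,j))"
      using ij EB by (intro sum.cong refl) (simp add: carrier_matD[OF EB(1)] carrier_matD[OF EB(2)])
    also have "\<dots> = (\<Sum>l<m. (?m (E l) * ?m (B l) - ?m (B l) * ?m (E l)) $$ (i,j))"
    proof (rule sum.cong[OF refl])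
      fix l assume "l \<in> {..<m}"
      hence l: "E l \<in> carrier_mat n n" "B l \<in> carrier_mat n n" using EB by auto
      hence "?m (E l * B l - B l * E l) = ?m (E l * B l) - ?m (B l * E l)" by (intro diff) auto
      thus "?m (E l * B l - B l * E l) $$ (i,j) = (?m (E l) * ?m (B l) - ?m (B l) * ?m (E l)) $$ (i,j)"
        by (simp add: h.mat_hom_mult[OF l] h.mat_hom_mult[OF l(2,1)])
    qed
    finally show "?m A $$ (i,j) = (\<Sum>l<m. (?m (E l) * ?m (B l) - ?m (B l) * ?m (E l)) $$ (i,j))" .
  next
    fix l k assume l: "l < m"
    have "?m (E l) * ?m (((\<lambda>W. A * W - W * A) ^^ k) (B l)) = ?m (E l * ((\<lambda>W. A * W - W * A) ^^ k) (B l))"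
      using EB[OF l] commutator_pow_carrier[OF A EB(2)[OF l]] by (intro h.mat_hom_mult[symmetric])
    thus "mtr (?m (E l) * ((\<lambda>W. ?m A * W - W * ?m A) ^^ k) (?m (B l))) = 0"
      unfolding ad[OF EB(2)[OF l]]
      by (simp add: trm mult_carrier_mat[OF EB(1)[OF l] commutator_pow_carrier[OF A EB(2)[OF l]]] tr l)
  qed (use A EB in auto)
  hence "?m (A ^\<^sub>m n) = 0\<^sub>m n n" by (simp add: h.mat_hom_pow[OF A])
  hence "\<forall>i<n. \<forall>j<n. ?m (A ^\<^sub>m n) $$ (i,j) = 0" by simp
  thus ?thesis using A by (intro eq_matI) (auto simp: to_ac_eq_iff[of _ 0, simplified])
qed

subsection \<open>Operators on subspaces\<close>

locale fd_space = finite_dimensional_vector_space scale Basis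
  for scale :: "'f :: field_char_0 \<Rightarrow> 'v :: ab_group_add \<Rightarrow> 'v" (infixr "*s" 75) and Basis
begin

abbreviation lin :: "('v \<Rightarrow> 'v) \<Rightarrow> bool" where
  "lin f \<equiv> Vector_Spaces.linear scale scale f"

lemma linI: "\<lbrakk>\<And>x y. f (x + y) = f x + f y; \<And>c x. f (c *s x) = c *s f x\<rbrakk> \<Longrightarrow> lin f"
  by (simp add: lin_iff)

lemma lin_simps:
  assumes "lin f"
  shows "f (x + y) = f x + f y" "f (c *s x) = c *s f x" "f 0 = 0" "f (- x) = - f x"
    "f (x - y) = f x - f y" "f (sum g A) = (\<Sum>a\<in>A. f (g a))"
proof -
  interpret f: Vector_Spaces.linear scale scale f by (rule assms)
  show "f (x + y) = f x + f y" "f (c *s x) = c *s f x" "f 0 = 0" "f (- x) = - f x"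
    "f (x - y) = f x - f y" "f (sum g A) = (\<Sum>a\<in>A. f (g a))"
    by (simp_all add: f.add f.scale f.neg f.diff f.sum)
qed

lemma lin_compose_fun: "lin f \<Longrightarrow> lin g \<Longrightarrow> lin (\<lambda>x. f (g x))"
  by (simp add: lin_iff)

definition bilin :: "('v \<Rightarrow> 'v \<Rightarrow> 'v) \<Rightarrow> bool" where
  "bilin b \<longleftrightarrow> (\<forall>x. lin (b x)) \<and> (\<forall>y. lin (\<lambda>x. b x y))"

lemma bilinD: assumes "bilin b" shows "lin (b x)" "lin (\<lambda>x. b x y)"
  using assms by (auto simp: bilin_def)

lemma bilin_simps:
  assumes "bilin b"
  shows "b (x + x') y = b x y + b x' y" "b x (y + y') = b x y + b x y'"
    "b (c *s x) y = c *s b x y" "b x (c *s y) = c *s b x y"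
    "b 0 y = 0" "b x 0 = 0" "b (- x) y = - b x y" "b x (- y) = - b x y"
    "b (x - x') y = b x y - b x' y" "b x (y - y') = b x y - b x y'"
    "b (sum g A) y = (\<Sum>a\<in>A. b (g a) y)" "b x (sum g A) = (\<Sum>a\<in>A. b x (g a))"
  by (simp_all add: lin_simps[OF bilinD(1)[OF assms]] lin_simps[OF bilinD(2)[OF assms]])

lemma subspace_vimage: "lin f \<Longrightarrow> subspace W \<Longrightarrow> subspace {x. f x \<in> W}"
  by (auto simp: subspace_def lin_simps)

lemma projection_exists:
  assumes "subspace W"
  shows "\<exists>q. lin q \<and> (\<forall>x. q x \<in> W) \<and> (\<forall>x\<in>W. q x = x)"
proof -
  interpret vector_space_pair scale scale ..
  obtain g where "g ` UNIV \<subseteq> W" "lin g" "\<forall>v\<in>W. g v = v"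
    using linear_exists_left_inverse_on[OF linear_id assms] by (auto simp: id_def)
  thus ?thesis by (intro exI[of _ g]) auto
qed

definition bas :: "'v set \<Rightarrow> 'v set" where
  "bas V = (SOME B. B \<subseteq> V \<and> independent B \<and> span B = V)"

lemma bas:
  assumes "subspace V"
  shows "bas V \<subseteq> V" "independent (bas V)" "span (bas V) = V" "finite (bas V)" "card (bas V) = dim V"
proof -
  have "\<exists>B. B \<subseteq> V \<and> independent B \<and> span B = V"
  proof -
    obtain B where B: "B \<subseteq> V" "independent B" "V \<subseteq> span B" using maximal_independent_subset[of V] by blast
    thus ?thesis using span_subspace[OF B(1,3) assms] by blast
  qed
  hence *: "bas V \<subseteq> V \<and> independent (bas V) \<and> span (bas V) = V" unfolding bas_def by (rule someI_ex)
  thus "bas V \<subseteq> V" "independent (bas V)" "span (bas V) = V" by auto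
  thus "finite (bas V)" "card (bas V) = dim V"
    using finiteI_independent[of "bas V"] dim_span_eq_card_independent[of "bas V"] by simp_all
qed

abbreviation co :: "'v set \<Rightarrow> 'v \<Rightarrow> 'v \<Rightarrow> 'f" where
  "co V \<equiv> representation (bas V)"

lemma co_sum: "subspace V \<Longrightarrow> v \<in> V \<Longrightarrow> (\<Sum>b\<in>bas V. co V v b *s b) = v"
  using bas[of V] by (intro sum_representation_eq) auto

lemma co_simps:
  assumes "subspace V"
  shows "v \<in> V \<Longrightarrow> w \<in> V \<Longrightarrow> co V (v + w) b = co V v b + co V w b"
    "v \<in> V \<Longrightarrow> w \<in> V \<Longrightarrow> co V (v - w) b = co V v b - co V w b"
    "v \<in> V \<Longrightarrow> co V (c *s v) b = c * co V v b"
    "co V 0 b = 0"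
  using bas[OF assms] by (simp_all add: representation_add representation_diff representation_scale representation_zero)

lemma co_bas: "subspace V \<Longrightarrow> b \<in> bas V \<Longrightarrow> co V b c = (if c = b then 1 else 0)"
  using representation_basis[OF bas(2)] by simp

lemma co_sum_arg:
  assumes "subspace V" "\<And>a. a \<in> A \<Longrightarrow> g a \<in> V"
  shows "co V (sum g A) b = (\<Sum>a\<in>A. co V (g a) b)"
  using assms(2) by (induction A rule: infinite_finite_induct)
    (simp_all add: co_simps[OF assms(1)] subspace_sum[OF assms(1)])

definition endo :: "'v set \<Rightarrow> ('v \<Rightarrow> 'v) \<Rightarrow> bool" where
  "endo V f \<longleftrightarrow> lin f \<and> (\<forall>v\<in>V. f v \<in> V)"

lemma endo_compose: "endo V f \<Longrightarrow> endo V g \<Longrightarrow> endo V (\<lambda>v. f (g v))"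
  by (simp add: endo_def lin_compose_fun)

lemma co_comp:
  assumes "subspace V" "endo V f" "v \<in> V"
  shows "co V (f v) b = (\<Sum>a\<in>bas V. co V v a * co V (f a) b)"
proof -
  have "f v = (\<Sum>a\<in>bas V. co V v a *s f a)"
    using arg_cong[OF co_sum[OF assms(1,3)], of f] assms(2) by (simp add: lin_simps endo_def)
  moreover have f: "f a \<in> V" if "a \<in> bas V" for a using that assms(2) bas(1)[OF assms(1)] by (auto simp: endo_def)
  ultimately show ?thesis using assms(1)
    by (simp add: co_sum_arg subspace_scale co_simps)
qed

definition tr :: "'v set \<Rightarrow> ('v \<Rightarrow> 'v) \<Rightarrow> 'f" where
  "tr V f = (\<Sum>b\<in>bas V. co V (f b) b)"

lemma tr_cong: "subspace V \<Longrightarrow> (\<And>v. v \<in> V \<Longrightarrow> f v = g v) \<Longrightarrow> tr V f = tr V g"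
  unfolding tr_def using bas(1)[of V] by (intro sum.cong) auto

lemma tr_add:
  assumes "subspace V" "\<And>v. v \<in> V \<Longrightarrow> f v \<in> V" "\<And>v. v \<in> V \<Longrightarrow> g v \<in> V"
  shows "tr V (\<lambda>v. f v + g v) = tr V f + tr V g"
  unfolding tr_def sum.distrib[symmetric] using assms bas(1)[OF assms(1)]
  by (intro sum.cong refl co_simps) auto

lemma tr_diff:
  assumes "subspace V" "\<And>v. v \<in> V \<Longrightarrow> f v \<in> V" "\<And>v. v \<in> V \<Longrightarrow> g v \<in> V"
  shows "tr V (\<lambda>v. f v - g v) = tr V f - tr V g"
  unfolding tr_def sum_subtractf[symmetric] using assms bas(1)[OF assms(1)]
  by (intro sum.cong refl co_simps) auto

lemma tr_scale:
  assumes "subspace V" "\<And>v. v \<in> V \<Longrightarrow> f v \<in> V"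
  shows "tr V (\<lambda>v. c *s f v) = c * tr V f"
  unfolding tr_def sum_distrib_left using assms bas(1)[OF assms(1)]
  by (intro sum.cong refl co_simps) auto

lemma tr_zero: "subspace V \<Longrightarrow> tr V (\<lambda>v. 0) = 0"
  by (simp add: tr_def co_simps)

lemma tr_sum:
  assumes "subspace V" "\<And>a v. a \<in> A \<Longrightarrow> v \<in> V \<Longrightarrow> f a v \<in> V"
  shows "tr V (\<lambda>v. \<Sum>a\<in>A. f a v) = (\<Sum>a\<in>A. tr V (f a))"
  unfolding tr_def using assms bas(1)[OF assms(1)]
  by (subst sum.swap) (intro sum.cong refl co_sum_arg, auto)

lemma tr_comp:
  assumes "subspace V" "endo V f" "endo V g"
  shows "tr V (\<lambda>v. f (g v)) = tr V (\<lambda>v. g (f v))"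
proof -
  have *: "tr V (\<lambda>v. f (g v)) = (\<Sum>b\<in>bas V. \<Sum>a\<in>bas V. co V (g b) a * co V (f a) b)"
    if "endo V f" "endo V g" for f g
    unfolding tr_def using bas(1)[OF assms(1)] that
    by (intro sum.cong refl co_comp[OF assms(1)]) (auto simp: endo_def)
  show ?thesis unfolding *[OF assms(2,3)] *[OF assms(3,2)]
    by (subst sum.swap) (simp add: mult.commute)
qed

definition blist :: "'v set \<Rightarrow> 'v list" where
  "blist V = (SOME l. distinct l \<and> set l = bas V)"

lemma blist:
  assumes "subspace V"
  shows "distinct (blist V)" "set (blist V) = bas V" "length (blist V) = dim V"
proof -
  have "distinct (blist V) \<and> set (blist V) = bas V"
    unfolding blist_def by (rule someI_ex) (use finite_distinct_list[OF bas(4)[OF assms]] in blast)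
  thus "distinct (blist V)" "set (blist V) = bas V" "length (blist V) = dim V"
    using bas(5)[OF assms] distinct_card by force+
qed

lemma sum_blist: "subspace V \<Longrightarrow> (\<Sum>b\<in>bas V. g b) = (\<Sum>i<dim V. g (blist V ! i))"
  by (rule sum.reindex_bij_betw[OF bij_betw_nth, symmetric]) (simp_all add: blist)

lemma blist_mem: "subspace V \<Longrightarrow> i < dim V \<Longrightarrow> blist V ! i \<in> V"
  using blist[of V] bas(1)[of V] nth_mem[of i "blist V"] by auto

definition mat_of :: "'v set \<Rightarrow> ('v \<Rightarrow> 'v) \<Rightarrow> 'f mat" where
  "mat_of V f = mat (dim V) (dim V) (\<lambda>(i,j). co V (f (blist V ! j)) (blist V ! i))"

lemma mat_of_carrier [simp]: "mat_of V f \<in> carrier_mat (dim V) (dim V)"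
  "dim_row (mat_of V f) = dim V" "dim_col (mat_of V f) = dim V"
  by (simp_all add: mat_of_def)

lemma mat_of_cong: "subspace V \<Longrightarrow> (\<And>v. v \<in> V \<Longrightarrow> f v = g v) \<Longrightarrow> mat_of V f = mat_of V g"
  by (auto simp: mat_of_def blist_mem intro!: eq_matI)

lemma mat_of_comp:
  assumes "subspace V" "endo V f" "\<And>v. v \<in> V \<Longrightarrow> g v \<in> V"
  shows "mat_of V (\<lambda>v. f (g v)) = mat_of V f * mat_of V g"
proof (rule eq_matI)
  fix i j assume "i < dim_row (mat_of V f * mat_of V g)" "j < dim_col (mat_of V f * mat_of V g)"
  hence ij: "i < dim V" "j < dim V" by simp_all
  have "co V (f (g (blist V ! j))) (blist V ! i) =
      (\<Sum>k<dim V. co V (g (blist V ! j)) (blist V ! k) * co V (f (blist V ! k)) (blist V ! i))"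
    by (subst co_comp[OF assms(1,2)]) (simp_all add: assms blist_mem ij sum_blist)
  thus "mat_of V (\<lambda>v. f (g v)) $$ (i,j) = (mat_of V f * mat_of V g) $$ (i,j)"
    using ij by (simp add: mat_of_def scalar_prod_def lessThan_atLeast0 mult.commute)
qed simp_all

lemma mat_of_diff:
  assumes "subspace V" "\<And>v. v \<in> V \<Longrightarrow> f v \<in> V" "\<And>v. v \<in> V \<Longrightarrow> g v \<in> V"
  shows "mat_of V (\<lambda>v. f v - g v) = mat_of V f - mat_of V g"
  using assms by (intro eq_matI) (auto simp: mat_of_def blist_mem co_simps)

lemma mtr_mat_of: "subspace V \<Longrightarrow> mtr (mat_of V f) = tr V f"
  by (simp add: mtr_def tr_def sum_blist mat_of_def)

lemma mat_of_pow:
  assumes "subspace V" "endo V f"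
  shows "mat_of V f ^\<^sub>m k = mat_of V (f ^^ k)"
proof (induction k)
  case 0
  have "blist V ! i \<in> bas V" if "i < dim V" for i
    using blist[OF assms(1)] nth_mem that by metis
  thus ?case using blist[OF assms(1)]
    by (intro eq_matI) (auto simp: mat_of_def co_bas[OF assms(1)] nth_eq_iff_index_eq)
next
  case (Suc k)
  have fk: "endo V (f ^^ k)" for k
    using assms(2) by (induction k) (auto simp: endo_def lin_iff)
  show ?case using mat_of_comp[OF assms(1) fk, of f k] assms(2)
    by (simp add: Suc funpow_Suc_right endo_def o_def del: funpow.simps)
qed

lemma mat_of_eq_0:
  assumes "subspace V" "endo V f" "mat_of V f = 0\<^sub>m (dim V) (dim V)" "v \<in> V"
  shows "f v = 0"
proof -
  have 0: "co V (f b) a = 0" if ab: "a \<in> bas V" "b \<in> bas V" for a b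
  proof -
    obtain i j where "i < dim V" "j < dim V" "a = blist V ! i" "b = blist V ! j"
      using ab blist[OF assms(1)] by (metis in_set_conv_nth)
    thus ?thesis using arg_cong[OF assms(3), of "\<lambda>M. M $$ (i,j)"] by (simp add: mat_of_def)
  qed
  have "f v = (\<Sum>b\<in>bas V. co V (f v) b *s b)" using assms by (simp add: co_sum endo_def)
  also have "\<dots> = 0" unfolding co_comp[OF assms(1,2,4)] by (simp add: 0)
  finally show ?thesis .
qed

end

subsection \<open>Representations\<close>

text \<open>The maps \<open>br\<close> and \<open>act\<close> are bilinear on the whole space but matter only on \<open>S\<close> and \<open>V\<close>, so that
  quotients can be realised on complementary subspaces of the same type.\<close>

locale lie_carrier = fd_space scale Basis
  for scale :: "'f :: field_char_0 \<Rightarrow> 'v :: ab_group_add \<Rightarrow> 'v" (infixr "*s" 75) and Basis +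
  fixes S :: "'v set" and br :: "'v \<Rightarrow> 'v \<Rightarrow> 'v"
  assumes subspace_S: "subspace S" and bilin_br: "bilin br"
    and br_closed: "x \<in> S \<Longrightarrow> y \<in> S \<Longrightarrow> br x y \<in> S"
    and br_self: "x \<in> S \<Longrightarrow> br x x = 0"
    and br_jacobi: "x \<in> S \<Longrightarrow> y \<in> S \<Longrightarrow> z \<in> S \<Longrightarrow> br x (br y z) + br y (br z x) + br z (br x y) = 0"
begin

lemmas br_simps = bilin_simps[OF bilin_br]

lemma br_anti: assumes "x \<in> S" "y \<in> S" shows "br x y = - br y x"
proof -
  have "br (x + y) (x + y) = 0" using assms subspace_S by (intro br_self subspace_add)
  thus ?thesis using br_self[OF assms(1)] br_self[OF assms(2)]
    by (simp add: br_simps eq_neg_iff_add_eq_0 add.commute)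
qed

lemma br_br: assumes "x \<in> S" "y \<in> S" "z \<in> S" shows "br (br x y) z = br x (br y z) - br y (br x z)"
proof -
  have "br (br x y) z = - br z (br x y)" using assms by (intro br_anti br_closed)
  moreover have "br y (br z x) = - br y (br x z)" using br_anti[OF assms(3,1)] by (simp add: br_simps)
  ultimately show ?thesis using br_jacobi[OF assms]
    by (simp add: algebra_simps)
qed

end

locale lie_rep = lie_carrier scale Basis S br
  for scale :: "'f :: field_char_0 \<Rightarrow> 'v :: ab_group_add \<Rightarrow> 'v" (infixr "*s" 75) and Basis S br +
  fixes V :: "'v set" and act :: "'v \<Rightarrow> 'v \<Rightarrow> 'v"
  assumes subspace_V: "subspace V" and bilin_act: "bilin act"
    and act_closed: "x \<in> S \<Longrightarrow> v \<in> V \<Longrightarrow> act x v \<in> V"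
    and act_br: "x \<in> S \<Longrightarrow> y \<in> S \<Longrightarrow> v \<in> V \<Longrightarrow> act (br x y) v = act x (act y v) - act y (act x v)"

sublocale lie_carrier \<subseteq> adj: lie_rep scale Basis S br S br
  by unfold_locales (simp_all add: subspace_S bilin_br br_closed br_br)

context lie_rep
begin

lemmas act_simps = bilin_simps[OF bilin_act]

lemma endo_act: "x \<in> S \<Longrightarrow> endo V (act x)"
  by (simp add: endo_def act_closed bilinD[OF bilin_act])

text \<open>The trace form of the representation; for the interpretation \<open>adj\<close> it is
  the Killing form.\<close>

definition form :: "'v \<Rightarrow> 'v \<Rightarrow> 'f" where
  "form x y = tr V (\<lambda>v. act x (act y v))"

text \<open>Scalars are absorbed into the left factors, leaving plain sums of brackets as
  \<open>commutator_trace_nilpotent\<close> expects them.\<close>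

lemma span_brackets_sum:
  assumes "subspace P" "x \<in> span {br a b | a b. a \<in> P \<and> b \<in> P}"
  shows "\<exists>m a b. (\<forall>l<m::nat. a l \<in> P \<and> b l \<in> P) \<and> x = (\<Sum>l<m. br (a l) (b l))"
  using assms(2)
proof (induction rule: span_induct_alt)
  case base
  show ?case by (intro exI[of _ 0]) simp
next
  case (step c z y)
  then obtain u w where uw: "u \<in> P" "w \<in> P" "z = br u w" by auto
  obtain m :: nat and a b where *: "\<forall>l<m. a l \<in> P \<and> b l \<in> P" "y = (\<Sum>l<m. br (a l) (b l))" using step.IH by blast
  have "(\<Sum>l<Suc m. br ((a(m := c *s u)) l) ((b(m := w)) l)) = c *s z + y"
    using uw * by (simp add: br_simps)
  moreover have "\<forall>l<Suc m. (a(m := c *s u)) l \<in> P \<and> (b(m := w)) l \<in> P"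
    using uw * assms(1) by (auto simp: less_Suc_eq subspace_scale)
  ultimately show ?case
    by (intro exI[of _ "Suc m"] exI[of _ "a(m := c *s u)"] exI[of _ "b(m := w)"]) (rule conjI, simp_all only:)
qed

text \<open>Perfectness makes the matrix of \<open>x\<close> a sum of commutators. Since
  \<open>P\<close> is closed under \<open>br x\<close>, each trace required by
  \<open>commutator_trace_nilpotent\<close> is a value of the form on \<open>P\<close>, hence
  zero.\<close>

lemma null_form_nilpotent:
  assumes P: "subspace P" "P \<subseteq> S" "\<And>x y. x \<in> P \<Longrightarrow> y \<in> P \<Longrightarrow> br x y \<in> P"
    and perf: "P \<subseteq> span {br a b | a b. a \<in> P \<and> b \<in> P}"
    and null: "\<And>x y. x \<in> P \<Longrightarrow> y \<in> P \<Longrightarrow> form x y = 0"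
    and x: "x \<in> P"
  shows "\<exists>k. \<forall>v\<in>V. (act x ^^ k) v = 0"
proof -
  let ?M = "\<lambda>y. mat_of V (act y)"
  obtain m a b where ab: "\<forall>l<m::nat. a l \<in> P \<and> b l \<in> P" "x = (\<Sum>l<m. br (a l) (b l))"
    using span_brackets_sum[OF P(1)] perf x by blast
  have M_br: "?M (br y z) = ?M y * ?M z - ?M z * ?M y" if "y \<in> P" "z \<in> P" for y z
  proof -
    have yz: "y \<in> S" "z \<in> S" using that P(2) by auto
    have "?M (br y z) = mat_of V (\<lambda>v. act y (act z v) - act z (act y v))"
      using yz by (intro mat_of_cong[OF subspace_V] act_br)
    also have "\<dots> = mat_of V (\<lambda>v. act y (act z v)) - mat_of V (\<lambda>v. act z (act y v))"
      using yz by (intro mat_of_diff[OF subspace_V] act_closed)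
    also have "\<dots> = ?M y * ?M z - ?M z * ?M y"
      using yz by (simp add: mat_of_comp[OF subspace_V] endo_act act_closed)
    finally show ?thesis .
  qed
  have iter: "(br x ^^ k) z \<in> P" if "z \<in> P" for k z
    using that x P(3) by (induction k) auto
  have ad: "((\<lambda>W. ?M x * W - W * ?M x) ^^ k) (?M z) = ?M ((br x ^^ k) z)" if "z \<in> P" for k z
    by (induction k) (simp_all add: M_br x iter that)
  have "?M x ^\<^sub>m dim V = 0\<^sub>m (dim V) (dim V)"
  proof (rule commutator_trace_nilpotent[where m = m and E = "\<lambda>l. ?M (a l)" and B = "\<lambda>l. ?M (b l)"])
    fix i j assume ij: "i < dim V" "j < dim V"
    let ?v = "blist V ! j"
    have v: "?v \<in> V" using ij blist_mem[OF subspace_V] by simp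
    have abS: "a l \<in> S" "b l \<in> S" if "l < m" for l using ab that P(2) by auto
    have "?M x $$ (i,j) = co V (\<Sum>l<m. act (br (a l) (b l)) ?v) (blist V ! i)"
      using ij by (simp add: mat_of_def ab(2) act_simps)
    also have "\<dots> = (\<Sum>l<m. co V (act (br (a l) (b l)) ?v) (blist V ! i))"
      using abS v by (intro co_sum_arg[OF subspace_V] act_closed br_closed) auto
    also have "\<dots> = (\<Sum>l<m. ?M (br (a l) (b l)) $$ (i,j))"
      using ij by (simp add: mat_of_def)
    also have "\<dots> = (\<Sum>l<m. (?M (a l) * ?M (b l) - ?M (b l) * ?M (a l)) $$ (i,j))"
      using ab by (intro sum.cong refl) (simp add: M_br)
    finally show "?M x $$ (i,j) = (\<Sum>l<m. (?M (a l) * ?M (b l) - ?M (b l) * ?M (a l)) $$ (i,j))" .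
  next
    fix l k assume l: "l < m"
    hence lS: "a l \<in> P" "(br x ^^ k) (b l) \<in> P" using ab iter by auto
    have "mtr (?M (a l) * ?M ((br x ^^ k) (b l))) = form (a l) ((br x ^^ k) (b l))"
      unfolding form_def mtr_mat_of[OF subspace_V, symmetric]
      using lS P(2) by (subst mat_of_comp[OF subspace_V]) (auto simp: endo_act act_closed)
    thus "mtr (?M (a l) * ((\<lambda>W. ?M x * W - W * ?M x) ^^ k) (?M (b l))) = 0"
      using ab(1) l null lS by (simp only: ad)
  qed simp_all
  moreover have xS: "x \<in> S" using x P(2) by auto
  ultimately have "mat_of V (act x ^^ dim V) = 0\<^sub>m (dim V) (dim V)"
    by (simp add: mat_of_pow[OF subspace_V endo_act])
  moreover have "endo V (act x ^^ k)" for k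
    using endo_act[OF xS] by (induction k) (auto simp: endo_def lin_iff)
  ultimately show ?thesis using mat_of_eq_0[OF subspace_V] by blast
qed

text \<open>Engel's theorem: a subalgebra acting nilpotently and maximal as such must be everything,
  since otherwise it is normalised by some element outside it, which can be adjoined.\<close>

definition D :: "'v set \<Rightarrow> 'v set \<Rightarrow> 'v set" where
  "D Q W = span {act q w | q w. q \<in> Q \<and> w \<in> W}"

lemma subspace_D: "subspace (D Q W)" by (simp add: D_def)

lemma D_mono: "W \<subseteq> W' \<Longrightarrow> D Q W \<subseteq> D Q W'"
  unfolding D_def by (intro span_mono) blast

lemma D_I: "q \<in> Q \<Longrightarrow> w \<in> W \<Longrightarrow> act q w \<in> D Q W"
  unfolding D_def by (intro span_base) blast

lemma D_least: "subspace U \<Longrightarrow> (\<And>q w. q \<in> Q \<Longrightarrow> w \<in> W \<Longrightarrow> act q w \<in> U) \<Longrightarrow> D Q W \<subseteq> U"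
  unfolding D_def by (intro span_minimal) auto

lemma D_pow_mono: "W \<subseteq> W' \<Longrightarrow> (D Q ^^ k) W \<subseteq> (D Q ^^ k) W'"
  by (induction k) (simp_all add: D_mono)

lemma subspace_D_pow: "subspace W \<Longrightarrow> subspace ((D Q ^^ k) W)"
  by (cases k) (simp_all add: subspace_D)

lemma D_pow_V: "Q \<subseteq> S \<Longrightarrow> (D Q ^^ k) V \<subseteq> V"
proof (induction k)
  case (Suc k)
  assume Q: "Q \<subseteq> S"
  have "D Q ((D Q ^^ k) V) \<subseteq> V"
    by (rule D_least[OF subspace_V], rule act_closed) (use Suc Q in auto)
  thus ?case by simp
qed simp

text \<open>Modulo \<open>D Q W\<close>, which \<open>y\<close> preserves, an element
  \<open>q + c *s y\<close> acts on \<open>W\<close> as a multiple of \<open>y\<close>. Hence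
  \<open>k\<close> factors from \<open>Q'\<close> act modulo \<open>D Q W\<close> like a multiple of
  the \<open>k\<close>-th power of \<open>y\<close>.\<close>

lemma D_pow_adjoin:
  assumes Q: "Q \<subseteq> S" "y \<in> S" and W: "subspace W" "W \<subseteq> V"
    and yW: "\<And>w. w \<in> W \<Longrightarrow> act y w \<in> W" and yD: "\<And>w. w \<in> D Q W \<Longrightarrow> act y w \<in> D Q W"
    and DW: "D Q W \<subseteq> W"
    and Q': "\<And>z. z \<in> Q' \<Longrightarrow> \<exists>q c. q \<in> Q \<and> z = q + c *s y"
  shows "(D Q' ^^ k) W \<subseteq> {(act y ^^ k) w + u | w u. w \<in> W \<and> u \<in> D Q W}"
proof (induction k)
  case 0
  show ?case
  proof
    fix w assume "w \<in> (D Q' ^^ 0) W"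
    thus "w \<in> {(act y ^^ 0) w + u | w u. w \<in> W \<and> u \<in> D Q W}"
      using subspace_0[OF subspace_D, of Q W] by (intro CollectI exI[of _ w] exI[of _ 0]) simp
  qed
next
  case (Suc k)
  let ?R = "\<lambda>k. {(act y ^^ k) w + u | w u. w \<in> W \<and> u \<in> D Q W}"
  have ypow: "(act y ^^ k) w \<in> W" if "w \<in> W" for w k
    using that yW by (induction k) auto
  have lin_pow: "lin (act y ^^ k)" for k
    by (intro linear_funpow bilinD[OF bilin_act])
  have sub: "subspace (?R k)" for k
  proof -
    have *: "?R k = {a + u | a u. a \<in> (act y ^^ k) ` W \<and> u \<in> D Q W}" by auto
    have "subspace ((act y ^^ k) ` W)"
      by (rule Modules.module_hom.subspace_image[OF linear_imp_module_hom[OF lin_pow] W(1)])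
    thus ?thesis unfolding * by (rule subspace_sums[OF _ subspace_D])
  qed
  have "D Q' (?R k) \<subseteq> ?R (Suc k)"
  proof (rule D_least[OF sub])
    fix z v assume "z \<in> Q'" "v \<in> ?R k"
    then obtain q c w u where *: "q \<in> Q" "z = q + c *s y" "w \<in> W" "u \<in> D Q W" "v = (act y ^^ k) w + u"
      using Q' by blast
    have "act z v = (act y ^^ Suc k) (c *s w) + (act q ((act y ^^ k) w) + act q u + c *s act y u)"
      unfolding * using lin_simps(2)[OF lin_pow] by (simp add: act_simps scale_right_distrib)
    moreover have "act q ((act y ^^ k) w) + act q u + c *s act y u \<in> D Q W"
    proof -
      have "act q ((act y ^^ k) w) \<in> D Q W" "act q u \<in> D Q W"
        using * ypow DW by (auto intro!: D_I)
      moreover have "act y u \<in> D Q W" using * yD by auto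
      ultimately show ?thesis by (intro subspace_add subspace_scale subspace_D)
    qed
    moreover have "c *s w \<in> W" using * W(1) by (simp add: subspace_scale)
    ultimately show "act z v \<in> ?R (Suc k)" by blast
  qed
  thus ?case using D_mono[OF Suc] by (simp, blast)
qed

lemma engel:
  assumes P: "subspace P" "P \<subseteq> S" "\<And>x y. x \<in> P \<Longrightarrow> y \<in> P \<Longrightarrow> br x y \<in> P"
    and nil: "\<And>x. x \<in> P \<Longrightarrow> \<exists>k. \<forall>v\<in>V. (act x ^^ k) v = 0"
  shows "\<exists>N. (D P ^^ N) V \<subseteq> {0}"
proof -
  \<comment> \<open>Starting from the elements acting as zero, rather than from the zero subspace,
    guarantees that nothing outside \<open>Q\<close> acts as zero. The search for a normalising
    element ends in a contradiction to this.\<close>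
  define Q0 where "Q0 = {x\<in>P. \<forall>v\<in>V. act x v = 0}"
  define good where "good Q \<longleftrightarrow> subspace Q \<and> Q0 \<subseteq> Q \<and> Q \<subseteq> P \<and>
    (\<forall>x\<in>Q. \<forall>y\<in>Q. br x y \<in> Q) \<and> (\<exists>N. (D Q ^^ N) V \<subseteq> {0})" for Q
  have "good Q0"
  proof -
    have "subspace Q0" using P(1) unfolding subspace_def Q0_def by (auto simp: act_simps)
    moreover have "br x y \<in> Q0" if "x \<in> Q0" "y \<in> Q0" for x y
      using that P(2,3) by (auto simp: Q0_def act_br act_simps subset_iff)
    moreover have "(D Q0 ^^ 1) V \<subseteq> {0}" by (simp, rule D_least) (auto simp: Q0_def)
    moreover have "Q0 \<subseteq> P" by (auto simp: Q0_def)
    ultimately show ?thesis unfolding good_def by blast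
  qed
  moreover have "\<forall>Q. good Q \<longrightarrow> dim Q < Suc dimension" using dim_subset_UNIV by (simp add: less_Suc_eq_le)
  ultimately obtain Q where Q: "good Q" "\<And>Q'. good Q' \<Longrightarrow> dim Q' \<le> dim Q"
    using ex_has_greatest_nat[of good Q0 dim "Suc dimension"] by blast
  then obtain N where N: "(D Q ^^ N) V \<subseteq> {0}" unfolding good_def by blast
  have QP: "subspace Q" "Q0 \<subseteq> Q" "Q \<subseteq> P" "\<And>x y. x \<in> Q \<Longrightarrow> y \<in> Q \<Longrightarrow> br x y \<in> Q"
    using Q(1) unfolding good_def by auto
  have QS: "Q \<subseteq> S" using QP P by auto
  have DV: "(D Q ^^ k) V \<subseteq> V" for k by (rule D_pow_V[OF QS])
  have Dz: "(D Q ^^ k) V \<subseteq> {0}" if "N \<le> k" for k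
  proof -
    have "(D Q ^^ k) V = (D Q ^^ N) ((D Q ^^ (k - N)) V)"
      using funpow_add[of N "k - N" "D Q"] that by simp
    thus ?thesis using D_pow_mono[OF DV[of "k - N"], of N Q] N by auto
  qed
  have "Q = P"
  proof (rule ccontr)
    assume "Q \<noteq> P"
    then obtain y0 where y0: "y0 \<in> P" "y0 \<notin> Q" using QP by auto
    have "\<exists>y\<in>P - Q. \<forall>q\<in>Q. br q y \<in> Q"
    proof (rule ccontr)
      assume "\<not> ?thesis"
      hence step: "\<forall>y\<in>P - Q. \<exists>q\<in>Q. br q y \<in> P - Q" using QP(3) P(3) by blast
      \<comment> \<open>Without a normalising element one can bracket \<open>y0\<close> with
        elements of \<open>Q\<close> forever and stay outside \<open>Q\<close>. Each bracket gains
        one step in the filtration by powers of \<open>D Q\<close>. For \<open>k = 0\<close> the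
        condition gives either \<open>N \<le> j\<close>, where \<open>w = 0\<close>, or
        \<open>i = 0\<close>, where nothing is claimed beyond membership in \<open>V\<close>. At
        \<open>k = 2 * N\<close> the element maps \<open>V\<close> to zero.\<close>
      have "\<exists>z\<in>P - Q. \<forall>i j. i + N \<le> k + j + 1 \<longrightarrow> (\<forall>w\<in>(D Q ^^ j) V. act z w \<in> (D Q ^^ i) V)" for k
      proof (induction k)
        case 0
        have "act y0 w \<in> (D Q ^^ i) V" if "i + N \<le> j + 1" "w \<in> (D Q ^^ j) V" for i j w
        proof (cases "N \<le> j")
          case True
          hence "w = 0" using Dz that by blast
          thus ?thesis using subspace_0[OF subspace_D_pow[OF subspace_V]] by (simp add: act_simps)
        next
          case False
          hence "i = 0" using that by simp
          thus ?thesis using that DV[of j] y0 P(2) by (auto intro!: act_closed)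
        qed
        thus ?case using y0 by auto
      next
        case (Suc k)
        then obtain z where z: "z \<in> P - Q" and zD:
          "\<And>i j w. i + N \<le> k + j + 1 \<Longrightarrow> w \<in> (D Q ^^ j) V \<Longrightarrow> act z w \<in> (D Q ^^ i) V" by blast
        obtain q where q: "q \<in> Q" "br q z \<in> P - Q" using step z by blast
        have "act (br q z) w \<in> (D Q ^^ i) V" if ij: "i + N \<le> Suc k + j + 1" and w: "w \<in> (D Q ^^ j) V" for i j w
        proof -
          have wV: "w \<in> V" using w DV by auto
          have zq: "z \<in> S" "q \<in> S" using z q P(2) QS by auto
          have e: "act (br q z) w = act q (act z w) - act z (act q w)" using zq wV by (simp add: act_br)
          have "act q w \<in> (D Q ^^ Suc j) V" using q w by (simp add: D_I)
          hence 2: "act z (act q w) \<in> (D Q ^^ i) V" using ij by (intro zD[of i "Suc j"]) auto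
          have "act q (act z w) \<in> (D Q ^^ i) V"
          proof (cases i)
            case 0
            thus ?thesis using zq wV by (simp add: act_closed)
          next
            case (Suc i')
            hence "act z w \<in> (D Q ^^ i') V" using ij w by (intro zD[of i' j]) auto
            thus ?thesis using q Suc by (simp add: D_I)
          qed
          thus ?thesis unfolding e using 2 subspace_D_pow[OF subspace_V] by (intro subspace_diff)
        qed
        thus ?case using q by blast
      qed
      from this[of "2 * N"] obtain z where z: "z \<in> P - Q" and zD:
        "\<And>i j w. i + N \<le> 2 * N + j + 1 \<Longrightarrow> w \<in> (D Q ^^ j) V \<Longrightarrow> act z w \<in> (D Q ^^ i) V" by blast
      have "act z w = 0" if "w \<in> V" for w using zD[of N 0 w] that N by auto
      hence "z \<in> Q0" using z by (simp add: Q0_def)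
      thus False using z QP by auto
    qed
    then obtain y where y: "y \<in> P" "y \<notin> Q" "\<And>q. q \<in> Q \<Longrightarrow> br q y \<in> Q" by blast
    have yS: "y \<in> S" using y P by auto
    define Q' where "Q' = span (insert y Q)"
    have Q'_iff: "z \<in> Q' \<longleftrightarrow> (\<exists>q c. q \<in> Q \<and> z = q + c *s y)" for z
    proof -
      have "z \<in> Q' \<longleftrightarrow> (\<exists>c. z - c *s y \<in> Q)"
        unfolding Q'_def span_breakdown_eq using QP(1) by (simp add: span_eq_iff[THEN iffD2])
      also have "\<dots> \<longleftrightarrow> (\<exists>q c. q \<in> Q \<and> z = q + c *s y)"
        by (metis add_diff_cancel diff_add_cancel)
      finally show ?thesis .
    qed
    have QQ': "Q \<subseteq> Q'" "y \<in> Q'" unfolding Q'_def using span_superset by blast+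
    obtain m where m: "\<forall>v\<in>V. (act y ^^ m) v = 0" using nil y by blast
    have yD: "act y w \<in> (D Q ^^ k) V" if "w \<in> (D Q ^^ k) V" for k w
      using that
    proof (induction k arbitrary: w)
      case 0
      thus ?case using yS by (simp add: act_closed)
    next
      case (Suc k)
      have "D Q ((D Q ^^ k) V) \<subseteq> {w. act y w \<in> D Q ((D Q ^^ k) V)}"
      proof (rule D_least)
        show "subspace {w. act y w \<in> D Q ((D Q ^^ k) V)}"
          by (intro subspace_vimage bilinD[OF bilin_act] subspace_D)
        fix q w assume qw: "q \<in> Q" "w \<in> (D Q ^^ k) V"
        have wV: "w \<in> V" using qw DV by auto
        have qS: "q \<in> S" using qw QS by auto
        have "act y (act q w) = act q (act y w) - act (br q y) w"
          using act_br[OF qS yS wV] by simp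
        also have "\<dots> \<in> D Q ((D Q ^^ k) V)"
          using qw y(3) Suc.IH by (intro subspace_diff subspace_D D_I) auto
        finally show "act q w \<in> {w. act y w \<in> D Q ((D Q ^^ k) V)}" by simp
      qed
      thus ?case using Suc.prems by auto
    qed
    have DD: "D Q ((D Q ^^ k) V) \<subseteq> (D Q ^^ k) V" for k
    proof (induction k)
      case 0 thus ?case using DV[of 1] by simp
    next
      case (Suc k) thus ?case using D_mono[OF Suc] by simp
    qed
    \<comment> \<open>As \<open>m\<close> factors \<open>y\<close> vanish on \<open>V\<close>,
      \<open>m\<close> steps of the filtration for \<open>Q'\<close> make up for one step of the
      filtration for \<open>Q\<close>.\<close>
    have adj: "(D Q' ^^ m) ((D Q ^^ k) V) \<subseteq> (D Q ^^ Suc k) V" for k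
    proof -
      have "(D Q' ^^ m) ((D Q ^^ k) V) \<subseteq>
          {(act y ^^ m) w + u | w u. w \<in> (D Q ^^ k) V \<and> u \<in> D Q ((D Q ^^ k) V)}"
        using yD[of _ k] yD[of _ "Suc k"] DV[of k] DD[of k] Q'_iff
        by (intro D_pow_adjoin QS yS subspace_D_pow subspace_V) auto
      thus ?thesis using m DV[of k] by fastforce
    qed
    have "(D Q' ^^ (m * k)) V \<subseteq> (D Q ^^ k) V" for k
    proof (induction k)
      case (Suc k)
      have "(D Q' ^^ (m * Suc k)) V = (D Q' ^^ m) ((D Q' ^^ (m * k)) V)" by (simp add: funpow_add)
      thus ?case using D_pow_mono[OF Suc, of m Q'] adj[of k] by simp
    qed simp
    hence nilQ': "(D Q' ^^ (m * N)) V \<subseteq> {0}" using N by blast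
    have "good Q'" unfolding good_def
    proof (intro conjI ballI exI)
      show "subspace Q'" by (simp add: Q'_def)
      show "Q0 \<subseteq> Q'" using QP QQ' by auto
      show "Q' \<subseteq> P" unfolding Q'_def using y QP P(1) by (intro span_minimal) auto
      show "(D Q' ^^ (m * N)) V \<subseteq> {0}" by (rule nilQ')
      fix a b assume "a \<in> Q'" "b \<in> Q'"
      then obtain q c r d where ab: "q \<in> Q" "a = q + c *s y" "r \<in> Q" "b = r + d *s y" unfolding Q'_iff by blast
      have "br y r = - br r y" using ab QS yS by (intro br_anti) auto
      hence "br a b = br q r + d *s br q y - c *s br r y"
        unfolding ab(2,4) using br_self[OF yS] by (simp add: br_simps algebra_simps)
      moreover have "br q r + d *s br q y - c *s br r y \<in> Q"
        using ab y(3) QP by (intro subspace_diff subspace_add subspace_scale) auto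
      ultimately show "br a b \<in> Q'" using QQ' by auto
    qed
    hence "dim Q' \<le> dim Q" by (rule Q(2))
    moreover have "Q \<subset> Q'" using QQ' y by auto
    hence "dim Q < dim Q'" using QP(1) by (intro dim_psubset) (simp add: Q'_def span_eq_iff[THEN iffD2])
    ultimately show False by simp
  qed
  thus ?thesis using N by blast
qed

text \<open>Engel's theorem makes the iterated images \<open>P V\<close>, \<open>P (P V)\<close>,
  ... reach zero. Perfectness stops their descent after the first step, since a bracket acts as a
  commutator; so already \<open>P V\<close> is zero.\<close>

lemma perfect_null_form_acts_trivially:
  assumes P: "subspace P" "P \<subseteq> S" "\<And>x y. x \<in> P \<Longrightarrow> y \<in> P \<Longrightarrow> br x y \<in> P"
    and perf: "P \<subseteq> span {br a b | a b. a \<in> P \<and> b \<in> P}"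
    and null: "\<And>x y. x \<in> P \<Longrightarrow> y \<in> P \<Longrightarrow> form x y = 0"
    and x: "x \<in> P" and v: "v \<in> V"
  shows "act x v = 0"
proof -
  obtain N where N: "(D P ^^ N) V \<subseteq> {0}"
    using engel[OF P null_form_nilpotent[OF P perf null]] by blast
  have DD: "D P W \<subseteq> D P (D P W)" if W: "W \<subseteq> V" for W
  proof (rule D_least[OF subspace_D])
    fix q w assume q: "q \<in> P" "w \<in> W"
    obtain m :: nat and a b where ab: "\<forall>l<m. a l \<in> P \<and> b l \<in> P" "q = (\<Sum>l<m. br (a l) (b l))"
      using span_brackets_sum[OF P(1)] perf q by blast
    have "act q w = (\<Sum>l<m. act (a l) (act (b l) w) - act (b l) (act (a l) w))"
      unfolding ab(2) act_simps using ab(1) q W P(2) by (intro sum.cong refl act_br) auto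
    also have "\<dots> \<in> D P (D P W)"
      using ab(1) q by (intro subspace_sum subspace_diff subspace_D D_I) auto
    finally show "act q w \<in> D P (D P W)" .
  qed
  have "D P V \<subseteq> (D P ^^ Suc k) V" for k
  proof (induction k)
    case (Suc k)
    have "D P ((D P ^^ k) V) \<subseteq> D P (D P ((D P ^^ k) V))" by (rule DD[OF D_pow_V[OF P(2)]])
    thus ?case using Suc by simp
  qed simp
  hence "D P V \<subseteq> (D P ^^ Suc N) V" .
  moreover have "(D P ^^ Suc N) V \<subseteq> {0}"
    using D_pow_mono[OF D_pow_V[OF P(2), of 1], of N P] N by (simp add: funpow_Suc_right del: funpow.simps) 
  ultimately show ?thesis using D_I[OF x v] by blast
qed

end

subsection \<open>Invariant forms and the Casimir operator\<close>

context fd_space begin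

text \<open>Linearity is demanded on \<open>K\<close> only: trace forms need not be additive at
  elements that do not map \<open>V\<close> to itself.\<close>

definition functional_on :: "'v set \<Rightarrow> ('v \<Rightarrow> 'f) \<Rightarrow> bool" where
  "functional_on K g \<longleftrightarrow> (\<forall>x\<in>K. \<forall>y\<in>K. g (x + y) = g x + g y) \<and> (\<forall>c. \<forall>x\<in>K. g (c *s x) = c * g x)"

lemma functional_onD:
  assumes "functional_on K g"
  shows "x \<in> K \<Longrightarrow> y \<in> K \<Longrightarrow> g (x + y) = g x + g y" "x \<in> K \<Longrightarrow> g (c *s x) = c * g x"
  using assms by (auto simp: functional_on_def)

lemma functional_on_simps:
  assumes g: "functional_on K g" and K: "subspace K"
  shows "g 0 = 0" "x \<in> K \<Longrightarrow> g (- x) = - g x" "x \<in> K \<Longrightarrow> y \<in> K \<Longrightarrow> g (x - y) = g x - g y"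
    "(\<And>a. a \<in> A \<Longrightarrow> h a \<in> K) \<Longrightarrow> g (sum h A) = (\<Sum>a\<in>A. g (h a))"
proof -
  show 0: "g 0 = 0" using functional_onD(2)[OF g, of 0 0] subspace_0[OF K] by simp
  have m: "g (- x) = - g x" if "x \<in> K" for x using functional_onD(2)[OF g that, of "-1"] by simp
  show "x \<in> K \<Longrightarrow> g (- x) = - g x" by (rule m)
  show "x \<in> K \<Longrightarrow> y \<in> K \<Longrightarrow> g (x - y) = g x - g y"
    using functional_onD(1)[OF g, of x "- y"] m subspace_neg[OF K] by simp
  show "(\<And>a. a \<in> A \<Longrightarrow> h a \<in> K) \<Longrightarrow> g (sum h A) = (\<Sum>a\<in>A. g (h a))"
    by (induction A rule: infinite_finite_induct) (simp_all add: 0 functional_onD[OF g] subspace_sum[OF K])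
qed

lemma functional_on_expand:
  assumes g: "functional_on K g" and K: "subspace K" and x: "x \<in> K"
  shows "g x = (\<Sum>b\<in>bas K. co K x b * g b)"
proof -
  have b: "b \<in> K" if "b \<in> bas K" for b using that bas(1)[OF K] by auto
  have "g x = g (\<Sum>b\<in>bas K. co K x b *s b)" using co_sum[OF K x] by simp
  also have "\<dots> = (\<Sum>b\<in>bas K. g (co K x b *s b))"
    by (rule functional_on_simps(4)[OF g K]) (simp add: b subspace_scale[OF K])
  also have "\<dots> = (\<Sum>b\<in>bas K. co K x b * g b)"
    by (intro sum.cong refl functional_onD(2)[OF g] b)
  finally show ?thesis .
qed

text \<open>The map into the dual space is encoded as an endomorphism \<Phi> of \<open>K\<close> by
  writing the values \<open>\<beta> x b\<close> as coordinates. Nondegeneracy makes it injective,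
  and equal dimensions make it surjective.\<close>

lemma nondegenerate_represents:
  assumes K: "subspace K"
    and \<beta>: "\<And>y. y \<in> K \<Longrightarrow> functional_on K (\<lambda>x. \<beta> x y)" "\<And>x. x \<in> K \<Longrightarrow> functional_on K (\<beta> x)"
    and nondeg: "\<And>x. x \<in> K \<Longrightarrow> (\<And>y. y \<in> K \<Longrightarrow> \<beta> x y = 0) \<Longrightarrow> x = 0"
    and g: "functional_on K g"
  shows "\<exists>x\<in>K. \<forall>y\<in>K. \<beta> x y = g y"
proof -
  interpret pair: finite_dimensional_vector_space_pair_1 scale Basis scale ..
  have b: "b \<in> K" if "b \<in> bas K" for b using that bas(1)[OF K] by auto
  obtain q where q: "lin q" "\<And>x. q x \<in> K" "\<And>x. x \<in> K \<Longrightarrow> q x = x" using projection_exists[OF K] by blast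
  \<comment> \<open>Precomposing with the projection \<open>q\<close> makes \<Phi> linear on the
    whole space although \<beta> is linear on \<open>K\<close> only.\<close>
  define \<Phi> where "\<Phi> x = (\<Sum>b\<in>bas K. \<beta> (q x) b *s b)" for x
  have lin: "lin \<Phi>"
    by (rule linI) (simp_all add: \<Phi>_def lin_simps[OF q(1)] functional_onD[OF \<beta>(1)] b q(2)
        scale_left_distrib sum.distrib scale_sum_right)
  have \<Phi>K: "\<Phi> x \<in> K" for x unfolding \<Phi>_def using b by (intro subspace_sum[OF K] subspace_scale[OF K])
  have co_lc: "co K (\<Sum>b\<in>bas K. h b *s b) a = h a" if a: "a \<in> bas K" for h a
  proof -
    have "co K (\<Sum>b\<in>bas K. h b *s b) a = (\<Sum>b\<in>bas K. if a = b then h b else 0)"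
      by (subst co_sum_arg[OF K])
        (auto simp: b subspace_scale[OF K] co_simps[OF K] co_bas[OF K] intro!: sum.cong)
    thus ?thesis using a bas(4)[OF K] by simp
  qed
  have "inj_on \<Phi> K"
  proof (rule inj_onI)
    fix x y assume xy: "x \<in> K" "y \<in> K" "\<Phi> x = \<Phi> y"
    have "\<Phi> (x - y) = 0" using xy by (simp add: lin_simps[OF lin])
    hence 0: "\<beta> (x - y) b = 0" if "b \<in> bas K" for b
      using co_lc[OF that, of "\<beta> (q (x - y))"] q(3)[of "x - y"] subspace_diff[OF K xy(1,2)]
      by (simp add: \<Phi>_def co_simps[OF K])
    have "x - y = 0"
      by (rule nondeg) (use xy subspace_diff[OF K] functional_on_expand[OF \<beta>(2) K] 0 in auto)
    thus "x = y" by simp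
  qed
  hence "dim (\<Phi> ` K) = dim K" using K by (intro pair.dim_image_eq[OF lin]) (simp add: span_eq_iff[THEN iffD2])
  moreover have "subspace (\<Phi> ` K)"
    by (rule Modules.module_hom.subspace_image[OF linear_imp_module_hom[OF lin] K])
  ultimately have "\<Phi> ` K = K" using \<Phi>K K by (intro subspace_dim_equal) auto
  moreover have "(\<Sum>b\<in>bas K. g b *s b) \<in> K" using b by (intro subspace_sum[OF K] subspace_scale[OF K])
  ultimately obtain x where x: "x \<in> K" "(\<Sum>b\<in>bas K. g b *s b) = \<Phi> x" by blast
  have "\<beta> x y = g y" if y: "y \<in> K" for y
  proof -
    have "\<beta> x a = g a" if "a \<in> bas K" for a
      using co_lc[OF that, of g] co_lc[OF that, of "\<beta> (q x)"] x q(3) by (simp add: \<Phi>_def)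
    thus ?thesis
      unfolding functional_on_expand[OF \<beta>(2)[OF x(1)] K y] functional_on_expand[OF g K y] by simp
  qed
  thus ?thesis using x by blast
qed

lemma functional_on_co: "subspace K \<Longrightarrow> functional_on K (\<lambda>x. co K x b)"
  by (simp add: functional_on_def co_simps)

text \<open>The vector \<open>e b\<close> represents the coordinate functional of \<open>b\<close>.
  The expansion holds because both sides have the same \<beta>-pairing with every element of
  \<open>K\<close>.\<close>

lemma dual_basis_exists:
  assumes K: "subspace K"
    and \<beta>: "\<And>y. y \<in> K \<Longrightarrow> functional_on K (\<lambda>x. \<beta> x y)" "\<And>x. x \<in> K \<Longrightarrow> functional_on K (\<beta> x)"
    and nondeg: "\<And>x. x \<in> K \<Longrightarrow> (\<And>y. y \<in> K \<Longrightarrow> \<beta> x y = 0) \<Longrightarrow> x = 0"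
  shows "\<exists>e. (\<forall>b\<in>bas K. e b \<in> K \<and> (\<forall>y\<in>K. \<beta> (e b) y = co K y b)) \<and>
    (\<forall>x\<in>K. x = (\<Sum>b\<in>bas K. \<beta> x b *s e b))"
proof -
  have "\<forall>b. \<exists>x\<in>K. \<forall>y\<in>K. \<beta> x y = co K y b"
    using nondegenerate_represents[OF K \<beta> nondeg functional_on_co[OF K]] by blast
  then obtain e where e: "\<And>b. e b \<in> K" "\<And>b y. y \<in> K \<Longrightarrow> \<beta> (e b) y = co K y b" by metis
  have "x = (\<Sum>b\<in>bas K. \<beta> x b *s e b)" if x: "x \<in> K" for x
  proof -
    let ?s = "\<Sum>b\<in>bas K. \<beta> x b *s e b"
    have s: "?s \<in> K" using e by (intro subspace_sum[OF K] subspace_scale[OF K])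
    have "x - ?s = 0"
    proof (rule nondeg)
      show "x - ?s \<in> K" using x s by (rule subspace_diff[OF K])
      fix y assume y: "y \<in> K"
      note f = \<beta>(1)[OF y]
      have "\<beta> ?s y = (\<Sum>b\<in>bas K. \<beta> (\<beta> x b *s e b) y)"
        by (rule functional_on_simps(4)[OF f K]) (simp add: e subspace_scale[OF K])
      also have "\<dots> = (\<Sum>b\<in>bas K. \<beta> x b * co K y b)"
        using e y functional_onD(2)[OF f] by (intro sum.cong refl) simp
      also have "\<dots> = \<beta> x y" by (simp add: functional_on_expand[OF \<beta>(2)[OF x] K y] mult.commute)
      finally show "\<beta> (x - ?s) y = 0" using functional_on_simps(3)[OF f K x s] by simp
    qed
    thus ?thesis by simp
  qed
  thus ?thesis using e by blast
qed

end

context lie_carrier begin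

definition sideal :: "'v set \<Rightarrow> bool" where
  "sideal I \<longleftrightarrow> subspace I \<and> I \<subseteq> S \<and> (\<forall>x\<in>S. \<forall>y\<in>I. br x y \<in> I)"

lemma sidealD:
  assumes "sideal I"
  shows "subspace I" "x \<in> I \<Longrightarrow> x \<in> S" "x \<in> S \<Longrightarrow> y \<in> I \<Longrightarrow> br x y \<in> I" "x \<in> S \<Longrightarrow> y \<in> I \<Longrightarrow> br y x \<in> I"
proof -
  show 1: "subspace I" "x \<in> I \<Longrightarrow> x \<in> S" "x \<in> S \<Longrightarrow> y \<in> I \<Longrightarrow> br x y \<in> I"
    using assms by (auto simp: sideal_def)
  have "br y x = - br x y" if "x \<in> S" "y \<in> I" using assms that by (intro br_anti) (auto simp: sideal_def)
  thus "x \<in> S \<Longrightarrow> y \<in> I \<Longrightarrow> br y x \<in> I"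
    using assms by (auto simp: sideal_def intro!: subspace_neg)
qed

lemma sideal_brackets:
  assumes "sideal N"
  shows "sideal (span {br a b | a b. a \<in> N \<and> b \<in> N})" "span {br a b | a b. a \<in> N \<and> b \<in> N} \<subseteq> N"
proof -
  let ?G = "{br a b | a b. a \<in> N \<and> b \<in> N}"
  note N = sidealD[OF assms]
  show sub: "span ?G \<subseteq> N"
  proof (rule span_minimal)
    show "?G \<subseteq> N" using N(2,3) by blast
  qed (rule N(1))
  have "br x y \<in> span ?G" if x: "x \<in> S" and y: "y \<in> span ?G" for x y
  proof -
    have "span ?G \<subseteq> {y. br x y \<in> span ?G}"
    proof (rule span_minimal)
      show "subspace {y. br x y \<in> span ?G}" by (intro subspace_vimage bilinD[OF bilin_br] subspace_span)
      show "?G \<subseteq> {y. br x y \<in> span ?G}"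
      proof safe
        fix a b assume ab: "a \<in> N" "b \<in> N"
        have "br x (br a b) = br (br x a) b + br a (br x b)" using x N(2)[OF ab(1)] N(2)[OF ab(2)] by (simp add: br_br)
        moreover have "br x a \<in> N" "br x b \<in> N" using x ab N(3) by auto
        hence "br (br x a) b \<in> ?G" "br a (br x b) \<in> ?G" using ab by auto
        ultimately show "br x (br a b) \<in> span ?G" by (simp only: span_add span_base)
      qed
    qed
    thus ?thesis using y by blast
  qed
  moreover have "span ?G \<subseteq> S" using sub N(2) by blast
  ultimately show "sideal (span ?G)" by (simp add: sideal_def)
qed

end

context lie_rep begin

lemma form_functional:
  assumes "y \<in> S"
  shows "functional_on S (\<lambda>x. form x y)" "functional_on S (form y)"
  using assms
  by (simp_all add: functional_on_def form_def act_simps tr_add[OF subspace_V] tr_scale[OF subspace_V] act_closed)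

lemma form_sym: "x \<in> S \<Longrightarrow> y \<in> S \<Longrightarrow> form x y = form y x"
  unfolding form_def by (rule tr_comp[OF subspace_V endo_act endo_act])

lemma form_invariant:
  assumes "x \<in> S" "y \<in> S" "z \<in> S"
  shows "form (br x y) z = form x (br y z)"
proof -
  have "form (br x y) z = tr V (\<lambda>v. act x (act y (act z v)) - act y (act x (act z v)))"
    unfolding form_def using assms by (intro tr_cong[OF subspace_V]) (simp add: act_br act_closed)
  also have "\<dots> = tr V (\<lambda>v. act x (act y (act z v))) - tr V (\<lambda>v. act y (act x (act z v)))"
    using assms by (intro tr_diff[OF subspace_V]) (simp_all add: act_closed)
  also have "tr V (\<lambda>v. act y (act x (act z v))) = tr V (\<lambda>v. act x (act z (act y v)))"
    by (rule tr_comp[OF subspace_V endo_act[OF assms(2)] endo_compose[OF endo_act[OF assms(1)] endo_act[OF assms(3)]]])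
  also have "tr V (\<lambda>v. act x (act y (act z v))) - \<dots> = tr V (\<lambda>v. act x (act y (act z v)) - act x (act z (act y v)))"
    using assms by (intro tr_diff[OF subspace_V, symmetric]) (simp_all add: act_closed)
  also have "\<dots> = form x (br y z)"
    unfolding form_def using assms by (intro tr_cong[OF subspace_V]) (simp add: act_br act_simps)
  finally show ?thesis .
qed

lemma form_ad: "x \<in> S \<Longrightarrow> y \<in> S \<Longrightarrow> z \<in> S \<Longrightarrow> form (br x y) z = - form y (br x z)"
  using form_invariant[of y x z] br_anti[of x y] functional_on_simps(2)[OF form_functional(1) subspace_S]
  by (simp add: br_closed)

end

context lie_carrier begin

text \<open>The element \<open>\<Sum>b \<otimes> e b\<close> built from dual bases is annihilated by the adjoint action.\<close>

lemma dual_bases_invariant: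
  assumes T: "sideal T"
    and \<beta>: "\<And>y. y \<in> T \<Longrightarrow> functional_on T (\<lambda>x. \<beta> x y)" "\<And>x. x \<in> T \<Longrightarrow> functional_on T (\<beta> x)"
    and nondeg: "\<And>x. x \<in> T \<Longrightarrow> (\<And>y. y \<in> T \<Longrightarrow> \<beta> x y = 0) \<Longrightarrow> x = 0"
    and inv: "\<And>x y z. x \<in> S \<Longrightarrow> y \<in> T \<Longrightarrow> z \<in> T \<Longrightarrow> \<beta> (br x y) z = - \<beta> y (br x z)"
  shows "\<exists>e. (\<forall>b\<in>bas T. e b \<in> T \<and> (\<forall>y\<in>T. \<beta> (e b) y = co T y b)) \<and>
    (\<forall>m x. bilin m \<longrightarrow> x \<in> S \<longrightarrow> (\<Sum>b\<in>bas T. m (br x b) (e b) + m b (br x (e b))) = 0)"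
proof -
  note sT = sidealD(1)[OF T]
  obtain e where e: "\<And>b. b \<in> bas T \<Longrightarrow> e b \<in> T" "\<And>b y. b \<in> bas T \<Longrightarrow> y \<in> T \<Longrightarrow> \<beta> (e b) y = co T y b"
    and ex: "\<And>x. x \<in> T \<Longrightarrow> x = (\<Sum>b\<in>bas T. \<beta> x b *s e b)"
    using dual_basis_exists[OF sT \<beta> nondeg] by blast
  have bT: "b \<in> T" if "b \<in> bas T" for b using that bas(1)[OF sT] by auto
  have "(\<Sum>b\<in>bas T. m (br x b) (e b) + m b (br x (e b))) = 0" if m: "bilin m" and x: "x \<in> S" for m x
  proof -
    note ms = bilin_simps[OF m]
    have "m (br x b) (e b) = (\<Sum>c\<in>bas T. \<beta> (e c) (br x b) *s m c (e b))" if b: "b \<in> bas T" for b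
    proof -
      have xb: "br x b \<in> T" using sidealD(3)[OF T x] bT b by blast
      have "br x b = (\<Sum>c\<in>bas T. co T (br x b) c *s c)" using co_sum[OF sT xb] by simp
      also have "\<dots> = (\<Sum>c\<in>bas T. \<beta> (e c) (br x b) *s c)" using e(2)[OF _ xb] by (intro sum.cong refl) simp
      finally have "br x b = (\<Sum>c\<in>bas T. \<beta> (e c) (br x b) *s c)" .
      from arg_cong[OF this, of "\<lambda>z. m z (e b)"] show ?thesis by (simp add: ms)
    qed
    moreover have "m b (br x (e b)) = (\<Sum>c\<in>bas T. - \<beta> (e b) (br x c) *s m b (e c))" if b: "b \<in> bas T" for b
    proof -
      have "br x (e b) = (\<Sum>c\<in>bas T. \<beta> (br x (e b)) c *s e c)"
        by (rule ex[OF sidealD(3)[OF T x e(1)[OF b]]])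
      also have "\<dots> = (\<Sum>c\<in>bas T. - \<beta> (e b) (br x c) *s e c)"
        using inv[OF x e(1)[OF b] bT] by (intro sum.cong refl) simp
      finally show ?thesis by (simp add: ms)
    qed
    ultimately have "(\<Sum>b\<in>bas T. m (br x b) (e b) + m b (br x (e b))) =
        (\<Sum>b\<in>bas T. \<Sum>c\<in>bas T. \<beta> (e c) (br x b) *s m c (e b)) - (\<Sum>b\<in>bas T. \<Sum>c\<in>bas T. \<beta> (e b) (br x c) *s m b (e c))"
      by (simp add: sum.distrib sum_negf sum_subtractf)
    also have "(\<Sum>b\<in>bas T. \<Sum>c\<in>bas T. \<beta> (e c) (br x b) *s m c (e b)) = (\<Sum>b\<in>bas T. \<Sum>c\<in>bas T. \<beta> (e b) (br x c) *s m b (e c))"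
      by (rule sum.swap)
    finally show ?thesis by simp
  qed
  thus ?thesis using e by (intro exI[of _ e]) blast
qed

end

text \<open>Semisimplicity is expressed through abelian ideals: this form is easily checked for a
  quotient, by lifting an ideal to its preimage.\<close>

locale semisimple_carrier = lie_carrier +
  assumes abelian_ideal_zero: "sideal I \<Longrightarrow> (\<And>x y. x \<in> I \<Longrightarrow> y \<in> I \<Longrightarrow> br x y = 0) \<Longrightarrow> I \<subseteq> {0}"

locale semisimple_rep = lie_rep + semisimple_carrier
begin

text \<open>Cartan's criterion for ideals on which the action is faithful. A perfect
  \<open>N\<close> acts trivially by \<open>perfect_null_form_acts_trivially\<close>, so
  faithfulness gives zero. Otherwise \<open>[N,N]\<close> is smaller, hence zero by induction, and
  \<open>N\<close> is an abelian ideal.\<close>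

lemma null_ideal_zero:
  assumes "sideal N" "\<And>x. x \<in> N \<Longrightarrow> (\<And>v. v \<in> V \<Longrightarrow> act x v = 0) \<Longrightarrow> x = 0"
    "\<And>x y. x \<in> N \<Longrightarrow> y \<in> N \<Longrightarrow> form x y = 0"
  shows "N \<subseteq> {0}"
  using assms
proof (induction "dim N" arbitrary: N rule: less_induct)
  case less
  let ?B = "span {br a b | a b. a \<in> N \<and> b \<in> N}"
  note N = sidealD[OF less.prems(1)]
  note B = sideal_brackets[OF less.prems(1)]
  show ?case
  proof (cases "?B = N")
    case True
    have "act x v = 0" if "x \<in> N" "v \<in> V" for x v
    proof (rule perfect_null_form_acts_trivially[of N])
      show "N \<subseteq> S" using N(2) by blast
      show "br a b \<in> N" if "a \<in> N" "b \<in> N" for a b using N(2,3) that by blast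
      show "N \<subseteq> ?B" using True by simp
    qed (fact N(1) less.prems(3) that)+
    thus ?thesis using less.prems(2) by blast
  next
    case False
    hence "?B \<subset> N" using B by blast
    hence "dim ?B < dim N" using N(1) by (intro dim_psubset) (simp add: span_span span_eq_iff[THEN iffD2, OF N(1)])
    hence "?B \<subseteq> {0}"
    proof (rule less.hyps)
      show "x = 0" if "x \<in> ?B" "\<And>v. v \<in> V \<Longrightarrow> act x v = 0" for x
        using that B(2) less.prems(2) by blast
      show "form x y = 0" if "x \<in> ?B" "y \<in> ?B" for x y
        using that B(2) less.prems(3) by blast
    qed (fact B(1))
    moreover have "br x y \<in> ?B" if "x \<in> N" "y \<in> N" for x y by (rule span_base) (use that in blast)
    ultimately have "br x y = 0" if "x \<in> N" "y \<in> N" for x y using that by blast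
    thus ?thesis by (rule abelian_ideal_zero[OF less.prems(1)])
  qed
qed

end

sublocale semisimple_carrier \<subseteq> adj: semisimple_rep scale Basis S br S br
  by unfold_locales

subsection \<open>Vanishing of the second cohomology\<close>

context semisimple_carrier begin

lemma center_zero: "x \<in> S \<Longrightarrow> (\<And>y. y \<in> S \<Longrightarrow> br x y = 0) \<Longrightarrow> x = 0"
proof -
  assume x: "x \<in> S" "\<And>y. y \<in> S \<Longrightarrow> br x y = 0"
  let ?Z = "{x\<in>S. \<forall>y\<in>S. br x y = 0}"
  have "?Z \<subseteq> {0}"
  proof (rule abelian_ideal_zero)
    have "subspace ?Z" using subspace_S by (auto simp: subspace_def br_simps)
    moreover have "br x z = 0" if "x \<in> S" "z \<in> ?Z" for x z using that br_anti[of x z] by auto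
    ultimately show "sideal ?Z" using subspace_0[OF subspace_S] by (auto simp: sideal_def br_simps)
  qed auto
  thus ?thesis using x by blast
qed

lemma killing_null_ideal:
  assumes "sideal N" "\<And>x y. x \<in> N \<Longrightarrow> y \<in> N \<Longrightarrow> adj.form x y = 0"
  shows "N \<subseteq> {0}"
proof (rule adj.null_ideal_zero[OF assms(1) _ assms(2)])
  show "x = 0" if "x \<in> N" "\<And>v. v \<in> S \<Longrightarrow> br x v = 0" for x
    using center_zero that sidealD(2)[OF assms(1)] by blast
qed

lemma killing_orthogonal_ideal:
  assumes K: "sideal K"
  shows "sideal {x\<in>S. \<forall>k\<in>K. adj.form x k = 0}"
proof -
  note f = adj.form_functional(1)
  have "subspace {x\<in>S. \<forall>k\<in>K. adj.form x k = 0}"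
    unfolding subspace_def using sidealD(2)[OF K] subspace_S
    by (auto simp: subspace_0 subspace_add subspace_scale functional_on_simps(1)[OF f subspace_S] functional_onD[OF f])
  moreover have "adj.form (br y x) k = 0" if "y \<in> S" "x \<in> S" "\<forall>k\<in>K. adj.form x k = 0" "k \<in> K" for y x k
    using adj.form_ad[of y x k] that sidealD[OF K] by auto
  ultimately show ?thesis by (auto simp: sideal_def br_closed)
qed

text \<open>The ideal \<open>T \<inter> K\<close> has zero Killing form and so vanishes. Hence the
  form is nondegenerate on \<open>K\<close>, and the functional given by \<open>s\<close> on
  \<open>K\<close> is represented by some \<open>k\<close> in \<open>K\<close>; the difference
  \<open>s - k\<close> is orthogonal to \<open>K\<close>.\<close>

lemma killing_orthogonal_complement:
  assumes K: "sideal K"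
  defines "T \<equiv> {x\<in>S. \<forall>k\<in>K. adj.form x k = 0}"
  shows "T \<inter> K \<subseteq> {0}" "s \<in> S \<Longrightarrow> \<exists>k\<in>K. s - k \<in> T"
proof -
  have T: "sideal T" unfolding T_def by (rule killing_orthogonal_ideal[OF K])
  note KD = sidealD[OF K]
  note f = adj.form_functional
  have fK: "functional_on K (adj.form x)" "functional_on K (\<lambda>y. adj.form y x)" if "x \<in> S" for x
    using f[OF that] KD(2) by (auto simp: functional_on_def)
  show TK: "T \<inter> K \<subseteq> {0}"
  proof (rule killing_null_ideal)
    have "subspace (T \<inter> K)" using KD(1) sidealD(1)[OF T] by (rule subspace_inter[rotated])
    thus "sideal (T \<inter> K)" using KD(2,3) sidealD(3)[OF T] by (auto simp: sideal_def)
  qed (auto simp: T_def)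
  show "\<exists>k\<in>K. s - k \<in> T" if s: "s \<in> S"
  proof -
    have "\<exists>k\<in>K. \<forall>y\<in>K. adj.form k y = adj.form s y"
    proof (rule nondegenerate_represents[OF KD(1)])
      show "x = 0" if "x \<in> K" "\<And>y. y \<in> K \<Longrightarrow> adj.form x y = 0" for x
        using that TK KD(2) by (auto simp: T_def)
    qed (use fK s KD(2) in blast)+
    then obtain k where k: "k \<in> K" "\<forall>y\<in>K. adj.form k y = adj.form s y" by blast
    have "adj.form (s - k) y = 0" if "y \<in> K" for y
      using functional_on_simps(3)[OF f(1)[OF KD(2)[OF that]] subspace_S s KD(2)[OF k(1)]] k(2) that by simp
    moreover have "s - k \<in> S" using subspace_diff[OF subspace_S s] KD(2)[OF k(1)] by blast
    ultimately show ?thesis using k(1) unfolding T_def by blast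
  qed
qed

lemma killing_nondegenerate:
  assumes "x \<in> S" "\<And>y. y \<in> S \<Longrightarrow> adj.form x y = 0"
  shows "x = 0"
proof -
  have S: "sideal S" using subspace_S br_closed by (auto simp: sideal_def)
  show ?thesis using killing_orthogonal_complement(1)[OF S] assms by blast
qed

text \<open>Choose \<open>d\<close> to represent the functional \<open>tr (D ad x)\<close>. Then
  \<open>E = D - ad d\<close> is a derivation with \<open>tr (E ad x) = 0\<close> for all
  \<open>x\<close>. Since \<open>ad (E x)\<close> is the commutator of \<open>E\<close> and
  \<open>ad x\<close>, the Killing form of \<open>E x\<close> and \<open>y\<close> equals
  \<open>tr (E ad [x,y])\<close>, which is zero.\<close>

lemma derivation_inner:
  assumes D: "lin D" "\<And>x. x \<in> S \<Longrightarrow> D x \<in> S"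
    and der: "\<And>x y. x \<in> S \<Longrightarrow> y \<in> S \<Longrightarrow> D (br x y) = br (D x) y + br x (D y)"
  shows "\<exists>d\<in>S. \<forall>x\<in>S. D x = br d x"
proof -
  note f = adj.form_functional
  have ladd: "lin (br x)" for x by (rule bilinD[OF bilin_br])
  have "functional_on S (\<lambda>x. tr S (\<lambda>v. D (br x v)))"
    by (simp add: functional_on_def br_simps lin_simps[OF D(1)] tr_add[OF subspace_S] tr_scale[OF subspace_S] D(2) br_closed)
  then obtain d where d: "d \<in> S" "\<And>x. x \<in> S \<Longrightarrow> adj.form d x = tr S (\<lambda>v. D (br x v))"
    using nondegenerate_represents[OF subspace_S f(1) f(2) killing_nondegenerate] by blast
  define E where "E x = D x - br d x" for x
  have E: "E x \<in> S" if "x \<in> S" for x unfolding E_def using that d D by (intro subspace_diff[OF subspace_S] br_closed) auto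
  have linE: "lin E" unfolding E_def by (simp add: lin_iff lin_simps[OF D(1)] br_simps algebra_simps)
  have derE: "E (br x y) = br (E x) y + br x (E y)" if "x \<in> S" "y \<in> S" for x y
    using br_br[OF d(1) that] by (simp add: E_def der[OF that] br_simps algebra_simps)
  have endoE: "endo S E" using E linE by (simp add: endo_def)
  have trE: "tr S (\<lambda>v. E (br x v)) = 0" if "x \<in> S" for x
    using that d by (simp add: E_def tr_diff[OF subspace_S] D(2) br_closed adj.form_def[symmetric])
  have "E x = 0" if x: "x \<in> S" for x
  proof (rule killing_nondegenerate[OF E[OF x]])
    fix y assume y: "y \<in> S"
    have "adj.form (E x) y = tr S (\<lambda>v. E (br x (br y v)) - br x (E (br y v)))"
      unfolding adj.form_def using x y by (intro tr_cong[OF subspace_S]) (simp add: derE br_closed)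
    also have "\<dots> = tr S (\<lambda>v. E (br x (br y v))) - tr S (\<lambda>v. br x (E (br y v)))"
      using x y by (intro tr_diff[OF subspace_S]) (simp_all add: E br_closed)
    also have "tr S (\<lambda>v. br x (E (br y v))) = tr S (\<lambda>v. E (br y (br x v)))"
      by (rule tr_comp[OF subspace_S adj.endo_act[OF x] endo_compose[OF endoE adj.endo_act[OF y]]])
    also have "tr S (\<lambda>v. E (br x (br y v))) - \<dots> = tr S (\<lambda>v. E (br x (br y v)) - E (br y (br x v)))"
      using x y by (intro tr_diff[OF subspace_S, symmetric]) (simp_all add: E br_closed)
    also have "\<dots> = tr S (\<lambda>v. E (br (br x y) v))"
      using x y by (intro tr_cong[OF subspace_S]) (simp add: br_br lin_simps[OF linE])
    also have "\<dots> = 0" using x y by (intro trE br_closed)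
    finally show "adj.form (E x) y = 0" .
  qed
  thus ?thesis using d(1) by (intro bexI[of _ d]) (auto simp: E_def)
qed

end

section \<open>The Casimir operator of a representation\<close>

context lie_rep begin

lemma casimir_commutes:
  assumes B: "\<And>b. b \<in> B \<Longrightarrow> b \<in> S" "\<And>b. b \<in> B \<Longrightarrow> e b \<in> S"
    and inv: "\<And>m x. bilin m \<Longrightarrow> x \<in> S \<Longrightarrow> (\<Sum>b\<in>B. m (br x b) (e b) + m b (br x (e b))) = 0"
    and x: "x \<in> S" and v: "v \<in> V"
  shows "act x (\<Sum>b\<in>B. act b (act (e b) v)) = (\<Sum>b\<in>B. act b (act (e b) (act x v)))"
proof -
  \<comment> \<open>For this bilinear map, invariance of the dual bases says that the commutator of
    \<open>act x\<close> with the Casimir operator vanishes at \<open>v\<close>.\<close>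
  have "bilin (\<lambda>u w. act u (act w v))" by (simp add: bilin_def lin_iff act_simps)
  from inv[OF this x] have "0 = (\<Sum>b\<in>B. act (br x b) (act (e b) v) + act b (act (br x (e b)) v))" by simp
  also have "\<dots> = (\<Sum>b\<in>B. act x (act b (act (e b) v)) - act b (act (e b) (act x v)))"
    using B x v by (intro sum.cong refl) (simp add: act_br act_closed act_simps)
  also have "\<dots> = act x (\<Sum>b\<in>B. act b (act (e b) v)) - (\<Sum>b\<in>B. act b (act (e b) (act x v)))"
    by (simp add: act_simps sum_subtractf)
  finally show ?thesis by simp
qed

end

context semisimple_rep begin

definition irreducible_rep :: bool where
  "irreducible_rep \<longleftrightarrow> (\<forall>W. subspace W \<and> W \<subseteq> V \<and> (\<forall>x\<in>S. \<forall>w\<in>W. act x w \<in> W) \<longrightarrow> W \<subseteq> {0} \<or> W = V)"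

lemma kernel_ideal: "sideal {x\<in>S. \<forall>v\<in>V. act x v = 0}"
proof -
  have "subspace {x\<in>S. \<forall>v\<in>V. act x v = 0}"
    using subspace_S by (auto simp: subspace_def act_simps)
  thus ?thesis by (auto simp: sideal_def br_closed act_br act_closed act_simps)
qed

text \<open>The Casimir operator is formed from an ideal complementing the kernel of the representation,
  on which the trace form is nondegenerate; its trace is the dimension of that ideal.\<close>

lemma casimir_exists:
  assumes irr: "irreducible_rep" and nontriv: "x0 \<in> S" "v0 \<in> V" "act x0 v0 \<noteq> 0"
  shows "\<exists>B e. (\<forall>b\<in>B. b \<in> S \<and> e b \<in> S) \<and>
    (\<forall>m x. bilin m \<longrightarrow> x \<in> S \<longrightarrow> (\<Sum>b\<in>B. m (br x b) (e b) + m b (br x (e b))) = 0) \<and>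
    (\<forall>v\<in>V. (\<Sum>b\<in>B. act b (act (e b) v)) = 0 \<longrightarrow> v = 0)"
proof -
  let ?K = "{x\<in>S. \<forall>v\<in>V. act x v = 0}"
  define T where "T = {x\<in>S. \<forall>k\<in>?K. adj.form x k = 0}"
  have T: "sideal T" unfolding T_def by (rule killing_orthogonal_ideal[OF kernel_ideal])
  note TD = sidealD[OF T]
  have TK: "T \<inter> ?K \<subseteq> {0}" "\<And>s. s \<in> S \<Longrightarrow> \<exists>k\<in>?K. s - k \<in> T"
    using killing_orthogonal_complement[OF kernel_ideal] unfolding T_def by simp_all
  have "\<not> T \<subseteq> {0}"
  proof
    assume "T \<subseteq> {0}"
    hence "x0 \<in> ?K" using TK(2)[OF nontriv(1)] by auto
    thus False using nontriv by auto
  qed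
  hence dimT: "dim T \<noteq> 0" by (simp add: dim_eq_0)
  note f = form_functional
  have fT: "functional_on T (form x)" "functional_on T (\<lambda>y. form y x)" if "x \<in> S" for x
    using f[OF that] TD(2) by (auto simp: functional_on_def)
  have nondeg: "x = 0" if x: "x \<in> T" "\<And>y. y \<in> T \<Longrightarrow> form x y = 0" for x
  proof -
    \<comment> \<open>The radical of the trace form on \<open>T\<close>. It meets the kernel of the
      representation trivially, so the action on it is faithful and \<open>null_ideal_zero\<close>
      applies.\<close>
    let ?N = "{x\<in>T. \<forall>y\<in>T. form x y = 0}"
    have "?N \<subseteq> {0}"
    proof (rule null_ideal_zero)
      have "subspace ?N"
        unfolding subspace_def using TD(1,2)
        by (auto simp: subspace_0 subspace_add subspace_scale functional_on_simps(1)[OF fT(2) TD(1)] functional_onD[OF fT(2)])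
      moreover have "form (br x y) z = 0" if "x \<in> S" "y \<in> ?N" "z \<in> T" for x y z
        using that form_ad[of x y z] TD(2,3) by auto
      ultimately show "sideal ?N" using TD(2,3) by (auto simp: sideal_def)
      show "x = 0" if "x \<in> ?N" "\<And>v. v \<in> V \<Longrightarrow> act x v = 0" for x
        using that TK(1) TD(2) by blast
    qed auto
    thus ?thesis using x by blast
  qed
  have bT: "b \<in> T" if "b \<in> bas T" for b using that bas(1)[OF TD(1)] by auto
  have "\<exists>e. (\<forall>b\<in>bas T. e b \<in> T \<and> (\<forall>y\<in>T. form (e b) y = co T y b)) \<and>
    (\<forall>m x. bilin m \<longrightarrow> x \<in> S \<longrightarrow> (\<Sum>b\<in>bas T. m (br x b) (e b) + m b (br x (e b))) = 0)"
  proof (rule dual_bases_invariant[OF T])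
    fix x assume "x \<in> T"
    thus "functional_on T (\<lambda>y. form y x)" "functional_on T (form x)" using fT TD(2) by simp_all
  next
    fix x assume "x \<in> T" "\<And>y. y \<in> T \<Longrightarrow> form x y = 0"
    thus "x = 0" by (rule nondeg)
  next
    fix x y z assume "x \<in> S" "y \<in> T" "z \<in> T"
    thus "form (br x y) z = - form y (br x z)" using form_ad TD(2) by simp
  qed
  then obtain e where e: "\<And>b. b \<in> bas T \<Longrightarrow> e b \<in> T" "\<And>b y. b \<in> bas T \<Longrightarrow> y \<in> T \<Longrightarrow> form (e b) y = co T y b"
    and inv: "\<And>m x. bilin m \<Longrightarrow> x \<in> S \<Longrightarrow> (\<Sum>b\<in>bas T. m (br x b) (e b) + m b (br x (e b))) = 0" by blast
  have bS: "b \<in> S" "e b \<in> S" if "b \<in> bas T" for b using that bT e TD(2) by auto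
  define C where "C v = (\<Sum>b\<in>bas T. act b (act (e b) v))" for v
  have linC: "lin C" unfolding C_def
    by (simp add: lin_iff act_simps sum.distrib scale_sum_right)
  have CV: "C v \<in> V" if "v \<in> V" for v
    unfolding C_def using that bS by (intro subspace_sum[OF subspace_V] act_closed) auto
  have C_comm: "act x (C v) = C (act x v)" if "x \<in> S" "v \<in> V" for x v
    unfolding C_def by (rule casimir_commutes[OF bS inv that])
  have "tr V C = (\<Sum>b\<in>bas T. form b (e b))"
    unfolding C_def form_def using bS by (intro tr_sum[OF subspace_V]) (auto intro!: act_closed)
  also have "\<dots> = (\<Sum>b\<in>bas T. 1)"
    using bS e(2) bT by (intro sum.cong refl) (simp add: form_sym[of _ "e _"] co_bas[OF TD(1)])
  finally have "tr V C \<noteq> 0" using dimT bas(5)[OF TD(1)] by simp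
  hence "\<exists>v\<in>V. C v \<noteq> 0" using tr_cong[OF subspace_V, of C "\<lambda>_. 0"] tr_zero[OF subspace_V] by auto
  \<comment> \<open>Since \<open>C\<close> commutes with the action, its kernel is a submodule; it
    is not all of \<open>V\<close> because the trace is nonzero.\<close>
  moreover have "{v\<in>V. C v = 0} \<subseteq> {0} \<or> {v\<in>V. C v = 0} = V"
  proof -
    have irrD: "W \<subseteq> {0} \<or> W = V" if "subspace W" "W \<subseteq> V" "\<And>x w. x \<in> S \<Longrightarrow> w \<in> W \<Longrightarrow> act x w \<in> W" for W
      using irr that unfolding irreducible_rep_def by blast
    show ?thesis
    proof (rule irrD)
      show "subspace {v\<in>V. C v = 0}"
        using subspace_V by (auto simp: subspace_def lin_simps[OF linC])
      show "act x w \<in> {v\<in>V. C v = 0}" if "x \<in> S" "w \<in> {v\<in>V. C v = 0}" for x w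
        using that C_comm[of x w] by (auto simp: act_closed act_simps)
    qed auto
  qed
  ultimately have "{v\<in>V. C v = 0} \<subseteq> {0}" by blast
  thus ?thesis using bS inv unfolding C_def by (intro exI[of _ "bas T"] exI[of _ e]) blast
qed

end

section \<open>Two-cocycles and coboundaries with values in a module\<close>

context lie_rep begin

text \<open>This is a 2-cocycle of the Chevalley-Eilenberg complex; \<open>coboundary\<close> is the
  differential of a 1-cochain and \<open>splits\<close> says that the class vanishes.\<close>

definition cocycle :: "('v \<Rightarrow> 'v \<Rightarrow> 'v) \<Rightarrow> bool" where
  "cocycle f \<longleftrightarrow> bilin f \<and> (\<forall>x\<in>S. \<forall>y\<in>S. f x y \<in> V) \<and> (\<forall>x\<in>S. f x x = 0) \<and>
    (\<forall>x\<in>S. \<forall>y\<in>S. \<forall>z\<in>S. act x (f y z) - act y (f x z) + act z (f x y)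
       - f (br x y) z + f (br x z) y - f (br y z) x = 0)"

definition coboundary :: "('v \<Rightarrow> 'v) \<Rightarrow> 'v \<Rightarrow> 'v \<Rightarrow> 'v" where
  "coboundary \<phi> x y = act x (\<phi> y) - act y (\<phi> x) - \<phi> (br x y)"

definition splits :: "('v \<Rightarrow> 'v \<Rightarrow> 'v) \<Rightarrow> bool" where
  "splits f \<longleftrightarrow> (\<exists>\<phi>. lin \<phi> \<and> (\<forall>x\<in>S. \<phi> x \<in> V) \<and> (\<forall>x\<in>S. \<forall>y\<in>S. f x y = coboundary \<phi> x y))"

lemma cocycleD:
  assumes "cocycle f"
  shows "bilin f" "x \<in> S \<Longrightarrow> y \<in> S \<Longrightarrow> f x y \<in> V" "x \<in> S \<Longrightarrow> f x x = 0"
    "x \<in> S \<Longrightarrow> y \<in> S \<Longrightarrow> z \<in> S \<Longrightarrow> act x (f y z) - act y (f x z) + act z (f x y)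
       - f (br x y) z + f (br x z) y - f (br y z) x = 0"
  using assms unfolding cocycle_def by blast+

lemma cocycle_anti: assumes "cocycle f" "x \<in> S" "y \<in> S" shows "f x y = - f y x"
proof -
  have "f (x + y) (x + y) = 0"
    by (rule cocycleD(3)[OF assms(1) subspace_add[OF subspace_S assms(2,3)]])
  thus ?thesis using cocycleD(3)[OF assms(1,2)] cocycleD(3)[OF assms(1,3)]
    by (simp add: bilin_simps[OF cocycleD(1)[OF assms(1)]] eq_neg_iff_add_eq_0 add.commute)
qed

lemma coboundary_closed: "(\<And>x. x \<in> S \<Longrightarrow> \<phi> x \<in> V) \<Longrightarrow> x \<in> S \<Longrightarrow> y \<in> S \<Longrightarrow> coboundary \<phi> x y \<in> V"
  unfolding coboundary_def by (intro subspace_diff[OF subspace_V] act_closed) (auto simp: br_closed)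

lemma bilin_coboundary: "lin \<phi> \<Longrightarrow> bilin (coboundary \<phi>)"
  by (simp add: bilin_def lin_iff coboundary_def act_simps br_simps algebra_simps)

lemma coboundary_cocycle:
  assumes \<phi>: "lin \<phi>" "\<And>x. x \<in> S \<Longrightarrow> \<phi> x \<in> V"
  shows "cocycle (coboundary \<phi>)"
  unfolding cocycle_def
proof (intro conjI ballI)
  show "bilin (coboundary \<phi>)" by (rule bilin_coboundary[OF \<phi>(1)])
  show "coboundary \<phi> x y \<in> V" if "x \<in> S" "y \<in> S" for x y
    by (rule coboundary_closed[OF \<phi>(2) that])
  show "coboundary \<phi> x x = 0" if "x \<in> S" for x
    using that by (simp add: coboundary_def br_self lin_simps[OF \<phi>(1)])
  fix x y z assume S: "x \<in> S" "y \<in> S" "z \<in> S"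
  have "br (br x y) z - br (br x z) y + br (br y z) x = 0"
  proof -
    have "br (br x y) z = - br z (br x y)" "br (br x z) y = - br y (br x z)" "br (br y z) x = - br x (br y z)"
      using S by (auto intro!: br_anti br_closed)
    moreover have "br y (br z x) = - br y (br x z)" using br_anti[OF S(3,1)] by (simp add: br_simps)
    ultimately have "br (br x y) z - br (br x z) y + br (br y z) x =
        - (br x (br y z) + br y (br z x) + br z (br x y))" by (simp add: algebra_simps)
    thus ?thesis using br_jacobi[OF S] by simp
  qed
  hence "\<phi> (br (br x y) z) - \<phi> (br (br x z) y) + \<phi> (br (br y z) x) = 0"
    by (simp only: lin_simps(1,5)[OF \<phi>(1), symmetric] lin_simps(3)[OF \<phi>(1)])
  thus "act x (coboundary \<phi> y z) - act y (coboundary \<phi> x z) + act z (coboundary \<phi> x y)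
       - coboundary \<phi> (br x y) z + coboundary \<phi> (br x z) y - coboundary \<phi> (br y z) x = 0"
    using S by (simp add: coboundary_def act_simps act_br \<phi>(2) algebra_simps)
qed


text \<open>Contraction with the dual bases is a homotopy between the Casimir operator and zero.\<close>

lemma cocycle_homotopy:
  assumes f: "cocycle f"
    and Be: "\<And>b. b \<in> B \<Longrightarrow> b \<in> S" "\<And>b. b \<in> B \<Longrightarrow> e b \<in> S"
    and inv: "\<And>m x. bilin m \<Longrightarrow> x \<in> S \<Longrightarrow> (\<Sum>b\<in>B. m (br x b) (e b) + m b (br x (e b))) = 0"
    and yz: "y \<in> S" "z \<in> S"
  shows "coboundary (\<lambda>x. \<Sum>b\<in>B. act b (f (e b) x)) y z = (\<Sum>b\<in>B. act b (act (e b) (f y z)))"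
proof -
  note fs = bilin_simps[OF cocycleD(1)[OF f]]
  \<comment> \<open>Invariance for the bilinear map sending \<open>u\<close>, \<open>w\<close> to
    \<open>act u (f w z)\<close> trades the bracket of \<open>y\<close> with \<open>b\<close> for
    one with \<open>e b\<close>, so that \<open>act b\<close> can be factored out of every
    term.\<close>
  have move: "act y (\<Sum>b\<in>B. act b (f (e b) z)) = (\<Sum>b\<in>B. act b (act y (f (e b) z) - f (br y (e b)) z))"
    if "y \<in> S" "z \<in> S" for y z
  proof -
    have "bilin (\<lambda>u w. act u (f w z))" by (simp add: bilin_def lin_iff act_simps fs)
    from inv[OF this \<open>y \<in> S\<close>]
    have "(\<Sum>b\<in>B. act (br y b) (f (e b) z)) = - (\<Sum>b\<in>B. act b (f (br y (e b)) z))"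
      by (simp add: sum.distrib eq_neg_iff_add_eq_0)
    moreover have "act y (\<Sum>b\<in>B. act b (f (e b) z)) = (\<Sum>b\<in>B. act (br y b) (f (e b) z)) + (\<Sum>b\<in>B. act b (act y (f (e b) z)))"
      using that Be by (simp add: act_simps act_br cocycleD(2)[OF f] sum.distrib[symmetric])
    ultimately show ?thesis by (simp add: act_simps sum_subtractf)
  qed
  have "coboundary (\<lambda>x. \<Sum>b\<in>B. act b (f (e b) x)) y z =
      (\<Sum>b\<in>B. act b (act y (f (e b) z) - f (br y (e b)) z - (act z (f (e b) y) - f (br z (e b)) y) - f (e b) (br y z)))"
    unfolding coboundary_def move[OF yz] move[OF yz(2,1)]
    by (simp add: act_simps sum_subtractf)
  also have "\<dots> = (\<Sum>b\<in>B. act b (act (e b) (f y z)))"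
  proof (rule sum.cong[OF refl])
    fix b assume b: "b \<in> B"
    note eb = Be(2)[OF b]
    have "br (e b) y = - br y (e b)" "br (e b) z = - br z (e b)" "f (br y z) (e b) = - f (e b) (br y z)"
      by (rule br_anti[OF eb yz(1)], rule br_anti[OF eb yz(2)],
          rule cocycle_anti[OF f br_closed[OF yz] eb])
    hence "act (e b) (f y z) - act y (f (e b) z) + act z (f (e b) y)
       + f (br y (e b)) z - f (br z (e b)) y + f (e b) (br y z) = 0"
      using cocycleD(4)[OF f eb yz] by (simp add: fs)
    hence "act y (f (e b) z) - f (br y (e b)) z - (act z (f (e b) y) - f (br z (e b)) y) - f (e b) (br y z) = act (e b) (f y z)"
      by (simp add: algebra_simps)
    thus "act b (act y (f (e b) z) - f (br y (e b)) z - (act z (f (e b) y) - f (br z (e b)) y) - f (e b) (br y z))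
        = act b (act (e b) (f y z))" by simp
  qed
  finally show ?thesis .
qed

end

context semisimple_rep begin

lemma cocycle_splits_irreducible:
  assumes irr: "irreducible_rep" and nontriv: "x0 \<in> S" "v0 \<in> V" "act x0 v0 \<noteq> 0" and f: "cocycle f"
  shows "splits f"
proof -
  from casimir_exists[OF irr nontriv] obtain B e where *: "\<forall>b\<in>B. b \<in> S \<and> e b \<in> S"
    "\<forall>m x. bilin m \<longrightarrow> x \<in> S \<longrightarrow> (\<Sum>b\<in>B. m (br x b) (e b) + m b (br x (e b))) = 0"
    "\<forall>v\<in>V. (\<Sum>b\<in>B. act b (act (e b) v)) = 0 \<longrightarrow> v = 0"
    by (elim exE conjE)
  have Be: "b \<in> S" "e b \<in> S" if "b \<in> B" for b using *(1) that by simp_all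
  have inv: "(\<Sum>b\<in>B. m (br x b) (e b) + m b (br x (e b))) = 0" if "bilin m" "x \<in> S" for m x
    using *(2)[rule_format, OF that] .
  have inj: "v = 0" if "v \<in> V" "(\<Sum>b\<in>B. act b (act (e b) v)) = 0" for v
    using *(3) that by simp
  interpret pair: finite_dimensional_vector_space_pair_1 scale Basis scale ..
  note fs = bilin_simps[OF cocycleD(1)[OF f]]
  define C where "C v = (\<Sum>b\<in>B. act b (act (e b) v))" for v
  define h where "h x = (\<Sum>b\<in>B. act b (f (e b) x))" for x
  have linC: "lin C" unfolding C_def by (simp add: lin_iff act_simps sum.distrib scale_sum_right)
  have CV: "C v \<in> V" if "v \<in> V" for v
    unfolding C_def by (rule subspace_sum[OF subspace_V]) (simp add: Be act_closed that)
  have C_comm: "act x (C v) = C (act x v)" if "x \<in> S" "v \<in> V" for x v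
    unfolding C_def by (rule casimir_commutes[OF Be inv that])
  have linh: "lin h" unfolding h_def by (simp add: lin_iff act_simps fs sum.distrib scale_sum_right)
  have hV: "h x \<in> V" if "x \<in> S" for x
    unfolding h_def by (rule subspace_sum[OF subspace_V]) (simp add: Be act_closed that cocycleD(2)[OF f])
  have inj_C: "inj_on C V"
  proof (rule inj_onI)
    fix v w assume vw: "v \<in> V" "w \<in> V" "C v = C w"
    hence "C (v - w) = 0" by (simp add: lin_simps[OF linC])
    thus "v = w" using inj[of "v - w"] subspace_diff[OF subspace_V vw(1,2)] by (simp add: C_def)
  qed
  \<comment> \<open>On \<open>V\<close> this is the inverse of \<open>C\<close>; taking it linear on
    the whole space with values in \<open>V\<close> lets it be composed freely.\<close>
  obtain g where "g ` UNIV \<subseteq> V" and g: "lin g" "\<And>v. v \<in> V \<Longrightarrow> g (C v) = v"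
    using pair.linear_exists_left_inverse_on[OF linC subspace_V inj_C] by blast
  hence gV: "g v \<in> V" for v by auto
  have "dim (C ` V) = dim V"
    using inj_C by (intro pair.dim_image_eq[OF linC]) (simp add: span_eq_iff[THEN iffD2, OF subspace_V])
  moreover have "subspace (C ` V)"
    by (rule Modules.module_hom.subspace_image[OF linear_imp_module_hom[OF linC] subspace_V])
  ultimately have "C ` V = V" using CV by (intro subspace_dim_equal subspace_V) auto
  hence Cg: "C (g v) = v" if "v \<in> V" for v using g(2) that by (metis imageE)
  define \<phi> where "\<phi> x = g (h x)" for x
  have "f x y = coboundary \<phi> x y" if xy: "x \<in> S" "y \<in> S" for x y
  proof -
    \<comment> \<open>As \<open>C\<close> commutes with the action, it commutes with the coboundary;
      the homotopy identifies the result with \<open>C (f x y)\<close>, and injectivity of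
      \<open>C\<close> finishes.\<close>
    have "C (coboundary \<phi> x y) = coboundary h x y"
      using xy by (simp add: coboundary_def \<phi>_def lin_simps[OF linC] C_comm[symmetric] gV Cg hV br_closed)
    also have "\<dots> = C (f x y)"
      unfolding h_def[abs_def] C_def by (rule cocycle_homotopy[OF f Be inv xy])
    finally show ?thesis
      using inj_C xy cocycleD(2)[OF f xy] coboundary_closed[of \<phi> x y] gV
      by (simp add: inj_on_eq_iff \<phi>_def)
  qed
  thus ?thesis unfolding splits_def using lin_compose_fun[OF g(1) linh] gV
    by (intro exI[of _ \<phi>]) (simp add: \<phi>_def[abs_def])
qed

lemma cocycle_splits_trivial:
  assumes triv: "\<And>x v. x \<in> S \<Longrightarrow> v \<in> V \<Longrightarrow> act x v = 0" and f: "cocycle f"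
  shows "splits f"
proof -
  note fs = bilin_simps[OF cocycleD(1)[OF f]]
  note kf = adj.form_functional
  obtain q where q: "lin q" "\<And>x. q x \<in> S" "\<And>x. x \<in> S \<Longrightarrow> q x = x" using projection_exists[OF subspace_S] by blast
  obtain e where e: "\<And>c. c \<in> bas S \<Longrightarrow> e c \<in> S" "\<And>c y. c \<in> bas S \<Longrightarrow> y \<in> S \<Longrightarrow> adj.form (e c) y = co S y c"
    using dual_basis_exists[OF subspace_S kf(1) kf(2) killing_nondegenerate] by blast
  have cS: "c \<in> S" if "c \<in> bas S" for c using that bas(1)[OF subspace_S] by auto
  have ex: "\<exists>d. d \<in> S \<and> (\<forall>x\<in>S. \<forall>y\<in>S. co V (f x y) b = adj.form d (br x y))" for b
  proof -
    define F where "F x y = co V (f x y) b" for x y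
    have F_fun: "functional_on S (F x)" if "x \<in> S" for x
      using that by (simp add: functional_on_def F_def fs co_simps[OF subspace_V] cocycleD(2)[OF f])
    have F_anti: "F x y = - F y x" if "x \<in> S" "y \<in> S" for x y
      using cocycle_anti[OF f that] co_simps(3)[OF subspace_V cocycleD(2)[OF f that(2,1)], of "-1" b]
      by (simp add: F_def)
    have F_coc: "F (br x y) z = F x (br y z) - F y (br x z)" if S: "x \<in> S" "y \<in> S" "z \<in> S" for x y z
    proof -
      have "f (br x y) z = f (br x z) y - f (br y z) x"
        using cocycleD(4)[OF f S] S by (simp add: triv cocycleD(2)[OF f] br_closed algebra_simps)
      hence "F (br x y) z = F (br x z) y - F (br y z) x"
        using S by (simp add: F_def co_simps[OF subspace_V] cocycleD(2)[OF f] br_closed)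
      moreover have "F (br x z) y = - F y (br x z)" "F (br y z) x = - F x (br y z)"
        using S by (auto intro!: F_anti br_closed)
      ultimately show ?thesis by simp
    qed
    \<comment> \<open>Built from the dual basis so that the Killing form of \<open>D x\<close> and
      \<open>y\<close> is \<open>F x y\<close>. Under this correspondence the cocycle identity
      \<open>F_coc\<close> becomes the Leibniz rule.\<close>
    define D where "D x = (\<Sum>c\<in>bas S. F (q x) c *s e c)" for x
    have linD: "lin D"
      unfolding D_def F_def
      by (simp add: lin_iff lin_simps[OF q(1)] fs co_simps[OF subspace_V] cocycleD(2)[OF f] q(2) cS
          scale_left_distrib sum.distrib scale_sum_right)
    have DS: "D x \<in> S" for x unfolding D_def using e by (intro subspace_sum[OF subspace_S] subspace_scale[OF subspace_S])
    have D_form: "adj.form (D x) y = F x y" if xy: "x \<in> S" "y \<in> S" for x y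
    proof -
      note k = kf(1)[OF xy(2)]
      have "adj.form (D x) y = (\<Sum>c\<in>bas S. adj.form (F x c *s e c) y)"
        unfolding D_def q(3)[OF xy(1)]
        by (rule functional_on_simps(4)[OF k subspace_S]) (simp add: e subspace_scale[OF subspace_S])
      also have "\<dots> = (\<Sum>c\<in>bas S. co S y c * F x c)"
        using functional_onD(2)[OF k] e xy by (intro sum.cong refl) (simp add: mult.commute)
      also have "\<dots> = F x y" by (rule functional_on_expand[OF F_fun[OF xy(1)] subspace_S xy(2), symmetric])
      finally show ?thesis .
    qed
    have "D (br x y) = br (D x) y + br x (D y)" if xy: "x \<in> S" "y \<in> S" for x y
    proof -
      have "D (br x y) - (br (D x) y + br x (D y)) = 0"
      proof (rule killing_nondegenerate)
        show "D (br x y) - (br (D x) y + br x (D y)) \<in> S"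
          using xy DS by (intro subspace_diff[OF subspace_S] subspace_add[OF subspace_S] br_closed)
        fix z assume z: "z \<in> S"
        note k = kf(1)[OF z]
        have "adj.form (D (br x y) - (br (D x) y + br x (D y))) z
            = adj.form (D (br x y)) z - (adj.form (br (D x) y) z + adj.form (br x (D y)) z)"
          using xy DS by (simp add: functional_on_simps(3)[OF k subspace_S] functional_onD(1)[OF k] br_closed subspace_add[OF subspace_S])
        also have "\<dots> = F (br x y) z - (F x (br y z) - F y (br x z))"
          using xy z DS by (simp add: D_form br_closed adj.form_invariant[of "D x"] adj.form_ad[of x "D y"])
        finally show "adj.form (D (br x y) - (br (D x) y + br x (D y))) z = 0" using F_coc xy z by simp
      qed
      thus ?thesis by simp
    qed
    from derivation_inner[OF linD DS this] obtain d where d: "d \<in> S" "\<And>x. x \<in> S \<Longrightarrow> D x = br d x" by blast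
    have "co V (f x y) b = adj.form d (br x y)" if "x \<in> S" "y \<in> S" for x y
      using D_form[OF that] d that adj.form_invariant[of d x y] by (simp add: F_def)
    thus ?thesis using d(1) by blast
  qed
  from choice[OF allI[OF ex]] obtain d
    where "\<forall>b. d b \<in> S \<and> (\<forall>x\<in>S. \<forall>y\<in>S. co V (f x y) b = adj.form (d b) (br x y))" ..
  hence d: "d b \<in> S" "x \<in> S \<Longrightarrow> y \<in> S \<Longrightarrow> co V (f x y) b = adj.form (d b) (br x y)" for b x y
    by simp_all
  \<comment> \<open>Each coordinate of \<open>f x y\<close> depends on \<open>br x y\<close> only.
    The sign arises because for the trivial action the coboundary of \<phi> is minus \<phi> of the
    bracket.\<close>
  define \<phi> where "\<phi> x = - (\<Sum>b\<in>bas V. adj.form (d b) (q x) *s b)" for x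
  have "lin \<phi>"
    unfolding \<phi>_def
    by (simp add: lin_iff lin_simps[OF q(1)] functional_onD[OF kf(2)[OF d(1)]] q(2)
        scale_left_distrib sum.distrib scale_sum_right)
  moreover have \<phi>V: "\<phi> x \<in> V" for x
    unfolding \<phi>_def using bas(1)[OF subspace_V]
    by (intro subspace_neg[OF subspace_V] subspace_sum[OF subspace_V] subspace_scale[OF subspace_V]) auto
  moreover have "f x y = coboundary \<phi> x y" if xy: "x \<in> S" "y \<in> S" for x y
  proof -
    have "coboundary \<phi> x y = (\<Sum>b\<in>bas V. co V (f x y) b *s b)"
      unfolding coboundary_def triv[OF xy(1) \<phi>V] triv[OF xy(2) \<phi>V]
      using xy by (simp add: \<phi>_def q(3) br_closed d(2))
    thus ?thesis using co_sum[OF subspace_V cocycleD(2)[OF f xy]] by simp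
  qed
  ultimately show ?thesis unfolding splits_def by blast
qed

end

context semisimple_carrier begin

text \<open>For a proper nonzero submodule \<open>W\<close>, the quotient \<open>V/W\<close> is
  realised on the complement \<open>Q\<close>. Splitting \<open>f\<close> modulo \<open>W\<close> by
  \<phi> leaves a cocycle \<open>g\<close> with values in \<open>W\<close>, split there by \<psi>;
  then \<open>\<phi> + \<psi>\<close> splits \<open>f\<close>. Both modules have smaller dimension,
  so induction leaves the irreducible case with nonzero or zero action.\<close>

theorem cocycle_splits:
  assumes "lie_rep scale Basis S br V act" "lie_rep.cocycle scale S br V act f"
  shows "lie_rep.splits scale S br V act f"
  using assms
proof (induction "dim V" arbitrary: V act f rule: less_induct)
  case less
  interpret M: lie_rep scale Basis S br V act by (rule less.prems(1))
  interpret M: semisimple_rep scale Basis S br V act by unfold_locales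
  note f = less.prems(2)
  show ?case
  proof (cases "M.irreducible_rep")
    case True
    thus ?thesis using M.cocycle_splits_irreducible[OF True _ _ _ f] M.cocycle_splits_trivial[OF _ f] by blast
  next
    case False
    then obtain W where W: "subspace W" "W \<subseteq> V" "\<And>x w. x \<in> S \<Longrightarrow> w \<in> W \<Longrightarrow> act x w \<in> W" "\<not> W \<subseteq> {0}" "W \<noteq> V"
      unfolding M.irreducible_rep_def by blast
    obtain q where q: "lin q" "\<And>x. q x \<in> W" "\<And>x. x \<in> W \<Longrightarrow> q x = x" using projection_exists[OF W(1)] by blast
    define p where "p x = x - q x" for x
    have linp: "lin p" unfolding p_def by (simp add: lin_iff lin_simps[OF q(1)] algebra_simps)
    note ps = lin_simps[OF linp]
    have pV: "p v \<in> V" if "v \<in> V" for v unfolding p_def using that q W(2) by (intro subspace_diff[OF M.subspace_V]) auto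
    have p0: "p v = 0 \<longleftrightarrow> v \<in> W" for v using q by (metis p_def diff_self eq_iff_diff_eq_0)
    have pp: "p (p v) = p v" for v using q by (simp add: p_def lin_simps[OF q(1)])
    have pW: "v - p v \<in> W" for v using q by (simp add: p_def)
    define Q where "Q = p ` V"
    have QV: "Q \<subseteq> V" using pV by (auto simp: Q_def)
    have Q: "subspace Q" unfolding Q_def
      by (rule Modules.module_hom.subspace_image[OF linear_imp_module_hom[OF linp] M.subspace_V])
    have pQ: "p v = v" if "v \<in> Q" for v using that pp by (auto simp: Q_def)
    have p_act: "p (act x (p v)) = p (act x v)" if "x \<in> S" "v \<in> V" for x v
    proof -
      have "p (act x (v - p v)) = 0" using W(3)[OF that(1) pW] p0 by simp
      thus ?thesis by (simp add: M.act_simps ps)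
    qed
    interpret N: lie_rep scale Basis S br Q "\<lambda>x v. p (act x v)"
    proof unfold_locales
      show "bilin (\<lambda>x v. p (act x v))" by (simp add: bilin_def lin_iff ps M.act_simps)
      show "p (act x v) \<in> Q" if "x \<in> S" "v \<in> Q" for x v using that QV M.act_closed by (auto simp: Q_def)
      show "p (act (br x y) v) = p (act x (p (act y v))) - p (act y (p (act x v)))"
        if "x \<in> S" "y \<in> S" "v \<in> Q" for x y v
        using that QV by (simp add: subset_iff p_act M.act_closed M.act_br ps)
    qed (rule Q)
    have WV: "W \<subset> V" using W(2,5) by blast
    have dW: "dim W < dim V"
      using WV by (intro dim_psubset) (simp add: span_eq_iff[THEN iffD2, OF W(1)] span_eq_iff[THEN iffD2, OF M.subspace_V])
    have "Q \<noteq> V"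
    proof
      assume "Q = V"
      hence "W \<subseteq> {0}" using pQ p0 W(2) by (metis insertCI subsetD subsetI)
      thus False using W(4) by simp
    qed
    hence dQ: "dim Q < dim V"
      using QV by (intro dim_psubset) (simp add: psubset_eq span_eq_iff[THEN iffD2, OF Q] span_eq_iff[THEN iffD2, OF M.subspace_V])
    have "N.cocycle (\<lambda>x y. p (f x y))"
      unfolding N.cocycle_def
    proof (intro conjI ballI)
      show "bilin (\<lambda>x y. p (f x y))"
        using M.cocycleD(1)[OF f] by (simp add: bilin_def lin_iff ps)
      fix x y z assume S: "x \<in> S" "y \<in> S" "z \<in> S"
      show "p (act x (p (f y z))) - p (act y (p (f x z))) + p (act z (p (f x y)))
         - p (f (br x y) z) + p (f (br x z) y) - p (f (br y z) x) = 0"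
        using arg_cong[OF M.cocycleD(4)[OF f S], of p] S by (simp add: p_act M.cocycleD(2)[OF f] ps)
    qed (use M.cocycleD(2,3)[OF f] ps in \<open>auto simp: Q_def\<close>)
    from less.hyps[OF dQ N.lie_rep_axioms this]
    obtain \<phi> where \<phi>: "lin \<phi>" "\<And>x. x \<in> S \<Longrightarrow> \<phi> x \<in> Q" "\<And>x y. x \<in> S \<Longrightarrow> y \<in> S \<Longrightarrow> p (f x y) = N.coboundary \<phi> x y"
      unfolding N.splits_def by blast
    have \<phi>V: "\<phi> x \<in> V" if "x \<in> S" for x using \<phi>(2)[OF that] QV by blast
    define g where "g x y = f x y - M.coboundary \<phi> x y" for x y
    interpret W: lie_rep scale Basis S br W act
      by unfold_locales (use W M.bilin_act M.act_br in auto)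
    note c = M.coboundary_cocycle[OF \<phi>(1) \<phi>V]
    have gW: "g x y \<in> W" if xy: "x \<in> S" "y \<in> S" for x y
    proof -
      have "p (M.coboundary \<phi> x y) = N.coboundary \<phi> x y"
        using pQ[OF \<phi>(2)[OF br_closed[OF xy]]] by (simp add: M.coboundary_def N.coboundary_def ps)
      hence "p (g x y) = 0" using \<phi>(3)[OF xy] by (simp add: g_def ps)
      thus ?thesis by (simp add: p0)
    qed
    have "W.cocycle g"
      unfolding W.cocycle_def
    proof (intro conjI ballI)
      show "bilin g" using M.cocycleD(1)[OF f] M.cocycleD(1)[OF c]
        by (simp add: bilin_def lin_iff g_def algebra_simps)
      show "g x y \<in> W" if "x \<in> S" "y \<in> S" for x y by (rule gW[OF that])
      show "g x x = 0" if "x \<in> S" for x using M.cocycleD(3)[OF f that] M.cocycleD(3)[OF c that] by (simp add: g_def)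
      fix x y z assume S: "x \<in> S" "y \<in> S" "z \<in> S"
      show "act x (g y z) - act y (g x z) + act z (g x y) - g (br x y) z + g (br x z) y - g (br y z) x = 0"
        using M.cocycleD(4)[OF f S] M.cocycleD(4)[OF c S] by (simp add: g_def M.act_simps algebra_simps)
    qed
    from less.hyps[OF dW W.lie_rep_axioms this]
    obtain \<psi> where \<psi>: "lin \<psi>" "\<And>x. x \<in> S \<Longrightarrow> \<psi> x \<in> W" "\<And>x y. x \<in> S \<Longrightarrow> y \<in> S \<Longrightarrow> g x y = M.coboundary \<psi> x y"
      unfolding W.splits_def W.coboundary_def M.coboundary_def by blast
    have "lin (\<lambda>x. \<phi> x + \<psi> x)" using \<phi>(1) \<psi>(1) by (simp add: lin_iff algebra_simps)
    moreover have "\<phi> x + \<psi> x \<in> V" if "x \<in> S" for x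
      using \<phi>V[OF that] \<psi>(2)[OF that] W(2) by (intro subspace_add[OF M.subspace_V]) auto
    moreover have "f x y = M.coboundary (\<lambda>x. \<phi> x + \<psi> x) x y" if "x \<in> S" "y \<in> S" for x y
      using \<psi>(3)[OF that] by (simp add: g_def M.coboundary_def M.act_simps algebra_simps)
    ultimately show ?thesis unfolding M.splits_def by blast
  qed
qed

end

subsection \<open>Levi complements modulo the derived algebra\<close>

locale fd_lie_algebra = fd_space scale Basis + lie_algebra scale bracket
  for scale :: "'f :: field_char_0 \<Rightarrow> 'v :: ab_group_add \<Rightarrow> 'v" (infixr "*s" 75) and Basis bracket
begin

lemma bilin_bracket: "bilin bracket"
  by (simp add: bilin_def lin_iff bracket_add_left bracket_add_right bracket_scale_left bracket_scale_right)

lemmas bracket_simps = bilin_simps[OF bilin_bracket]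

lemma lie_carrier_UNIV: "lie_carrier scale Basis UNIV bracket"
  by unfold_locales (simp_all add: bilin_bracket bracket_self jacobi)

lemma bracket_anti: "bracket x y = - bracket y x"
  by (rule lie_carrier.br_anti[OF lie_carrier_UNIV]) simp_all

lemma bracket_bracket: "bracket (bracket x y) z = bracket x (bracket y z) - bracket y (bracket x z)"
  by (rule lie_carrier.br_br[OF lie_carrier_UNIV]) simp_all

lemma derived_mono: "A \<subseteq> B \<Longrightarrow> derived_subalgebra A \<subseteq> derived_subalgebra B"
  unfolding derived_subalgebra_def by (intro span_mono) blast

lemma derived_pow_mono: "A \<subseteq> B \<Longrightarrow> (derived_subalgebra ^^ n) A \<subseteq> (derived_subalgebra ^^ n) B"
  by (induction n) (simp_all add: derived_mono)

lemma subspace_derived: "subspace (derived_subalgebra A)"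
  by (simp add: derived_subalgebra_def)

lemma derived_I: "x \<in> A \<Longrightarrow> y \<in> A \<Longrightarrow> bracket x y \<in> derived_subalgebra A"
  unfolding derived_subalgebra_def by (intro span_base) blast

lemma derived_least: "subspace W \<Longrightarrow> (\<And>x y. x \<in> A \<Longrightarrow> y \<in> A \<Longrightarrow> bracket x y \<in> W) \<Longrightarrow> derived_subalgebra A \<subseteq> W"
  unfolding derived_subalgebra_def by (intro span_minimal) auto

lemma solvableI:
  assumes "subspace A" "(derived_subalgebra ^^ n) A \<subseteq> {0}"
  shows "lie_solvable A"
proof -
  have "0 \<in> (derived_subalgebra ^^ n) A"
    using assms(1) by (cases n) (simp_all add: subspace_0 subspace_derived)
  thus ?thesis using assms(2) unfolding lie_solvable_def by blast
qed

lemma solvable_subset: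
  assumes "lie_solvable R" "subspace A" "(derived_subalgebra ^^ k) A \<subseteq> R"
  shows "lie_solvable A"
proof -
  obtain n where n: "(derived_subalgebra ^^ n) R = {0}" using assms(1) unfolding lie_solvable_def by blast
  have "(derived_subalgebra ^^ (n + k)) A = (derived_subalgebra ^^ n) ((derived_subalgebra ^^ k) A)"
    by (simp add: funpow_add)
  hence "(derived_subalgebra ^^ (n + k)) A \<subseteq> {0}" using derived_pow_mono[OF assms(3), of n] n by simp
  thus ?thesis by (rule solvableI[OF assms(2)])
qed

lemma lie_idealD:
  assumes "lie_ideal U I"
  shows "subspace I" "x \<in> I \<Longrightarrow> x \<in> U" "x \<in> U \<Longrightarrow> y \<in> I \<Longrightarrow> bracket x y \<in> I" "x \<in> U \<Longrightarrow> y \<in> I \<Longrightarrow> bracket y x \<in> I"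
proof -
  show 1: "subspace I" "x \<in> I \<Longrightarrow> x \<in> U" "x \<in> U \<Longrightarrow> y \<in> I \<Longrightarrow> bracket x y \<in> I"
    using assms by (auto simp: lie_ideal_def)
  show "bracket y x \<in> I" if "x \<in> U" "y \<in> I"
    using assms that subspace_neg[of I "bracket x y"] bracket_anti[of y x] by (simp add: lie_ideal_def)
qed

lemma derived_ideal:
  assumes U: "lie_subalgebra U" and I: "lie_ideal U I"
  shows "lie_ideal U (derived_subalgebra I)" "derived_subalgebra I \<subseteq> I"
proof -
  note ID = lie_idealD[OF I]
  show sub: "derived_subalgebra I \<subseteq> I"
    by (rule derived_least[OF ID(1)]) (simp add: ID(2,3))
  have "bracket x y \<in> derived_subalgebra I" if x: "x \<in> U" and y: "y \<in> derived_subalgebra I" for x y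
  proof -
    have "derived_subalgebra I \<subseteq> {y. bracket x y \<in> derived_subalgebra I}"
    proof (rule derived_least)
      show "subspace {y. bracket x y \<in> derived_subalgebra I}"
        by (intro subspace_vimage bilinD[OF bilin_bracket] subspace_derived)
      fix a b assume ab: "a \<in> I" "b \<in> I"
      have "bracket x (bracket a b) = bracket (bracket x a) b + bracket a (bracket x b)" by (simp add: bracket_bracket)
      also have "\<dots> \<in> derived_subalgebra I"
        by (intro subspace_add[OF subspace_derived] derived_I ab ID(3)[OF x])
      finally show "bracket a b \<in> {y. bracket x y \<in> derived_subalgebra I}" by simp
    qed
    thus ?thesis using y by blast
  qed
  thus "lie_ideal U (derived_subalgebra I)"
    using sub ID(2) by (auto simp: lie_ideal_def subspace_derived)
qed

text \<open>Semisimplicity of the quotient \<open>U/I\<close>, without forming it.\<close>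

definition semisimple_mod :: "'v set \<Rightarrow> 'v set \<Rightarrow> bool" where
  "semisimple_mod U I \<longleftrightarrow>
     (\<forall>J. lie_ideal U J \<and> I \<subseteq> J \<and> (\<forall>x\<in>J. \<forall>y\<in>J. bracket x y \<in> I) \<longrightarrow> J \<subseteq> I)"

text \<open>A Levi complement of \<open>I/[I,I]\<close> amounts to a projection onto \<open>I\<close> that is a derivation modulo \<open>[I,I]\<close>.
  The quotients \<open>U/I\<close> and \<open>I/[I,I]\<close> are realised on complementary subspaces.\<close>

lemma derivation_projection_exists:
  assumes U: "lie_subalgebra U" and I: "lie_ideal U I" and ss: "semisimple_mod U I"
  defines "I' \<equiv> derived_subalgebra I"
  shows "\<exists>p. lin p \<and> (\<forall>u\<in>U. p u \<in> I) \<and> (\<forall>u\<in>I. p u = u) \<and>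
    (\<forall>u\<in>U. \<forall>w\<in>U. p (bracket u w) - bracket u (p w) - bracket (p u) w \<in> I')"
proof -
  have sU: "subspace U" and Ucl: "\<And>x y. x \<in> U \<Longrightarrow> y \<in> U \<Longrightarrow> bracket x y \<in> U"
    using U by (auto simp: lie_subalgebra_def)
  note ID = lie_idealD[OF I]
  have I': "lie_ideal U I'" "I' \<subseteq> I" unfolding I'_def using derived_ideal[OF U I] by auto
  note ID' = lie_idealD[OF I'(1)]
  have III: "bracket x y \<in> I'" if "x \<in> I" "y \<in> I" for x y unfolding I'_def by (rule derived_I[OF that])
  obtain q where q: "lin q" "\<And>x. q x \<in> I" "\<And>x. x \<in> I \<Longrightarrow> q x = x" using projection_exists[OF ID(1)] by blast
  obtain r where r: "lin r" "\<And>x. r x \<in> I'" "\<And>x. x \<in> I' \<Longrightarrow> r x = x" using projection_exists[OF ID'(1)] by blast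
  \<comment> \<open>The maps \<open>s\<close> and \<open>t\<close> project along \<open>I\<close>
    and along \<open>I'\<close>; their images \<open>S\<close> of \<open>U\<close> and
    \<open>V\<close> of \<open>I\<close> are models of \<open>U/I\<close> and
    \<open>I/I'\<close>.\<close>
  define s where "s x = x - q x" for x
  define t where "t x = x - r x" for x
  have lins: "lin s" unfolding s_def by (simp add: lin_iff lin_simps[OF q(1)] algebra_simps)
  have lint: "lin t" unfolding t_def by (simp add: lin_iff lin_simps[OF r(1)] algebra_simps)
  note qs = lin_simps[OF q(1)] and ss' = lin_simps[OF lins] and ts = lin_simps[OF lint]
  have sU': "s u \<in> U" if "u \<in> U" for u unfolding s_def using that q(2) ID(2) by (intro subspace_diff[OF sU]) auto
  have s0: "s u = 0" if "u \<in> I" for u using that q(3) by (simp add: s_def)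
  have t0: "t u = 0" if "u \<in> I'" for u using that r(3) by (simp add: t_def)
  have s0D: "u \<in> I" if "s u = 0" for u using that q(2)[of u] by (simp add: s_def)
  have t0D: "u \<in> I'" if "t u = 0" for u using that r(2)[of u] by (simp add: t_def)
  have sss: "s (s u) = s u" for u using s0[OF q(2)] by (simp add: s_def[of u] ss')
  have ttt: "t (t u) = t u" for u using t0[OF r(2)] by (simp add: t_def[of u] ts)
  have tI: "t u \<in> I" if "u \<in> I" for u unfolding t_def using that r(2) I'(2) by (intro subspace_diff[OF ID(1)]) auto
  define S where "S = s ` U"
  define V where "V = t ` I"
  have SU: "x \<in> U" if "x \<in> S" for x using that sU' by (auto simp: S_def)
  have sS: "s x = x" if "x \<in> S" for x using that sss by (auto simp: S_def)
  have sUS: "s u \<in> S" if "u \<in> U" for u using that by (auto simp: S_def)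
  have VI: "v \<in> I" if "v \<in> V" for v using that tI by (auto simp: V_def)
  have tV: "t v = v" if "v \<in> V" for v using that ttt by (auto simp: V_def)
  have tIV: "t v \<in> V" if "v \<in> I" for v using that by (auto simp: V_def)
  define br where "br x y = s (bracket x y)" for x y
  define act where "act x v = t (bracket x v)" for x v
  \<comment> \<open>The class modulo \<open>I'\<close> of the \<open>I\<close>-component of the
    bracket: it measures how far \<open>S\<close> is from being a subalgebra modulo
    \<open>I'\<close>.\<close>
  define f where "f x y = t (q (bracket x y))" for x y
  have s_right: "s (bracket x (s y)) = s (bracket x y)" if "x \<in> U" for x y
    using s0[OF ID(3)[OF that q(2)]] by (simp add: s_def[of y] bracket_simps ss')
  have s_left: "s (bracket (s x) y) = s (bracket x y)" if "y \<in> U" for x y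
    using s0[OF ID(4)[OF that q(2)]] by (simp add: s_def[of x] bracket_simps ss')
  have t_right: "t (bracket x (t y)) = t (bracket x y)" if "x \<in> U" for x y
    using t0[OF ID'(3)[OF that r(2)]] by (simp add: t_def[of y] bracket_simps ts)
  \<comment> \<open>The action on \<open>I/I'\<close> factors through \<open>U/I\<close> exactly
    because brackets within \<open>I\<close> lie in \<open>I'\<close>.\<close>
  have t_left: "t (bracket (s x) v) = t (bracket x v)" if "v \<in> I" for x v
    using t0[OF III[OF q(2) that]] by (simp add: s_def[of x] bracket_simps ts)
  interpret S: lie_carrier scale Basis S br
  proof unfold_locales
    show "subspace S" unfolding S_def
      by (rule Modules.module_hom.subspace_image[OF linear_imp_module_hom[OF lins] sU])
    show "bilin br" by (simp add: bilin_def lin_iff br_def bracket_simps ss')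
    show "br x y \<in> S" if "x \<in> S" "y \<in> S" for x y
      unfolding br_def by (rule sUS[OF Ucl[OF SU[OF that(1)] SU[OF that(2)]]])
    show "br x x = 0" for x by (simp add: br_def bracket_self ss')
    fix x y z assume "x \<in> S" "y \<in> S" "z \<in> S"
    hence "br x (br y z) + br y (br z x) + br z (br x y)
        = s (bracket x (bracket y z) + bracket y (bracket z x) + bracket z (bracket x y))"
      by (simp add: br_def s_right SU ss')
    thus "br x (br y z) + br y (br z x) + br z (br x y) = 0" by (simp add: jacobi ss')
  qed
  interpret S: semisimple_carrier scale Basis S br
  proof unfold_locales
    fix J assume J: "S.sideal J" and ab: "\<And>x y. x \<in> J \<Longrightarrow> y \<in> J \<Longrightarrow> br x y = 0"
    note JD = S.sidealD[OF J]
    \<comment> \<open>The preimage of \<open>J\<close> in \<open>U\<close>. It is an ideal whose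
      brackets lie in \<open>I\<close>, so \<open>ss\<close> applies to it.\<close>
    let ?J = "{u\<in>U. s u \<in> J}"
    have "?J = U \<inter> {u. s u \<in> J}" by auto
    hence subJ: "subspace ?J" using subspace_inter[OF sU subspace_vimage[OF lins JD(1)]] by simp
    have b: "s (bracket u w) = br (s u) (s w)" if "u \<in> U" "w \<in> U" for u w
      using that by (simp add: br_def s_right s_left sU')
    have "lie_ideal U ?J"
      unfolding lie_ideal_def
    proof (intro conjI ballI)
      fix x y assume "x \<in> U" "y \<in> ?J"
      thus "bracket x y \<in> ?J" using b[of x y] JD(3)[OF sUS] Ucl by simp
    qed (use subJ in auto)
    moreover have "I \<subseteq> ?J" using ID(2) s0 subspace_0[OF JD(1)] by auto
    moreover have "bracket x y \<in> I" if "x \<in> ?J" "y \<in> ?J" for x y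
      using that b[of x y] ab by (intro s0D) simp
    ultimately have *: "?J \<subseteq> I" using ss unfolding semisimple_mod_def by blast
    show "J \<subseteq> {0}"
    proof
      fix x assume x: "x \<in> J"
      hence "x \<in> S" by (rule JD(2))
      hence "x \<in> I" using x * sS SU by auto
      thus "x \<in> {0}" using s0 sS[OF \<open>x \<in> S\<close>] by simp
    qed
  qed
  interpret M: lie_rep scale Basis S br V act
  proof unfold_locales
    show "subspace V" unfolding V_def
      by (rule Modules.module_hom.subspace_image[OF linear_imp_module_hom[OF lint] ID(1)])
    show "bilin act" by (simp add: bilin_def lin_iff act_def bracket_simps ts)
    show "act x v \<in> V" if "x \<in> S" "v \<in> V" for x v
      unfolding act_def by (rule tIV[OF ID(3)[OF SU[OF that(1)] VI[OF that(2)]]])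
    show "act (br x y) v = act x (act y v) - act y (act x v)" if "x \<in> S" "y \<in> S" "v \<in> V" for x y v
      using that by (simp add: act_def br_def t_left VI t_right SU bracket_bracket ts)
  qed
  have "M.cocycle f"
    unfolding M.cocycle_def
  proof (intro conjI ballI)
    show "bilin f" by (simp add: bilin_def lin_iff f_def bracket_simps ts qs)
    show "f x y \<in> V" for x y unfolding f_def by (rule tIV[OF q(2)])
    show "f x x = 0" for x by (simp add: f_def bracket_self qs ts)
    fix x y z assume S: "x \<in> S" "y \<in> S" "z \<in> S"
    have fbr: "f (br x y) z = t (q (bracket (bracket x y) z)) + t (bracket z (q (bracket x y)))"
      if "x \<in> S" "y \<in> S" "z \<in> S" for x y z
    proof -
      have "q (bracket (q (bracket x y)) z) = bracket (q (bracket x y)) z"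
        by (rule q(3)[OF ID(4)[OF SU[OF that(3)] q(2)]])
      also have "\<dots> = - bracket z (q (bracket x y))" by (rule bracket_anti)
      finally show ?thesis by (simp add: f_def br_def s_def bracket_simps qs ts)
    qed
    have actf: "act x (f y z) = t (bracket x (q (bracket y z)))" if "x \<in> S" for x y z
      using that by (simp add: act_def f_def t_right SU)
    \<comment> \<open>In the cocycle identity the terms \<open>act x (f y z)\<close> cancel against
      the correction terms in \<open>fbr\<close>. What remains is \<open>q\<close> followed by
      \<open>t\<close> applied to this form of the Jacobi identity.\<close>
    have "bracket (bracket x y) z - bracket (bracket x z) y + bracket (bracket y z) x = 0"
      using jacobi[of x y z] bracket_anti[of "bracket x y" z] bracket_anti[of "bracket x z" y]
        bracket_anti[of "bracket y z" x] bracket_anti[of z x]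
      by (simp add: bracket_simps algebra_simps)
    hence "t (q (bracket (bracket x y) z)) - t (q (bracket (bracket x z) y)) + t (q (bracket (bracket y z) x)) = 0"
      by (simp only: lin_simps(1,5)[OF q(1), symmetric] lin_simps(1,5)[OF lint, symmetric] qs(3) ts(3))
    thus "act x (f y z) - act y (f x z) + act z (f x y) - f (br x y) z + f (br x z) y - f (br y z) x = 0"
      using S by (simp add: fbr actf algebra_simps)
  qed
  from S.cocycle_splits[OF M.lie_rep_axioms this]
  obtain \<phi> where \<phi>: "lin \<phi>" "\<And>x. x \<in> S \<Longrightarrow> \<phi> x \<in> V" "\<And>x y. x \<in> S \<Longrightarrow> y \<in> S \<Longrightarrow> f x y = M.coboundary \<phi> x y"
    unfolding M.splits_def by blast
  \<comment> \<open>The projection \<open>q\<close> corrected by the cochain that splits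
    \<open>f\<close>. The correction vanishes on \<open>I\<close>, and the splitting equation is
    precisely the Leibniz rule modulo \<open>I'\<close>.\<close>
  define p where "p u = q u + \<phi> (s u)" for u
  have "lin p" unfolding p_def by (simp add: lin_iff qs ss' lin_simps[OF \<phi>(1)] algebra_simps)
  moreover have "p u \<in> I" if "u \<in> U" for u
    unfolding p_def by (intro subspace_add[OF ID(1)] q(2) VI \<phi>(2) sUS that)
  moreover have "p u = u" if "u \<in> I" for u
    using that by (simp add: p_def q(3) s0 lin_simps[OF \<phi>(1)])
  moreover have "p (bracket u w) - bracket u (p w) - bracket (p u) w \<in> I'" if uw: "u \<in> U" "w \<in> U" for u w
  proof (rule t0D)
    define x i y j where "x = s u" "i = q u" "y = s w" "j = q w"
    have xy: "x \<in> S" "y \<in> S" and ij: "i \<in> I" "j \<in> I" and u: "u = x + i" and w: "w = y + j"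
      using uw sUS q(2) by (simp_all add: x_i_y_j_def s_def)
    have \<phi>I: "\<phi> x \<in> I" "\<phi> y \<in> I" using \<phi>(2) VI xy by auto
    have qb: "q (bracket u w) = q (bracket x y) + bracket x j + bracket i y + bracket i j"
    proof -
      have "bracket u w = bracket x y + bracket x j + bracket i y + bracket i j"
        unfolding u w by (simp add: bracket_simps algebra_simps)
      moreover have "bracket x j \<in> I" "bracket i y \<in> I" "bracket i j \<in> I"
        using ID(3)[OF SU[OF xy(1)] ij(2)] ID(4)[OF SU[OF xy(2)] ij(1)] ID(3)[OF ID(2)[OF ij(1)] ij(2)] by auto
      ultimately show ?thesis by (simp add: qs q(3))
    qed
    have sb: "s (bracket u w) = br x y"
      using uw by (simp add: br_def x_i_y_j_def s_right s_left sU')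
    have brS: "br x y \<in> S" by (rule S.br_closed[OF xy])
    have tz: "t (bracket a b) = 0" if "a \<in> I" "b \<in> I" for a b by (rule t0[OF III[OF that]])
    have "t (p (bracket u w)) = f x y + t (bracket x j) + t (bracket i y) + \<phi> (br x y)"
      unfolding p_def qb sb using tz[OF ij] tV[OF \<phi>(2)[OF brS]] by (simp add: ts f_def)
    moreover have "t (bracket u (p w)) = t (bracket x j) + t (bracket x (\<phi> y))"
    proof -
      have "p w = j + \<phi> y" by (simp add: p_def x_i_y_j_def)
      thus ?thesis unfolding u using tz[OF ij] tz[OF ij(1) \<phi>I(2)] by (simp add: bracket_simps ts)
    qed
    moreover have "t (bracket (p u) w) = t (bracket i y) + t (bracket (\<phi> x) y)"
    proof -
      have "p u = i + \<phi> x" by (simp add: p_def x_i_y_j_def)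
      thus ?thesis unfolding w using tz[OF ij] tz[OF \<phi>I(1) ij(2)] by (simp add: bracket_simps ts)
    qed
    moreover have "t (bracket (\<phi> x) y) = - t (bracket y (\<phi> x))"
      using bracket_anti[of "\<phi> x" y] by (simp add: ts)
    ultimately show "t (p (bracket u w) - bracket u (p w) - bracket (p u) w) = 0"
      using \<phi>(3)[OF xy] by (simp add: ts M.coboundary_def act_def)
  qed
  ultimately show ?thesis by blast
qed

end

subsection \<open>Gradings\<close>

locale graded_lie_algebra = fd_lie_algebra scale Basis bracket + group G
  for scale :: "'f :: field_char_0 \<Rightarrow> 'v :: ab_group_add \<Rightarrow> 'v" (infixr "*s" 75) and Basis bracket
    and G :: "('g, 'm) monoid_scheme" (structure) +
  fixes L :: "'g \<Rightarrow> 'v set"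
  assumes grading: "lie_grading G L"
begin

definition decomposes :: "'v \<Rightarrow> ('g \<Rightarrow> 'v) \<Rightarrow> bool" where
  "decomposes x c \<longleftrightarrow> (\<forall>i\<in>carrier G. c i \<in> L i) \<and> (\<forall>i. i \<notin> carrier G \<longrightarrow> c i = 0) \<and>
     finite {i\<in>carrier G. c i \<noteq> 0} \<and> x = (\<Sum>i\<in>{i\<in>carrier G. c i \<noteq> 0}. c i)"

definition cmp :: "'v \<Rightarrow> 'g \<Rightarrow> 'v" where
  "cmp x = (THE c. decomposes x c)"

lemma decomposes_ex1: "\<exists>!c. decomposes x c"
  and subspace_L: "g \<in> carrier G \<Longrightarrow> subspace (L g)"
proof -
  have "direct_sum_decomposition (carrier G) L UNIV"
    using grading unfolding lie_grading_def by (rule conjunct1)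
  note * = conjunct2[OF this[unfolded direct_sum_decomposition_def]]
  show "\<exists>!c. decomposes x c"
    unfolding decomposes_def by (rule bspec[OF conjunct2[OF *] UNIV_I])
  show "g \<in> carrier G \<Longrightarrow> subspace (L g)" using conjunct1[OF *] by blast
qed

lemma decomposes_cmp: "decomposes x (cmp x)"
  unfolding cmp_def by (rule theI'[OF decomposes_ex1])

lemma cmp_unique: "decomposes x c \<Longrightarrow> cmp x = c"
  unfolding cmp_def by (rule the1_equality[OF decomposes_ex1])

lemma bracket_L:
  assumes "g \<in> carrier G" "h \<in> carrier G" "x \<in> L g" "y \<in> L h"
  shows "bracket x y \<in> L (g \<otimes> h)"
  using conjunct2[OF grading[unfolded lie_grading_def], rule_format, OF assms] .

lemmas decomposes_cmpD = decomposes_cmp[unfolded decomposes_def]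

lemma cmp_mem: "g \<in> carrier G \<Longrightarrow> cmp x g \<in> L g"
  by (rule bspec[OF conjunct1[OF decomposes_cmpD]])

lemma cmp_outside: "g \<notin> carrier G \<Longrightarrow> cmp x g = 0"
  by (rule conjunct1[OF conjunct2[OF decomposes_cmpD], rule_format])

lemma cmp_support: "{g. cmp x g \<noteq> 0} = {g\<in>carrier G. cmp x g \<noteq> 0}"
  using cmp_outside[of _ x] by blast

lemma finite_support: "finite {g. cmp x g \<noteq> 0}"
  unfolding cmp_support by (rule conjunct1[OF conjunct2[OF conjunct2[OF decomposes_cmpD]]])

lemma sum_cmp_support: "(\<Sum>g\<in>{g. cmp x g \<noteq> 0}. cmp x g) = x"
  unfolding cmp_support by (rule conjunct2[OF conjunct2[OF conjunct2[OF decomposes_cmpD]], symmetric])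

lemma sum_cmp: "finite F \<Longrightarrow> {g. cmp x g \<noteq> 0} \<subseteq> F \<Longrightarrow> (\<Sum>g\<in>F. cmp x g) = x"
  by (rule trans[OF sum.mono_neutral_right sum_cmp_support]) auto

lemma cmp_eqI:
  assumes "\<And>g. g \<in> carrier G \<Longrightarrow> c g \<in> L g" "\<And>g. g \<notin> carrier G \<Longrightarrow> c g = 0"
    and F: "finite F" "\<And>g. g \<notin> F \<Longrightarrow> c g = 0" and x: "x = (\<Sum>g\<in>F. c g)"
  shows "cmp x = c"
proof (rule cmp_unique)
  have sub: "{i\<in>carrier G. c i \<noteq> 0} \<subseteq> F" using F(2) by auto
  have "(\<Sum>i\<in>{i\<in>carrier G. c i \<noteq> 0}. c i) = (\<Sum>g\<in>F. c g)"
    using F(1) sub assms(2) by (intro sum.mono_neutral_left) auto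
  thus "decomposes x c"
    unfolding decomposes_def using assms(1,2) x finite_subset[OF sub F(1)] by simp
qed

lemma cmp_add: "cmp (x + y) g = cmp x g + cmp y g"
proof -
  let ?F = "{g. cmp x g \<noteq> 0} \<union> {g. cmp y g \<noteq> 0}"
  have "cmp (x + y) = (\<lambda>g. cmp x g + cmp y g)"
  proof (rule cmp_eqI[where F = ?F])
    show "x + y = (\<Sum>g\<in>?F. cmp x g + cmp y g)"
      unfolding sum.distrib using sum_cmp[of ?F x] sum_cmp[of ?F y] by (simp add: finite_support)
  qed (auto simp: cmp_outside finite_support subspace_add[OF subspace_L] cmp_mem)
  thus ?thesis by simp
qed

lemma cmp_scale: "cmp (a *s x) g = a *s cmp x g"
proof -
  have "cmp (a *s x) = (\<lambda>g. a *s cmp x g)"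
  proof (rule cmp_eqI[where F = "{g. cmp x g \<noteq> 0}"])
    show "a *s x = (\<Sum>g\<in>{g. cmp x g \<noteq> 0}. a *s cmp x g)"
      by (simp add: scale_sum_right[symmetric] sum_cmp_support)
  qed (auto simp: cmp_outside finite_support subspace_scale[OF subspace_L] cmp_mem)
  thus ?thesis by simp
qed

lemma lin_cmp: "lin (\<lambda>x. cmp x g)"
  by (simp add: lin_iff cmp_add cmp_scale)

lemmas cmp_simps = lin_simps[OF lin_cmp]

lemma cmp_homogeneous:
  assumes "g \<in> carrier G" "x \<in> L g"
  shows "cmp x h = (if h = g then x else 0)"
proof -
  have "cmp x = (\<lambda>h. if h = g then x else 0)"
    by (rule cmp_eqI[where F = "{g}"]) (use assms subspace_0[OF subspace_L] in auto)
  thus ?thesis by simp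
qed

lemma cmp_cmp: "cmp (cmp x g) h = (if h = g then cmp x g else 0)"
  by (cases "g \<in> carrier G") (simp_all add: cmp_homogeneous[OF _ cmp_mem] cmp_outside cmp_simps)

text \<open>Left multiplication by \<open>g\<close> is injective, so no component of
  \<open>z\<close> other than that of degree \<open>k\<close> contributes in degree
  \<open>g \<otimes> k\<close>.\<close>

lemma cmp_bracket_left:
  assumes g: "g \<in> carrier G" "x \<in> L g" and k: "k \<in> carrier G"
  shows "cmp (bracket x z) (g \<otimes> k) = bracket x (cmp z k)"
proof -
  let ?F = "{h. cmp z h \<noteq> 0}"
  have "bracket x z = (\<Sum>h\<in>?F. bracket x (cmp z h))"
    using arg_cong[OF sum_cmp_support[of z], of "bracket x"] by (simp add: bracket_simps)
  hence "cmp (bracket x z) (g \<otimes> k) = (\<Sum>h\<in>?F. cmp (bracket x (cmp z h)) (g \<otimes> k))"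
    by (simp add: cmp_simps)
  also have "\<dots> = (\<Sum>h\<in>?F. if k = h then bracket x (cmp z h) else 0)"
  proof (rule sum.cong[OF refl])
    fix h assume "h \<in> ?F"
    hence h: "h \<in> carrier G" using cmp_outside by auto
    show "cmp (bracket x (cmp z h)) (g \<otimes> k) = (if k = h then bracket x (cmp z h) else 0)"
      using cmp_homogeneous[OF m_closed[OF g(1) h] bracket_L[OF g(1) h g(2) cmp_mem[OF h]]] g(1) h k by simp
  qed
  also have "\<dots> = bracket x (cmp z k)" using finite_support[of z] by (simp add: bracket_simps)
  finally show ?thesis .
qed

lemma cmp_bracket_right:
  assumes g: "g \<in> carrier G" "x \<in> L g" and k: "k \<in> carrier G"
  shows "cmp (bracket z x) (k \<otimes> g) = bracket (cmp z k) x"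
proof -
  let ?F = "{h. cmp z h \<noteq> 0}"
  have "bracket z x = (\<Sum>h\<in>?F. bracket (cmp z h) x)"
    using arg_cong[OF sum_cmp_support[of z], of "\<lambda>z. bracket z x"] by (simp add: bracket_simps)
  hence "cmp (bracket z x) (k \<otimes> g) = (\<Sum>h\<in>?F. cmp (bracket (cmp z h) x) (k \<otimes> g))"
    by (simp add: cmp_simps)
  also have "\<dots> = (\<Sum>h\<in>?F. if k = h then bracket (cmp z h) x else 0)"
  proof (rule sum.cong[OF refl])
    fix h assume "h \<in> ?F"
    hence h: "h \<in> carrier G" using cmp_outside by auto
    show "cmp (bracket (cmp z h) x) (k \<otimes> g) = (if k = h then bracket (cmp z h) x else 0)"
      using cmp_homogeneous[OF m_closed[OF h g(1)] bracket_L[OF h g(1) cmp_mem[OF h] g(2)]] g(1) h k by simp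
  qed
  also have "\<dots> = bracket (cmp z k) x" using finite_support[of z] by (simp add: bracket_simps)
  finally show ?thesis .
qed

text \<open>By uniqueness of the decomposition in the whole algebra, any decomposition inside
  \<open>W\<close> consists of the components \<open>cmp x g\<close>; being graded thus means
  closure under taking components.\<close>

lemma graded_subspace_iff:
  "graded_subspace G L W \<longleftrightarrow> subspace W \<and> (\<forall>x\<in>W. \<forall>g. cmp x g \<in> W)"
proof
  assume W: "graded_subspace G L W"
  hence sub: "subspace W" unfolding graded_subspace_def direct_sum_decomposition_def by (rule conjunct1)
  moreover have "cmp x g \<in> W" if "x \<in> W" for x g
  proof -
    have "\<forall>x\<in>W. \<exists>!c. (\<forall>i\<in>carrier G. c i \<in> L i \<inter> W) \<and> (\<forall>i. i \<notin> carrier G \<longrightarrow> c i = 0) \<and>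
        finite {i\<in>carrier G. c i \<noteq> 0} \<and> x = (\<Sum>i\<in>{i\<in>carrier G. c i \<noteq> 0}. c i)"
      using W unfolding graded_subspace_def direct_sum_decomposition_def by (elim conjE)
    from ex1_implies_ex[OF bspec[OF this that]]
    obtain c where c: "\<forall>i\<in>carrier G. c i \<in> L i \<inter> W" "\<forall>i. i \<notin> carrier G \<longrightarrow> c i = 0"
        "finite {i\<in>carrier G. c i \<noteq> 0}" "x = (\<Sum>i\<in>{i\<in>carrier G. c i \<noteq> 0}. c i)"
      by (elim exE conjE)
    hence "decomposes x c" unfolding decomposes_def by auto
    hence "cmp x = c" by (rule cmp_unique)
    thus ?thesis using c(1,2) subspace_0[OF sub] by (cases "g \<in> carrier G") auto
  qed
  ultimately show "subspace W \<and> (\<forall>x\<in>W. \<forall>g. cmp x g \<in> W)" by blast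
next
  assume W: "subspace W \<and> (\<forall>x\<in>W. \<forall>g. cmp x g \<in> W)"
  show "graded_subspace G L W"
    unfolding graded_subspace_def direct_sum_decomposition_def
  proof (intro conjI ballI)
    fix x assume x: "x \<in> W"
    show "\<exists>!c. (\<forall>i\<in>carrier G. c i \<in> L i \<inter> W) \<and> (\<forall>i. i \<notin> carrier G \<longrightarrow> c i = 0) \<and>
        finite {i\<in>carrier G. c i \<noteq> 0} \<and> x = (\<Sum>i\<in>{i\<in>carrier G. c i \<noteq> 0}. c i)"
    proof (rule ex1I[of _ "cmp x"])
      show "(\<forall>i\<in>carrier G. cmp x i \<in> L i \<inter> W) \<and> (\<forall>i. i \<notin> carrier G \<longrightarrow> cmp x i = 0) \<and>
          finite {i\<in>carrier G. cmp x i \<noteq> 0} \<and> x = (\<Sum>i\<in>{i\<in>carrier G. cmp x i \<noteq> 0}. cmp x i)"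
        using decomposes_cmp[of x] W x unfolding decomposes_def by blast
    next
      fix c assume "(\<forall>i\<in>carrier G. c i \<in> L i \<inter> W) \<and> (\<forall>i. i \<notin> carrier G \<longrightarrow> c i = 0) \<and>
          finite {i\<in>carrier G. c i \<noteq> 0} \<and> x = (\<Sum>i\<in>{i\<in>carrier G. c i \<noteq> 0}. c i)"
      hence "decomposes x c" unfolding decomposes_def by auto
      thus "c = cmp x" by (simp add: cmp_unique)
    qed
  qed (use W in \<open>auto intro: subspace_inter subspace_L\<close>)
qed

text \<open>For homogeneous left factor of degree \<open>h\<close>, the degree \<open>g\<close>
  component of the bracket comes from the component of \<open>y\<close> in degree
  \<open>inv h \<otimes> g\<close>, so it is again a bracket of elements of
  \<open>I\<close>.\<close>

lemma graded_derived:
  assumes "graded_subspace G L I"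
  shows "graded_subspace G L (derived_subalgebra I)"
proof -
  have I: "cmp x g \<in> I" if "x \<in> I" for x g using assms that unfolding graded_subspace_iff by blast
  let ?D = "derived_subalgebra I"
  have "?D \<subseteq> {z. cmp z g \<in> ?D}" for g
  proof (rule derived_least)
    show "subspace {z. cmp z g \<in> ?D}" by (rule subspace_vimage[OF lin_cmp subspace_derived])
    fix x y assume xy: "x \<in> I" "y \<in> I"
    have "bracket x y = (\<Sum>h\<in>{h. cmp x h \<noteq> 0}. bracket (cmp x h) y)"
      using arg_cong[OF sum_cmp_support[of x], of "\<lambda>z. bracket z y"] by (simp add: bracket_simps)
    hence "cmp (bracket x y) g = (\<Sum>h\<in>{h. cmp x h \<noteq> 0}. cmp (bracket (cmp x h) y) g)"
      by (simp add: cmp_simps)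
    also have "\<dots> \<in> ?D"
    proof (rule subspace_sum[OF subspace_derived])
      fix h assume "h \<in> {h. cmp x h \<noteq> 0}"
      hence h: "h \<in> carrier G" using cmp_outside by auto
      show "cmp (bracket (cmp x h) y) g \<in> ?D"
      proof (cases "g \<in> carrier G")
        case True
        hence "cmp (bracket (cmp x h) y) (h \<otimes> (inv h \<otimes> g)) = bracket (cmp x h) (cmp y (inv h \<otimes> g))"
          using h by (intro cmp_bracket_left cmp_mem) auto
        moreover have "h \<otimes> (inv h \<otimes> g) = g" using h True by (simp add: m_assoc[symmetric])
        ultimately show ?thesis using I xy by (simp add: derived_I)
      qed (simp add: cmp_outside subspace_0 subspace_derived)
    qed
    finally show "bracket x y \<in> {z. cmp z g \<in> ?D}" by simp
  qed
  thus ?thesis unfolding graded_subspace_iff using subspace_derived by blast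
qed

text \<open>Taking the degree-preserving part of a derivation gives a derivation, for any group: the component
  of \<open>[x, p y]\<close> in degree \<open>gh\<close> is \<open>[x, z]\<close> with \<open>z\<close> the component of \<open>p y\<close> in degree \<open>h\<close>, by cancellation.
  Its kernel modulo \<open>[I,I]\<close> is a graded complement.\<close>

lemma graded_complement_mod_derived:
  assumes U: "lie_subalgebra U" "graded_subspace G L U"
    and I: "lie_ideal U I" "graded_subspace G L I" and ss: "semisimple_mod U I"
  defines "I' \<equiv> derived_subalgebra I"
  shows "\<exists>B. lie_subalgebra B \<and> graded_subspace G L B \<and> B \<subseteq> U \<and> lie_ideal B I' \<and> B \<inter> I \<subseteq> I' \<and>
    (\<forall>u\<in>U. \<exists>b\<in>B. u - b \<in> I)"
proof -
  have sU: "subspace U" and Ucl: "\<And>x y. x \<in> U \<Longrightarrow> y \<in> U \<Longrightarrow> bracket x y \<in> U"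
    using U(1) by (auto simp: lie_subalgebra_def)
  have Ug: "cmp x g \<in> U" if "x \<in> U" for x g using U(2) that unfolding graded_subspace_iff by blast
  have Ig: "cmp x g \<in> I" if "x \<in> I" for x g using I(2) that unfolding graded_subspace_iff by blast
  note ID = lie_idealD[OF I(1)]
  have I': "lie_ideal U I'" "I' \<subseteq> I" unfolding I'_def using derived_ideal[OF U(1) I(1)] by simp_all
  note ID' = lie_idealD[OF I'(1)]
  have I'g: "cmp x g \<in> I'" if "x \<in> I'" for x g
    using graded_derived[OF I(2)] that unfolding graded_subspace_iff I'_def by blast
  from derivation_projection_exists[OF U(1) I(1) ss] obtain p where
    "lin p \<and> (\<forall>u\<in>U. p u \<in> I) \<and> (\<forall>u\<in>I. p u = u) \<and>
      (\<forall>u\<in>U. \<forall>w\<in>U. p (bracket u w) - bracket u (p w) - bracket (p u) w \<in> I')"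
    unfolding I'_def by (elim exE)
  hence p: "lin p" "u \<in> U \<Longrightarrow> p u \<in> I" "u \<in> I \<Longrightarrow> p u = u"
      "u \<in> U \<Longrightarrow> w \<in> U \<Longrightarrow> p (bracket u w) - bracket u (p w) - bracket (p u) w \<in> I'" for u w
    by simp_all
  \<comment> \<open>The degree \<open>g\<close> component of the degree-preserving part of
    \<open>p\<close>. Keeping the family \<open>r\<close> avoids a sum over a possibly infinite
    group.\<close>
  define r where "r g u = cmp (p (cmp u g)) g" for g u
  have linr: "lin (r g)" for g
    unfolding r_def by (simp add: lin_iff cmp_simps lin_simps[OF p(1)])
  note rs = lin_simps[OF linr]
  have rI: "r g u \<in> I" if "u \<in> U" for g u unfolding r_def by (intro Ig p(2) Ug that)
  have r_on_I: "r g u = cmp u g" if "u \<in> I" for g u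
    by (simp add: r_def p(3)[OF Ig[OF that]] cmp_cmp)
  define B where "B = {u\<in>U. \<forall>g. r g u \<in> I'}"
  have subZ: "subspace {u. \<forall>g. r g u \<in> I'}"
  proof -
    have "{u. \<forall>g. r g u \<in> I'} = (\<Inter>g. {u. r g u \<in> I'})" by auto
    thus ?thesis using subspace_vimage[OF linr ID'(1)] by (simp add: subspace_Int)
  qed
  have "B = U \<inter> {u. \<forall>g. r g u \<in> I'}" by (auto simp: B_def)
  hence sB: "subspace B" using subspace_inter[OF sU subZ] by simp
  have gB: "cmp u g \<in> B" if "u \<in> B" for u g
  proof -
    have "r h (cmp u g) \<in> I'" for h
      using that subspace_0[OF ID'(1)] by (cases "h = g") (auto simp: B_def r_def cmp_cmp lin_simps[OF p(1)] cmp_simps)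
    thus ?thesis using that Ug by (simp add: B_def)
  qed
  have homog: "r k (bracket u w) \<in> I'"
    if gh: "g \<in> carrier G" "h \<in> carrier G" and u: "u \<in> B" "u \<in> L g" and w: "w \<in> B" "w \<in> L h" for g h k u w
  proof (cases "k = g \<otimes> h")
    case False
    thus ?thesis
      using cmp_homogeneous[OF m_closed[OF gh] bracket_L[OF gh u(2) w(2)]] subspace_0[OF ID'(1)]
      by (simp add: r_def lin_simps[OF p(1)] cmp_simps)
  next
    case True
    have uU: "u \<in> U" and wU: "w \<in> U" using u w by (auto simp: B_def)
    have cu: "cmp (p u) g \<in> I'" and cw: "cmp (p w) h \<in> I'"
      using u(1) w(1) cmp_homogeneous[OF gh(1) u(2), of g] cmp_homogeneous[OF gh(2) w(2), of h]
      by (auto simp: B_def r_def dest: spec[of _ g] spec[of _ h])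
    let ?d = "p (bracket u w) - bracket u (p w) - bracket (p u) w"
    have "cmp (bracket u w) k = bracket u w"
      using True cmp_homogeneous[OF m_closed[OF gh] bracket_L[OF gh u(2) w(2)]] by simp
    hence "r k (bracket u w) = cmp (?d + bracket u (p w) + bracket (p u) w) k" by (simp add: r_def)
    also have "\<dots> = cmp ?d k + bracket u (cmp (p w) h) + bracket (cmp (p u) g) w"
      unfolding True cmp_simps(1)
      by (simp only: cmp_bracket_left[OF gh(1) u(2) gh(2)] cmp_bracket_right[OF gh(2) w(2) gh(1)])
    also have "\<dots> \<in> I'"
      by (intro subspace_add[OF ID'(1)] I'g p(4)[OF uU wU] ID'(3)[OF uU cw] ID'(4)[OF wU cu])
    finally show ?thesis .
  qed
  have Bcl: "bracket u w \<in> B" if uw: "u \<in> B" "w \<in> B" for u w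
  proof -
    have "bracket u w = (\<Sum>g\<in>{g. cmp u g \<noteq> 0}. bracket (cmp u g) w)"
      using arg_cong[OF sum_cmp_support[of u], of "\<lambda>z. bracket z w"] by (simp add: bracket_simps)
    also have "\<dots> = (\<Sum>g\<in>{g. cmp u g \<noteq> 0}. \<Sum>h\<in>{h. cmp w h \<noteq> 0}. bracket (cmp u g) (cmp w h))"
    proof (rule sum.cong[OF refl])
      fix g
      show "bracket (cmp u g) w = (\<Sum>h\<in>{h. cmp w h \<noteq> 0}. bracket (cmp u g) (cmp w h))"
        using arg_cong[OF sum_cmp_support[of w], of "bracket (cmp u g)"] by (simp add: bracket_simps)
    qed
    finally have e: "bracket u w = (\<Sum>g\<in>{g. cmp u g \<noteq> 0}. \<Sum>h\<in>{h. cmp w h \<noteq> 0}. bracket (cmp u g) (cmp w h))" .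
    have "bracket u w \<in> {u. \<forall>g. r g u \<in> I'}"
      unfolding e
    proof (intro subspace_sum[OF subZ])
      fix g h assume "g \<in> {g. cmp u g \<noteq> 0}" "h \<in> {h. cmp w h \<noteq> 0}"
      hence gh: "g \<in> carrier G" "h \<in> carrier G" using cmp_outside by auto
      show "bracket (cmp u g) (cmp w h) \<in> {u. \<forall>g. r g u \<in> I'}"
        using homog[OF gh gB[OF uw(1)] cmp_mem[OF gh(1)] gB[OF uw(2)] cmp_mem[OF gh(2)]] by simp
    qed
    thus ?thesis using uw Ucl by (simp add: B_def)
  qed
  have I'B: "I' \<subseteq> B"
  proof
    fix x assume "x \<in> I'"
    thus "x \<in> B" using I'(2) ID'(2) I'g r_on_I[of x] by (auto simp: B_def)
  qed
  have "B \<inter> I \<subseteq> I'"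
  proof
    fix x assume x: "x \<in> B \<inter> I"
    have "(\<Sum>g\<in>{g. cmp x g \<noteq> 0}. cmp x g) \<in> I'"
      by (rule subspace_sum[OF ID'(1)]) (use x r_on_I[of x] in \<open>auto simp: B_def\<close>)
    thus "x \<in> I'" by (simp only: sum_cmp_support)
  qed
  moreover have "\<exists>b\<in>B. u - b \<in> I" if u: "u \<in> U" for u
  proof -
    \<comment> \<open>The image of \<open>u\<close> under the degree-preserving part of
      \<open>p\<close>; the sum is finite because \<open>r g u\<close> vanishes outside the support
      of \<open>u\<close>. That part is the identity on \<open>I\<close>, so it kills
      \<open>u - i\<close>.\<close>
    define i where "i = (\<Sum>g\<in>{g. cmp u g \<noteq> 0}. r g u)"
    have iI: "i \<in> I" unfolding i_def by (rule subspace_sum[OF ID(1)]) (rule rI[OF u])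
    have "cmp i h = r h u" for h
    proof -
      have c: "cmp (r g u) h = (if g = h then r g u else 0)" for g by (auto simp: r_def cmp_cmp)
      have "cmp i h = (\<Sum>g\<in>{g. cmp u g \<noteq> 0}. if g = h then r g u else 0)"
        by (simp add: i_def cmp_simps c)
      also have "\<dots> = (if h \<in> {g. cmp u g \<noteq> 0} then r h u else 0)"
        using finite_support[of u] by (rule sum.delta)
      also have "\<dots> = r h u" by (auto simp: r_def lin_simps[OF p(1)] cmp_simps)
      finally show ?thesis .
    qed
    hence "r h (u - i) = 0" for h by (simp add: rs r_on_I[OF iI])
    hence "u - i \<in> B" using u iI ID(2) subspace_diff[OF sU] subspace_0[OF ID'(1)] by (simp add: B_def)
    thus ?thesis using iI by (intro bexI[of _ "u - i"]) simp_all
  qed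
  moreover have "B \<subseteq> U" by (auto simp: B_def)
  moreover have "lie_ideal B I'"
    using I'B ID'(1,3) \<open>B \<subseteq> U\<close> by (auto simp: lie_ideal_def)
  moreover have "lie_subalgebra B" using sB Bcl by (simp add: lie_subalgebra_def)
  moreover have "graded_subspace G L B" using sB gB by (simp add: graded_subspace_iff)
  ultimately show ?thesis by blast
qed

text \<open>The sum of two subspaces is written \<open>{x. \<exists>a\<in>A. x - a \<in> W}\<close>.\<close>

lemma subspace_setsum:
  "subspace A \<Longrightarrow> subspace W \<Longrightarrow> subspace {x. \<exists>a\<in>A. x - a \<in> W}"
proof -
  assume *: "subspace A" "subspace W"
  have "{x. \<exists>a\<in>A. x - a \<in> W} = {a + w | a w. a \<in> A \<and> w \<in> W}"
    by (auto, metis add.commute diff_add_cancel, metis add_diff_cancel_left')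
  thus ?thesis using subspace_sums[OF *] by simp
qed

text \<open>Since \<open>U = B + I\<close>, brackets of \<open>U\<close> with \<open>J + I\<close>
  lie in \<open>[B,J] + I\<close>.\<close>

lemma ideal_sum:
  assumes U: "lie_subalgebra U" and I: "lie_ideal U I" and B: "B \<subseteq> U" "\<And>u. u \<in> U \<Longrightarrow> \<exists>b\<in>B. u - b \<in> I"
    and J: "lie_ideal B J"
  shows "lie_ideal U {x. \<exists>j\<in>J. x - j \<in> I}"
proof -
  note ID = lie_idealD[OF I] and JD = lie_idealD[OF J]
  have sU: "subspace U" using U by (simp add: lie_subalgebra_def)
  let ?J = "{x. \<exists>j\<in>J. x - j \<in> I}"
  have "x \<in> U" if x: "x \<in> ?J" for x
  proof -
    obtain j where "j \<in> J" "x - j \<in> I" using x by blast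
    hence "(x - j) + j \<in> U" using ID(2) JD(2) B(1) by (intro subspace_add[OF sU]) auto
    thus ?thesis by simp
  qed
  moreover have "bracket u x \<in> ?J" if u: "u \<in> U" and x: "x \<in> ?J" for u x
  proof -
    obtain j where j: "j \<in> J" "x - j \<in> I" using x by blast
    obtain b where b: "b \<in> B" "u - b \<in> I" using B(2)[OF u] by blast
    have jU: "j \<in> U" using JD(2)[OF j(1)] B(1) by blast
    have "bracket u x - bracket b j = bracket u (x - j) + bracket (u - b) j" by (simp add: bracket_simps)
    also have "\<dots> \<in> I" by (intro subspace_add[OF ID(1)] ID(3)[OF u j(2)] ID(4)[OF jU b(2)])
    finally show ?thesis using JD(3)[OF b(1) j(1)] by blast
  qed
  ultimately show ?thesis unfolding lie_ideal_def using subspace_setsum[OF JD(1) ID(1)] by blast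
qed

text \<open>Solvability makes \<open>[I,I]\<close> strictly smaller than a nonzero \<open>I\<close>,
  so induction applies to the graded subalgebra \<open>B\<close> with its ideal
  \<open>[I,I]\<close>. A complement of \<open>[I,I]\<close> in \<open>B\<close> is a complement of
  \<open>I\<close> in \<open>U\<close>, because \<open>B \<inter> I \<subseteq> [I,I]\<close> and
  \<open>U = B + I\<close>.\<close>

lemma graded_levi:
  assumes "lie_subalgebra U" "graded_subspace G L U" "lie_ideal U I" "graded_subspace G L I"
    "lie_solvable I" "semisimple_mod U I"
  shows "\<exists>B. lie_subalgebra B \<and> graded_subspace G L B \<and> B \<inter> I \<subseteq> {0} \<and> B \<subseteq> U \<and> (\<forall>u\<in>U. \<exists>b\<in>B. u - b \<in> I)"
  using assms
proof (induction "dim I" arbitrary: U I rule: less_induct)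
  case less
  note ID = lie_idealD[OF less.prems(3)]
  show ?case
  proof (cases "I \<subseteq> {0}")
    case True
    show ?thesis
    proof (intro exI[of _ U] conjI ballI)
      show "\<exists>b\<in>U. u - b \<in> I" if "u \<in> U" for u
        by (rule bexI[OF _ that]) (simp add: subspace_0[OF ID(1)])
      show "U \<inter> I \<subseteq> {0}" using True by blast
    qed (use less.prems(1,2) in simp_all)
  next
    case False
    let ?I' = "derived_subalgebra I"
    from graded_complement_mod_derived[OF less.prems(1-4,6)] obtain B
      where B: "lie_subalgebra B" "graded_subspace G L B" "B \<subseteq> U" "lie_ideal B ?I'" "B \<inter> I \<subseteq> ?I'"
        "\<forall>u\<in>U. \<exists>b\<in>B. u - b \<in> I"
      by (elim exE conjE)
    have sub: "?I' \<subseteq> I" using derived_ideal(2)[OF less.prems(1,3)] .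
    obtain n where n: "(derived_subalgebra ^^ n) I = {0}" using less.prems(5) unfolding lie_solvable_def by blast
    have "?I' \<noteq> I"
    proof
      assume *: "?I' = I"
      have "(derived_subalgebra ^^ k) I = I" for k by (induction k) (simp_all add: *)
      thus False using n False by simp
    qed
    hence "?I' \<subset> I" using sub by blast
    hence dim: "dim ?I' < dim I"
      by (intro dim_psubset) (simp add: span_eq_iff[THEN iffD2, OF ID(1)] span_eq_iff[THEN iffD2, OF subspace_derived])
    have solv: "lie_solvable ?I'"
      by (rule solvable_subset[OF less.prems(5) subspace_derived, of 0]) (use sub in simp)
    \<comment> \<open>Semisimplicity passes from \<open>U/I\<close> to \<open>B/[I,I]\<close>: an
      ideal \<open>J\<close> of \<open>B\<close> that is abelian modulo \<open>[I,I]\<close> gives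
      the ideal \<open>J + I\<close> of \<open>U\<close>, abelian modulo \<open>I\<close>. So
      \<open>J\<close> lies in \<open>B \<inter> I\<close>.\<close>
    have "semisimple_mod B ?I'"
      unfolding semisimple_mod_def
    proof (intro allI impI, elim conjE)
      fix J assume J: "lie_ideal B J" "?I' \<subseteq> J" "\<forall>x\<in>J. \<forall>y\<in>J. bracket x y \<in> ?I'"
      note JD = lie_idealD[OF J(1)]
      let ?J = "{x. \<exists>j\<in>J. x - j \<in> I}"
      have ideal: "lie_ideal U ?J"
        by (rule ideal_sum[OF less.prems(1,3) B(3) _ J(1)]) (use B(6) in blast)
      note JU = lie_idealD[OF ideal]
      have I_J: "I \<subseteq> ?J"
      proof
        fix x assume "x \<in> I"
        thus "x \<in> ?J" by (intro CollectI bexI[of _ 0] subspace_0[OF JD(1)]) simp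
      qed
      have "bracket x y \<in> I" if xy: "x \<in> ?J" "y \<in> ?J" for x y
      proof -
        obtain i j where i: "i \<in> J" "x - i \<in> I" and j: "j \<in> J" "y - j \<in> I" using xy by blast
        have iU: "i \<in> U" using JD(2)[OF i(1)] B(3) by blast
        have "bracket i j \<in> I" using J(3) i(1) j(1) sub by blast
        moreover have "bracket x y = bracket i j + (bracket i (y - j) + bracket (x - i) y)"
          by (simp add: bracket_simps)
        ultimately show ?thesis
          using ID(3)[OF iU j(2)] ID(4)[OF JU(2)[OF xy(2)] i(2)] by (simp add: subspace_add[OF ID(1)])
      qed
      hence JI: "?J \<subseteq> I"
        by (intro less.prems(6)[unfolded semisimple_mod_def, rule_format] conjI ballI ideal I_J)
      have "x \<in> ?I'" if "x \<in> J" for x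
      proof -
        have "x \<in> ?J" by (intro CollectI bexI[of _ x] that) (simp add: subspace_0[OF ID(1)])
        thus ?thesis using JI B(5) JD(2)[OF that] by blast
      qed
      thus "J \<subseteq> ?I'" by blast
    qed
    from less.hyps[OF dim B(1,2,4) graded_derived[OF less.prems(4)] solv this]
    obtain A where A: "lie_subalgebra A" "graded_subspace G L A" "A \<inter> ?I' \<subseteq> {0}" "A \<subseteq> B" "\<forall>b\<in>B. \<exists>a\<in>A. b - a \<in> ?I'"
      by (elim exE conjE)
    have "A \<inter> I \<subseteq> {0}" using A(3,4) B(5) by blast
    moreover have "\<exists>a\<in>A. u - a \<in> I" if u: "u \<in> U" for u
    proof -
      obtain b where b: "b \<in> B" "u - b \<in> I" using B(6) u by blast
      obtain a where a: "a \<in> A" "b - a \<in> ?I'" using A(5) b(1) by blast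
      have "(u - b) + (b - a) \<in> I" using b(2) a(2) sub by (intro subspace_add[OF ID(1)]) auto
      thus ?thesis using a(1) by auto
    qed
    ultimately show ?thesis using A(1,2,4) B(3) by blast
  qed
qed

text \<open>Brackets of \<open>J + R\<close> agree with brackets of \<open>J\<close> modulo the
  ideal \<open>R\<close>. For solvable \<open>J\<close> some derived power of \<open>J + R\<close>
  therefore lies in \<open>R\<close>.\<close>

lemma derived_pow_sum:
  assumes R: "lie_ideal UNIV R"
  shows "(derived_subalgebra ^^ n) {x. \<exists>j\<in>J. x - j \<in> R} \<subseteq> {x. \<exists>j\<in>(derived_subalgebra ^^ n) J. x - j \<in> R}"
proof (induction n)
  case (Suc n)
  note RD = lie_idealD[OF R]
  let ?A = "(derived_subalgebra ^^ n) J"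
  have "derived_subalgebra {x. \<exists>j\<in>?A. x - j \<in> R} \<subseteq> {x. \<exists>j\<in>derived_subalgebra ?A. x - j \<in> R}"
  proof (rule derived_least[OF subspace_setsum[OF subspace_derived RD(1)]])
    fix x y assume "x \<in> {x. \<exists>j\<in>?A. x - j \<in> R}" "y \<in> {x. \<exists>j\<in>?A. x - j \<in> R}"
    then obtain i j where i: "i \<in> ?A" "x - i \<in> R" and j: "j \<in> ?A" "y - j \<in> R" by blast
    have "bracket x y - bracket i j = bracket i (y - j) + bracket (x - i) y" by (simp add: bracket_simps)
    also have "\<dots> \<in> R" by (intro subspace_add[OF RD(1)] RD(3)[OF UNIV_I j(2)] RD(4)[OF UNIV_I i(2)])
    finally show "bracket x y \<in> {x. \<exists>j\<in>derived_subalgebra ?A. x - j \<in> R}" using derived_I[OF i(1) j(1)] by blast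
  qed
  thus ?case using derived_mono[OF Suc] by simp
qed simp

end

theorem theorem4:
  fixes scale :: "'f::field_char_0 \<Rightarrow> 'v::ab_group_add \<Rightarrow> 'v"
    and bracket :: "'v \<Rightarrow> 'v \<Rightarrow> 'v"
    and G :: "('g, 'm) monoid_scheme"
    and L :: "'g \<Rightarrow> 'v set"
    and R :: "'v set"
  assumes "lie_algebra scale bracket"
    and "lie_algebra.finite_dimensional scale"
    and "group G"
    and "lie_algebra.lie_grading scale bracket G L"
    and "lie_algebra.is_solvable_radical scale bracket UNIV R"
    and "lie_algebra.graded_subspace scale G L R"
  shows "\<exists>B. lie_algebra.maximal_semisimple_subalgebra scale bracket B \<and>
           lie_algebra.graded_subspace scale G L B \<and>
           lie_algebra.graded_subspace scale G L R \<and>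
           lie_algebra.direct_sum_decomposition scale
             (UNIV :: bool set) (\<lambda>first. if first then B else R) UNIV"
proof -
  interpret lie_algebra scale bracket by (rule assms(1))
  obtain F where F: "finite F" "span F = UNIV" using assms(2) unfolding finite_dimensional_def by blast
  obtain Basis where Basis: "Basis \<subseteq> F" "independent Basis" "F \<subseteq> span Basis"
    using maximal_independent_subset[of F] by blast
  have "span Basis = UNIV" using span_minimal[OF Basis(3) subspace_span] F(2) by auto
  hence fd: "fd_space scale Basis"
    using finite_subset[OF Basis(1) F(1)] Basis(2) by unfold_locales
  interpret group G by (rule assms(3))
  interpret fd_space scale Basis by (rule fd)
  interpret graded_lie_algebra scale Basis bracket G L
    by unfold_locales (rule assms(4))
  have R: "lie_ideal UNIV R" "lie_solvable R" "\<And>I. lie_ideal UNIV I \<Longrightarrow> lie_solvable I \<Longrightarrow> I \<subseteq> R"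
    using assms(5) unfolding is_solvable_radical_def by auto
  note RD = lie_idealD[OF R(1)]
  note gR = assms(6)
  have "semisimple_mod UNIV R"
    unfolding semisimple_mod_def
  proof (intro allI impI, elim conjE)
    fix J assume J: "lie_ideal UNIV J" "R \<subseteq> J" "\<forall>x\<in>J. \<forall>y\<in>J. bracket x y \<in> R"
    have "derived_subalgebra J \<subseteq> R" by (rule derived_least[OF RD(1)]) (use J(3) in blast)
    hence "lie_solvable J" by (intro solvable_subset[OF R(2) lie_idealD(1)[OF J(1)], of 1]) simp
    thus "J \<subseteq> R" by (rule R(3)[OF J(1)])
  qed
  moreover have "lie_subalgebra UNIV" "graded_subspace G L UNIV"
    by (simp_all add: lie_subalgebra_def graded_subspace_iff)
  ultimately obtain B where B: "lie_subalgebra B" "graded_subspace G L B" "B \<inter> R \<subseteq> {0}"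
      "\<forall>u\<in>UNIV. \<exists>b\<in>B. u - b \<in> R"
    using graded_levi[of UNIV R] R gR by blast
  have sB: "subspace B" using B(1) by (simp add: lie_subalgebra_def)
  have z0: "lie_solvable {0}" by (rule solvableI[of _ 0]) simp_all
  have "is_solvable_radical B {0}"
    unfolding is_solvable_radical_def
  proof (intro conjI allI impI)
    show "lie_ideal B {0}" using subspace_0[OF sB] by (simp add: lie_ideal_def bracket_simps)
    show "lie_solvable {0}" by (rule z0)
    fix J assume "lie_ideal B J \<and> lie_solvable J"
    hence J: "lie_ideal B J" "lie_solvable J" by auto
    note JD = lie_idealD[OF J(1)]
    \<comment> \<open>The sum \<open>J + R\<close> is an ideal of the whole algebra and is solvable
      together with \<open>J\<close> and \<open>R\<close>. Hence it lies in the radical, and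
      \<open>J\<close> lies in \<open>B \<inter> R\<close>.\<close>
    let ?J = "{x. \<exists>j\<in>J. x - j \<in> R}"
    have ideal: "lie_ideal UNIV ?J"
      by (rule ideal_sum[OF _ R(1) _ _ J(1)]) (use B(4) in \<open>simp_all add: lie_subalgebra_def\<close>)
    obtain n where "(derived_subalgebra ^^ n) J = {0}" using J(2) unfolding lie_solvable_def by blast
    hence "(derived_subalgebra ^^ n) ?J \<subseteq> R" using derived_pow_sum[OF R(1), of n J] by auto
    hence "lie_solvable ?J" by (rule solvable_subset[OF R(2) lie_idealD(1)[OF ideal]])
    hence JR: "?J \<subseteq> R" by (rule R(3)[OF ideal])
    show "J \<subseteq> {0}"
    proof
      fix x assume x: "x \<in> J"
      hence "x \<in> ?J" by (intro CollectI bexI[of _ x]) (simp_all add: subspace_0[OF RD(1)])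
      thus "x \<in> {0}" using JR JD(2)[OF x] B(3) by blast
    qed
  qed
  hence ssB: "semisimple_subalgebra B" using B(1) by (simp add: semisimple_subalgebra_def)
  have "maximal_semisimple_subalgebra B"
    unfolding maximal_semisimple_subalgebra_def
  proof (intro conjI allI impI ssB)
    fix C assume "semisimple_subalgebra C \<and> B \<subseteq> C"
    hence C: "lie_subalgebra C" "is_solvable_radical C {0}" "B \<subseteq> C" by (auto simp: semisimple_subalgebra_def)
    have sC: "subspace C" using C(1) by (simp add: lie_subalgebra_def)
    have sCR: "subspace (C \<inter> R)" by (rule subspace_inter[OF sC RD(1)])
    \<comment> \<open>A semisimple \<open>C\<close> meets the radical in a solvable ideal, hence in
      zero. If \<open>C\<close> contains \<open>B\<close>, the \<open>R\<close>-part of any element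
      of \<open>C\<close> again lies in \<open>C\<close> and so vanishes.\<close>
    have "lie_ideal C (C \<inter> R)"
      using C(1) RD(3) sCR by (auto simp: lie_ideal_def lie_subalgebra_def)
    moreover have "lie_solvable (C \<inter> R)"
      by (rule solvable_subset[OF R(2) sCR, of 0]) simp
    ultimately have CR: "C \<inter> R \<subseteq> {0}" using C(2) unfolding is_solvable_radical_def by blast
    have "c \<in> B" if c: "c \<in> C" for c
    proof -
      obtain b where b: "b \<in> B" "c - b \<in> R" using B(4) by blast
      have "c - b \<in> C" using c b(1) C(3) by (intro subspace_diff[OF sC]) auto
      hence "c - b = 0" using CR b(2) by blast
      thus ?thesis using b(1) by simp
    qed
    thus "C = B" using C(3) by blast
  qed
  moreover have "direct_sum_decomposition (UNIV :: bool set) (\<lambda>first. if first then B else R) UNIV"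
    unfolding direct_sum_decomposition_def
  proof (intro conjI ballI)
    fix x
    have supp: "(\<Sum>i\<in>{i\<in>UNIV. c i \<noteq> 0}. c i) = c True + c False" for c :: "bool \<Rightarrow> 'v"
    proof -
      have "(\<Sum>i\<in>{i\<in>UNIV. c i \<noteq> 0}. c i) = (\<Sum>i\<in>UNIV. c i)" by (rule sum.mono_neutral_left) auto
      thus ?thesis by (simp add: UNIV_bool add.commute)
    qed
    obtain b where b: "b \<in> B" "x - b \<in> R" using B(4) by blast
    show "\<exists>!c. (\<forall>i\<in>UNIV. c i \<in> (if i then B else R)) \<and> (\<forall>i. i \<notin> UNIV \<longrightarrow> c i = 0) \<and>
        finite {i\<in>UNIV. c i \<noteq> 0} \<and> x = (\<Sum>i\<in>{i\<in>UNIV. c i \<noteq> 0}. c i)"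
      unfolding supp
    proof (rule ex1I[of _ "\<lambda>i. if i then b else x - b"])
      fix c :: "bool \<Rightarrow> 'v"
      assume "(\<forall>i\<in>UNIV. c i \<in> (if i then B else R)) \<and> (\<forall>i. i \<notin> UNIV \<longrightarrow> c i = 0) \<and>
          finite {i\<in>UNIV. c i \<noteq> 0} \<and> x = c True + c False"
      hence *: "\<forall>i. c i \<in> (if i then B else R)" and x: "x = c True + c False" by auto
      have c: "c True \<in> B" "c False \<in> R" using *[rule_format, of True] *[rule_format, of False] by simp_all
      have "c True - b \<in> B" using c(1) b(1) by (rule subspace_diff[OF sB])
      moreover have "c True - b = (x - b) - c False" using x by simp
      hence "c True - b \<in> R" using subspace_diff[OF RD(1) b(2) c(2)] by (simp only:)
      ultimately have "c True = b" using B(3) by auto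
      thus "c = (\<lambda>i. if i then b else x - b)" using x by (auto simp: fun_eq_iff)
    qed (use b in auto)
  qed (use sB RD(1) in auto)
  ultimately show ?thesis using B(2) gR by blast
qed

end
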